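(* If $\mu\in\mathrm{VConv}_k(U,F)$ vanishes on all $k$-dimensional subspaces in $\mathbb{R}^n$, then $\mu=0$. In particular, $\mu\in\mathrm{VConv}(U,F)$ is dually simple if and only if $\mu$ is $n$-homogeneous.
   Context: $F$ is a locally convex vector space, $U\subset\mathbb{R}^n$ open convex, $\mathrm{Conv}(U,\mathbb{R})$ the finite-valued convex functions on $U$ (uniform convergence on compacts). $\mathrm{VConv}(U,F)$ is the space of continuous valuations $\mu:\mathrm{Conv}(U,\mathbb{R})\to F$ with $\mu(f+l)=\mu(f)$ for all affine $l$; $\mathrm{VConv}_k(U,F)$ the $k$-homogeneous ones ($\mu(tf)=t^k\mu(f)$, $t\ge0$). $\mu$ vanishes on a subspace $E$ if $\mu(\pi_E^*f|_U)=0$ for all $f\in\mathrm{Conv}(E,\mathbb{R})$, where $\pi_E$ is the orthogonal projection onto $E$; $\mu$ is dually simple if it vanishes on all proper subspaces. *)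

theory Defs
  imports "HOL-Analysis.Analysis"
begin

definition seminorm :: "('f::real_vector \<Rightarrow> real) \<Rightarrow> bool" where
  "seminorm p \<longleftrightarrow> (\<forall>x y. p (x + y) \<le> p x + p y) \<and> (\<forall>c x. p (c *\<^sub>R x) = \<bar>c\<bar> * p x)"

text \<open>A (Hausdorff) locally convex space: the topology of the real vector space is
  generated by the family P of seminorms, which separates points.\<close>
definition lc_seminorms :: "('f::real_vector \<Rightarrow> real) set \<Rightarrow> bool" where
  "lc_seminorms P \<longleftrightarrow> (\<forall>p\<in>P. seminorm p) \<and> (\<forall>x. (\<forall>p\<in>P. p x = 0) \<longrightarrow> x = 0)"

definition lc_tendsto :: "('f::real_vector \<Rightarrow> real) set \<Rightarrow> (nat \<Rightarrow> 'f) \<Rightarrow> 'f \<Rightarrow> bool" where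
  "lc_tendsto P xs x \<longleftrightarrow> (\<forall>p\<in>P. (\<lambda>j. p (xs j - x)) \<longlonglongrightarrow> 0)"

text \<open>Functions on U are represented extensionally: values outside U are 0.\<close>
definition restr :: "'a set \<Rightarrow> ('a \<Rightarrow> real) \<Rightarrow> 'a \<Rightarrow> real" where
  "restr U f = (\<lambda>x. if x \<in> U then f x else 0)"

definition ConvF :: "'a::real_vector set \<Rightarrow> ('a \<Rightarrow> real) set" where
  "ConvF U = {f. convex_on U f \<and> (\<forall>x. x \<notin> U \<longrightarrow> f x = 0)}"

definition affine_fun :: "('a::euclidean_space \<Rightarrow> real) \<Rightarrow> bool" where
  "affine_fun l \<longleftrightarrow> (\<exists>a b. \<forall>x. l x = a \<bullet> x + b)"

text \<open>Continuity w.r.t. uniform convergence on compact subsets of U (the domain is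
  metrizable, so sequential continuity).\<close>
definition cont_val :: "'a::euclidean_space set \<Rightarrow> ('f::real_vector \<Rightarrow> real) set
    \<Rightarrow> (('a \<Rightarrow> real) \<Rightarrow> 'f) \<Rightarrow> bool" where
  "cont_val U P \<mu> \<longleftrightarrow> (\<forall>fs f. (\<forall>j. fs j \<in> ConvF U) \<longrightarrow> f \<in> ConvF U \<longrightarrow>
      (\<forall>K. compact K \<longrightarrow> K \<subseteq> U \<longrightarrow> uniform_limit K fs f sequentially) \<longrightarrow>
      lc_tendsto P (\<lambda>j. \<mu> (fs j)) (\<mu> f))"

definition is_valuation :: "'a::euclidean_space set \<Rightarrow> (('a \<Rightarrow> real) \<Rightarrow> 'f::real_vector) \<Rightarrow> bool" where
  "is_valuation U \<mu> \<longleftrightarrow> (\<forall>f\<in>ConvF U. \<forall>g\<in>ConvF U.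
      convex_on U (\<lambda>x. min (f x) (g x)) \<longrightarrow>
      \<mu> f + \<mu> g = \<mu> (\<lambda>x. max (f x) (g x)) + \<mu> (\<lambda>x. min (f x) (g x)))"

definition VConv :: "'a::euclidean_space set \<Rightarrow> ('f::real_vector \<Rightarrow> real) set
    \<Rightarrow> (('a \<Rightarrow> real) \<Rightarrow> 'f) \<Rightarrow> bool" where
  "VConv U P \<mu> \<longleftrightarrow> is_valuation U \<mu> \<and> cont_val U P \<mu> \<and>
     (\<forall>f\<in>ConvF U. \<forall>l. affine_fun l \<longrightarrow> \<mu> (restr U (\<lambda>x. f x + l x)) = \<mu> f)"

definition homogeneous_of :: "'a::euclidean_space set \<Rightarrow> nat \<Rightarrow> (('a \<Rightarrow> real) \<Rightarrow> 'f::real_vector) \<Rightarrow> bool" where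
  "homogeneous_of U k \<mu> \<longleftrightarrow> (\<forall>f\<in>ConvF U. \<forall>t::real. t \<ge> 0 \<longrightarrow> \<mu> (\<lambda>x. t * f x) = t ^ k *\<^sub>R \<mu> f)"

definition VConvk :: "'a::euclidean_space set \<Rightarrow> ('f::real_vector \<Rightarrow> real) set \<Rightarrow> nat
    \<Rightarrow> (('a \<Rightarrow> real) \<Rightarrow> 'f) \<Rightarrow> bool" where
  "VConvk U P k \<mu> \<longleftrightarrow> VConv U P \<mu> \<and> homogeneous_of U k \<mu>"

definition orth_proj :: "'a::euclidean_space set \<Rightarrow> 'a \<Rightarrow> 'a" where
  "orth_proj E x = (THE y. y \<in> E \<and> (\<forall>z\<in>E. (x - y) \<bullet> z = 0))"

definition vanishes_on :: "'a::euclidean_space set \<Rightarrow> (('a \<Rightarrow> real) \<Rightarrow> 'f::real_vector) \<Rightarrow> 'a set \<Rightarrow> bool" where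
  "vanishes_on U \<mu> E \<longleftrightarrow> (\<forall>f. convex_on E f \<longrightarrow> \<mu> (restr U (\<lambda>x. f (orth_proj E x))) = 0)"

definition dually_simple :: "'a::euclidean_space set \<Rightarrow> (('a \<Rightarrow> real) \<Rightarrow> 'f::real_vector) \<Rightarrow> bool" where
  "dually_simple U \<mu> \<longleftrightarrow> (\<forall>E. subspace E \<and> E \<noteq> UNIV \<longrightarrow> vanishes_on U \<mu> E)"

end

theory Submission
  imports Defs "HOL-Probability.Distributions"
begin

text \<open>
  A hinge is a function \<open>x \<mapsto> max (u \<bullet> x - a) 0\<close>. The valuation property yields a shear relation
  between difference operators along hinges, which makes iterated differences multilinear and makes
  them vanish as soon as the directions \<open>u\<close> are linearly dependent. A \<open>k\<close>-homogeneous valuation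
  therefore has only iterated differences of order \<open>k\<close>, taken along \<open>k\<close> independent directions, and
  these only see functions pulled back from a \<open>k\<close>-dimensional subspace.

  It remains to see that a valuation vanishing on all sums of hinges is zero. Locally uniform limits
  of such sums (up to affine functions) include all sums of convex ridge functions; since a Gaussian is
  a limit of averages of cosines and \<open>cos t + t\<^sup>2 / 2\<close> is convex, every Gaussian plus a multiple of
  \<open>(norm x)\<^sup>2\<close> is such a limit. Every convex function is a limit of convex functions that agree with
  \<open>(norm x)\<^sup>2\<close> up to a constant outside a compact set, and convolution with a Gaussian turns those into
  functions \<open>F\<close> for which \<open>F + s (norm x)\<^sup>2\<close> lies in the cone for large \<open>s\<close>. As the valuation
  depends polynomially on the coefficients of the added squares, it vanishes at \<open>s = 0\<close> too.
\<close>

section \<open>Iterated differences along hinges\<close>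

text \<open>The obstacle is that from dimension two on, limits of hinge sums form a proper subcone
  of the convex functions: \<open>max x (max y 0)\<close> on the plane is no such limit, for the
  same reason that a triangle is no zonotope. Vanishing on hinge sums therefore does not spread by
  density alone. A multiple of the squared norm is added to enter the cone, and it can be removed
  again because second differences along parallel hinges vanish, so that \<open>m\<close> is affine
  in the weight of each coordinate square. Degrees are separated by a discrete Taylor expansion: the
  value on a hinge sum is a sum of iterated differences at 0, and a difference of order
  \<open>j\<close> scales with \<open>t ^ j\<close>. Identities between two valuations, such as
  homogeneity for a fixed \<open>t\<close>, are proved by applying the vanishing criterion to their
  difference. That an n-homogeneous valuation is dually simple follows in the same way, after a
  pullback along the projection: differences of order n then have all their directions in a proper
  subspace.\<close>

lemma seminormD:
  assumes "seminorm p"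
  shows "p (x + y) \<le> p x + p y" "p (c *\<^sub>R x) = \<bar>c\<bar> * p x" "p 0 = 0" "0 \<le> p x" "p (- x) = p x"
proof -
  show tri: "p (x + y) \<le> p x + p y" for x y
    using assms by (simp add: seminorm_def)
  show sc: "p (c *\<^sub>R x) = \<bar>c\<bar> * p x" for c x
    using assms by (simp add: seminorm_def)
  show z: "p 0 = 0"
    using sc[of 0 0] by simp
  show neg: "p (- x) = p x" for x
    using sc[of "-1" x] by simp
  show "0 \<le> p x"
    using tri[of x "- x"] neg[of x] z by simp
qed

lemma lc_tendsto_unique:
  assumes "lc_seminorms P" "lc_tendsto P xs x" "lc_tendsto P xs y"
  shows "x = y"
proof -
  have "p (x - y) = 0" if "p \<in> P" for p
  proof -
    have sn: "seminorm p"
      using assms(1) that by (simp add: lc_seminorms_def)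
    have "(\<lambda>j. p (xs j - x) + p (xs j - y)) \<longlonglongrightarrow> 0 + 0"
      using assms(2,3) that by (intro tendsto_add) (auto simp: lc_tendsto_def)
    moreover have "p (x - y) \<le> p (xs j - x) + p (xs j - y)" for j
      using seminormD(1)[OF sn, of "x - xs j" "xs j - y"] seminormD(5)[OF sn, of "xs j - x"] by simp
    ultimately have "p (x - y) \<le> 0"
      by (intro LIMSEQ_le_const) auto
    then show ?thesis
      using seminormD(4)[OF sn, of "x - y"] by simp
  qed
  then show ?thesis
    using assms(1) unfolding lc_seminorms_def by (metis right_minus_eq)
qed

lemma lc_tendsto_const: "lc_seminorms P \<Longrightarrow> lc_tendsto P (\<lambda>_. x) x"
  by (simp add: lc_tendsto_def lc_seminorms_def seminormD(3))

lemma lc_tendsto_diff: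
  assumes "lc_seminorms P" "lc_tendsto P xs x" "lc_tendsto P ys y"
  shows "lc_tendsto P (\<lambda>j. xs j - ys j) (x - y)"
  unfolding lc_tendsto_def
proof
  fix p assume p: "p \<in> P"
  have sn: "seminorm p"
    using assms(1) p by (simp add: lc_seminorms_def)
  have lim: "(\<lambda>j. p (xs j - x) + p (ys j - y)) \<longlonglongrightarrow> 0"
    using tendsto_add[of "\<lambda>j. p (xs j - x)" 0 sequentially "\<lambda>j. p (ys j - y)" 0] assms(2,3) p
    by (simp add: lc_tendsto_def)
  have le: "p (xs j - ys j - (x - y)) \<le> p (xs j - x) + p (ys j - y)" for j
    using seminormD(1)[OF sn, of "xs j - x" "- (ys j - y)"] seminormD(5)[OF sn, of "ys j - y"]
    by (simp add: algebra_simps)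
  show "(\<lambda>j. p (xs j - ys j - (x - y))) \<longlonglongrightarrow> 0"
    by (rule tendsto_sandwich[OF _ _ tendsto_const lim]) (auto simp: le seminormD(4)[OF sn])
qed

lemma lc_tendsto_scaleR:
  assumes "lc_seminorms P" "lc_tendsto P xs x"
  shows "lc_tendsto P (\<lambda>j. c *\<^sub>R xs j) (c *\<^sub>R x)"
  unfolding lc_tendsto_def
proof
  fix p assume p: "p \<in> P"
  have sn: "seminorm p"
    using assms(1) p by (simp add: lc_seminorms_def)
  have "(\<lambda>j. \<bar>c\<bar> * p (xs j - x)) \<longlonglongrightarrow> \<bar>c\<bar> * 0"
    using assms(2) p by (intro tendsto_intros) (auto simp: lc_tendsto_def)
  then show "(\<lambda>j. p (c *\<^sub>R xs j - c *\<^sub>R x)) \<longlonglongrightarrow> 0"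
    by (simp add: seminormD(2)[OF sn] flip: scaleR_diff_right)
qed

lemma lc_tendsto_scaleR_left:
  assumes "lc_seminorms P" "cs \<longlonglongrightarrow> c"
  shows "lc_tendsto P (\<lambda>j. cs j *\<^sub>R x) (c *\<^sub>R x)"
  unfolding lc_tendsto_def
proof
  fix p assume p: "p \<in> P"
  have sn: "seminorm p"
    using assms(1) p by (simp add: lc_seminorms_def)
  have "(\<lambda>j. \<bar>cs j - c\<bar> * p x) \<longlonglongrightarrow> \<bar>c - c\<bar> * p x"
    using assms(2) by (intro tendsto_intros)
  then show "(\<lambda>j. p (cs j *\<^sub>R x - c *\<^sub>R x)) \<longlonglongrightarrow> 0"
    by (simp add: seminormD(2)[OF sn] flip: scaleR_diff_left)
qed

text \<open>Cauchy's functional equation on the half-line: additivity settles rational arguments,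
  continuity the rest, since limits are unique when the seminorms separate points.\<close>

lemma additive_continuous_imp_linear:
  fixes a :: "real \<Rightarrow> 'f::real_vector"
  assumes P: "lc_seminorms P"
    and add: "\<And>s t. \<lbrakk>0 \<le> s; 0 \<le> t\<rbrakk> \<Longrightarrow> a (s + t) = a s + a t"
    and cont: "\<And>ts t. \<lbrakk>\<And>j. 0 \<le> ts j; 0 \<le> t; ts \<longlonglongrightarrow> t\<rbrakk> \<Longrightarrow> lc_tendsto P (\<lambda>j. a (ts j)) (a t)"
    and t: "0 \<le> t"
  shows "a t = t *\<^sub>R a 1"
proof -
  have nat: "a (of_nat n * s) = of_nat n *\<^sub>R a s" if "0 \<le> s" for n s
  proof (induction n)
    case 0
    show ?case using add[of 0 0] by simp
  next
    case (Suc n)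
    then show ?case using add[of s "of_nat n * s"] that by (simp add: algebra_simps)
  qed
  \<comment> \<open>Rational approximations from below with denominator \<open>Suc j\<close>; the
    floor keeps them nonnegative, where additivity is assumed.\<close>
  define ts where "ts j = real (nat \<lfloor>t * Suc j\<rfloor>) / Suc j" for j :: nat
  have rat: "a (ts j) = ts j *\<^sub>R a 1" for j
  proof -
    have "a (ts j) = real (nat \<lfloor>t * Suc j\<rfloor>) *\<^sub>R a (1 / Suc j)"
      using nat[of "1 / Suc j" "nat \<lfloor>t * Suc j\<rfloor>"] by (simp add: ts_def)
    moreover have "a 1 = real (Suc j) *\<^sub>R a (1 / Suc j)"
      using nat[of "1 / Suc j" "Suc j"] by simp
    ultimately show ?thesis
      by (simp add: ts_def del: of_nat_Suc)
  qed
  have lim: "ts \<longlonglongrightarrow> t"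
  proof (rule tendsto_sandwich)
    have fl: "real (nat \<lfloor>t * Suc j\<rfloor>) = of_int \<lfloor>t * Suc j\<rfloor>" for j
      using t by (intro of_nat_nat) simp
    show "\<forall>\<^sub>F j in sequentially. t - 1 / Suc j \<le> ts j"
    proof (intro always_eventually allI)
      fix j :: nat
      have "t * Suc j - 1 \<le> of_int \<lfloor>t * Suc j\<rfloor>" by linarith
      then have "(t * Suc j - 1) / Suc j \<le> ts j"
        unfolding ts_def fl by (rule divide_right_mono) simp
      then show "t - 1 / Suc j \<le> ts j"
        by (simp add: diff_divide_distrib del: of_nat_Suc)
    qed
    show "\<forall>\<^sub>F j in sequentially. ts j \<le> t"
      by (intro always_eventually allI) (simp add: ts_def fl field_simps del: of_nat_Suc)
    show "(\<lambda>j. t - 1 / Suc j) \<longlonglongrightarrow> t"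
      using tendsto_diff[OF tendsto_const LIMSEQ_inverse_real_of_nat, of t]
      by (simp add: inverse_eq_divide)
  qed simp
  have "lc_tendsto P (\<lambda>j. a (ts j)) (a t)"
    by (intro cont t lim) (simp add: ts_def)
  moreover have "lc_tendsto P (\<lambda>j. a (ts j)) (t *\<^sub>R a 1)"
    unfolding rat by (rule lc_tendsto_scaleR_left[OF P lim])
  ultimately show ?thesis
    by (rule lc_tendsto_unique[OF P])
qed

section \<open>Convex functions and hinges\<close>

lemma convex_on_cong:
  assumes "convex_on S f" "\<And>x. x \<in> S \<Longrightarrow> f x = g x"
  shows "convex_on S g"
proof (rule convex_onI)
  show "convex S"
    using assms(1) by (rule convex_on_imp_convex)
  fix t :: real and x y assume *: "0 < t" "t < 1" "x \<in> S" "y \<in> S"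
  then have "(1 - t) *\<^sub>R x + t *\<^sub>R y \<in> S"
    using \<open>convex S\<close> by (simp add: convex_alt)
  then show "g ((1 - t) *\<^sub>R x + t *\<^sub>R y) \<le> (1 - t) * g x + t * g y"
    using convex_onD[OF assms(1), of t x y] * assms(2) by simp
qed

lemma convex_on_max:
  assumes "convex_on S f" "convex_on S g"
  shows "convex_on S (\<lambda>x. max (f x) (g x))"
proof (rule convex_onI)
  fix t :: real and x y assume *: "0 < t" "t < 1" "x \<in> S" "y \<in> S"
  let ?z = "(1 - t) *\<^sub>R x + t *\<^sub>R y"
  have "f ?z \<le> (1 - t) * f x + t * f y" "g ?z \<le> (1 - t) * g x + t * g y"
    using * by (auto intro: convex_onD[OF assms(1)] convex_onD[OF assms(2)])
  moreover have "(1 - t) * f x + t * f y \<le> (1 - t) * max (f x) (g x) + t * max (f y) (g y)"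
      "(1 - t) * g x + t * g y \<le> (1 - t) * max (f x) (g x) + t * max (f y) (g y)"
    using * by (auto intro!: add_mono mult_left_mono)
  ultimately show "max (f ?z) (g ?z) \<le> (1 - t) * max (f x) (g x) + t * max (f y) (g y)"
    by linarith
qed (use assms convex_on_imp_convex in blast)

lemma convex_on_affine_function:
  fixes a :: "'a::euclidean_space"
  assumes "convex S"
  shows "convex_on S (\<lambda>x. a \<bullet> x + b)"
proof (rule convex_onI)
  fix t :: real and x y
  have "t * b + (1 - t) * b = b" by (simp add: algebra_simps)
  then show "a \<bullet> ((1 - t) *\<^sub>R x + t *\<^sub>R y) + b \<le> (1 - t) * (a \<bullet> x + b) + t * (a \<bullet> y + b)"
    by (simp add: inner_add_right algebra_simps)
qed (use assms in auto)

text \<open>A nonnegative weight needs no parameter of its own: by \<open>hinge_scale\<close> it is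
  absorbed into \<open>(u, a)\<close>, so lists of pairs encode all nonnegative
  combinations.\<close>

definition hinge :: "'a::euclidean_space \<Rightarrow> real \<Rightarrow> 'a \<Rightarrow> real" where
  "hinge u a x = max (u \<bullet> x - a) 0"

lemma hinge_scale: "0 \<le> t \<Longrightarrow> hinge (t *\<^sub>R u) (t * a) x = t * hinge u a x"
  by (simp add: hinge_def max_mult_distrib_left right_diff_distrib)

lemma hinge_flip: "hinge u a x = hinge (- u) (- a) x + (u \<bullet> x - a)"
  by (simp add: hinge_def max_def)

lemma convex_on_hinge: "convex S \<Longrightarrow> convex_on S (hinge u a)"
  using convex_on_max[OF convex_on_affine_function[of S u "- a"] convex_on_affine_function[of S 0 0]]
  by (simp add: hinge_def[abs_def])

definition diff_op :: "('a \<Rightarrow> real) \<Rightarrow> (('a \<Rightarrow> real) \<Rightarrow> 'f) \<Rightarrow> ('a \<Rightarrow> real) \<Rightarrow> 'f::real_vector" where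
  "diff_op h m F = m (\<lambda>x. F x + h x) - m F"

lemma diff_op_commute: "diff_op g (diff_op h m) F = diff_op h (diff_op g m) F"
  by (simp add: diff_op_def ac_simps)

text \<open>Read each maximum as the support function of a convex hull. The triangles {0, p, p+q}
  and {0, q, p+q} have as union the parallelogram on p, q and meet in the diagonal [0, p+q].
  Translated by p, the second triangle forms with the first the parallelogram on p, p+q, and they
  meet in [p, p+q].\<close>

lemma parallelogram_triangles:
  fixes p q :: real
  shows "max (max p (max (p + q) 0)) (max q (max (p + q) 0)) = max p 0 + max q 0"
    and "min (max p (max (p + q) 0)) (max q (max (p + q) 0)) = max (p + q) 0"
    and "max (max p (max (p + q) 0)) (max q (max (p + q) 0) + p) = max p 0 + max (p + q) 0"
    and "min (max p (max (p + q) 0)) (max q (max (p + q) 0) + p) = max q 0 + p"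
  by linarith+

text \<open>Functions are total and only their values on \<open>U\<close> matter
  (\<open>cong\<close>), so sums and pullbacks need no \<open>restr\<close>. The axioms are those
  inherited by differences, linear combinations and pullbacks, so every result can be applied again
  to derived valuations; homogeneity is kept apart because differences destroy it.\<close>

locale dual_valuation =
  fixes U :: "'n::euclidean_space set" and P :: "('f::real_vector \<Rightarrow> real) set"
    and m :: "('n \<Rightarrow> real) \<Rightarrow> 'f"
  assumes lc: "lc_seminorms P" and open_U: "open U" and convex_U: "convex U"
    and val: "\<lbrakk>convex_on U F; convex_on U G; convex_on U (\<lambda>x. min (F x) (G x))\<rbrakk>
      \<Longrightarrow> m F + m G = m (\<lambda>x. max (F x) (G x)) + m (\<lambda>x. min (F x) (G x))"
    and aff: "convex_on U F \<Longrightarrow> m (\<lambda>x. F x + (a \<bullet> x + b)) = m F"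
    and cong: "(\<And>x. x \<in> U \<Longrightarrow> F x = G x) \<Longrightarrow> m F = m G"
    and cont: "\<lbrakk>\<And>j. convex_on U (Fs j); convex_on U F;
        \<And>K. \<lbrakk>compact K; K \<subseteq> U\<rbrakk> \<Longrightarrow> uniform_limit K Fs F sequentially\<rbrakk>
      \<Longrightarrow> lc_tendsto P (\<lambda>j. m (Fs j)) (m F)"
begin

lemma hinge_convex: "convex_on U (hinge u a)"
  using convex_on_hinge convex_U .

lemma val_eq:
  assumes "convex_on U F" "convex_on U G" "convex_on U N"
    and "\<And>x. x \<in> U \<Longrightarrow> max (F x) (G x) = M x" "\<And>x. x \<in> U \<Longrightarrow> min (F x) (G x) = N x"
  shows "m F + m G = m M + m N"
proof -
  have "convex_on U (\<lambda>x. min (F x) (G x))"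
    using assms(3) by (rule convex_on_cong) (simp add: assms(5))
  from val[OF assms(1,2) this] show ?thesis
    using cong[of "\<lambda>x. max (F x) (G x)" M] cong[of "\<lambda>x. min (F x) (G x)" N] assms(4,5) by simp
qed

lemma aff_eq:
  assumes "convex_on U F" "\<And>x. x \<in> U \<Longrightarrow> G x = F x + (a \<bullet> x + b)"
  shows "m G = m F"
  using cong[of G "\<lambda>x. F x + (a \<bullet> x + b)"] aff[OF assms(1), of a b] assms(2) by simp

lemma dual_valuation_diff_op:
  assumes h: "convex_on U h"
  shows "dual_valuation U P (diff_op h m)"
proof
  fix F G assume F: "convex_on U F" and G: "convex_on U G"
    and FG: "convex_on U (\<lambda>x. min (F x) (G x))"
  have "m (\<lambda>x. F x + h x) + m (\<lambda>x. G x + h x)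
      = m (\<lambda>x. max (F x) (G x) + h x) + m (\<lambda>x. min (F x) (G x) + h x)"
  proof (rule val_eq)
    show "max (F x + h x) (G x + h x) = max (F x) (G x) + h x"
      "min (F x + h x) (G x + h x) = min (F x) (G x) + h x" for x
      by (simp_all add: max_def min_def)
  qed (intro convex_on_add F G FG h)+
  with val[OF F G FG] show "diff_op h m F + diff_op h m G
      = diff_op h m (\<lambda>x. max (F x) (G x)) + diff_op h m (\<lambda>x. min (F x) (G x))"
    by (simp add: diff_op_def algebra_simps)
next
  fix F a b assume F: "convex_on U F"
  have "m (\<lambda>x. F x + (a \<bullet> x + b) + h x) = m (\<lambda>x. F x + h x)"
    by (rule aff_eq[where a = a and b = b]) (auto intro!: convex_on_add F h)
  with aff[OF F] show "diff_op h m (\<lambda>x. F x + (a \<bullet> x + b)) = diff_op h m F"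
    by (simp add: diff_op_def)
next
  fix F G :: "'n \<Rightarrow> real" assume "\<And>x. x \<in> U \<Longrightarrow> F x = G x"
  then show "diff_op h m F = diff_op h m G"
    using cong[of F G] cong[of "\<lambda>x. F x + h x" "\<lambda>x. G x + h x"] by (simp add: diff_op_def)
next
  fix Fs F assume Fs: "\<And>j. convex_on U (Fs j)" and F: "convex_on U F"
    and lim: "\<And>K. compact K \<Longrightarrow> K \<subseteq> U \<Longrightarrow> uniform_limit K Fs F sequentially"
  show "lc_tendsto P (\<lambda>j. diff_op h m (Fs j)) (diff_op h m F)"
    unfolding diff_op_def
    by (intro lc_tendsto_diff lc cont Fs F lim convex_on_add h uniform_limit_add uniform_limit_const)
qed (use lc open_U convex_U in auto)

text \<open>Both parallelograms, spanned by u, v and by u, u + v, are unions of translates of the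
  same two triangles; the diagonals they are cut along give the two remaining terms.\<close>
lemma shear_identity:
  assumes g: "convex_on U g"
  shows "m (\<lambda>x. g x + hinge u a x + hinge v b x) + m (\<lambda>x. g x + hinge (u + v) (a + b) x)
    = m (\<lambda>x. g x + hinge u a x + hinge (u + v) (a + b) x) + m (\<lambda>x. g x + hinge v b x)"
proof -
  define p where "p x = u \<bullet> x - a" for x
  define q where "q x = v \<bullet> x - b" for x
  have h: "hinge u a x = max (p x) 0" "hinge v b x = max (q x) 0"
    "hinge (u + v) (a + b) x = max (p x + q x) 0" for x
    by (simp_all add: hinge_def p_def q_def inner_add_left algebra_simps)
  define T1 where "T1 x = g x + max (p x) (max (p x + q x) 0)" for x
  define T2 where "T2 x = g x + max (q x) (max (p x + q x) 0)" for x
  have cp: "convex_on U p" "convex_on U q"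
    using convex_on_affine_function[OF convex_U, of u "- a"] convex_on_affine_function[OF convex_U, of v "- b"]
    by (simp_all add: p_def[abs_def] q_def[abs_def])
  have T: "convex_on U T1" "convex_on U T2" "convex_on U (\<lambda>x. T2 x + (u \<bullet> x + - a))"
    unfolding T1_def[abs_def] T2_def[abs_def]
    by (intro convex_on_add g convex_on_max cp convex_on_affine_function convex_U
        convex_on_const[THEN iffD2])+
  have "m T1 + m T2 = m (\<lambda>x. g x + hinge u a x + hinge v b x) + m (\<lambda>x. g x + hinge (u + v) (a + b) x)"
  proof (rule val_eq)
    show "max (T1 x) (T2 x) = g x + hinge u a x + hinge v b x"
      "min (T1 x) (T2 x) = g x + hinge (u + v) (a + b) x" for x
      unfolding T1_def T2_def h add.assoc max_add_distrib_right[symmetric] min_add_distrib_right[symmetric]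
        parallelogram_triangles by simp_all
  qed (intro T convex_on_add g hinge_convex)+
  \<comment> \<open>Translating the second triangle adds an affine function, which \<open>m\<close>
    does not see; both decompositions thus have the same left side, and comparing their right sides
    gives the claim.\<close>
  moreover have "m T1 + m (\<lambda>x. T2 x + (u \<bullet> x + - a))
      = m (\<lambda>x. g x + hinge u a x + hinge (u + v) (a + b) x)
        + m (\<lambda>x. g x + hinge v b x + (u \<bullet> x + - a))"
  proof (rule val_eq)
    show "convex_on U (\<lambda>x. g x + hinge v b x + (u \<bullet> x + - a))"
      by (intro convex_on_add g hinge_convex convex_on_affine_function convex_U)
    have e: "u \<bullet> x + - a = p x" for x by (simp add: p_def)
    show "max (T1 x) (T2 x + (u \<bullet> x + - a)) = g x + hinge u a x + hinge (u + v) (a + b) x"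
      "min (T1 x) (T2 x + (u \<bullet> x + - a)) = g x + hinge v b x + (u \<bullet> x + - a)" for x
      unfolding e T1_def T2_def h add.assoc max_add_distrib_right[symmetric] min_add_distrib_right[symmetric]
        parallelogram_triangles by simp_all
  qed (fact T)+
  moreover have "m (\<lambda>x. T2 x + (u \<bullet> x + - a)) = m T2"
    by (rule aff[OF T(2)])
  moreover have "m (\<lambda>x. g x + hinge v b x + (u \<bullet> x + - a)) = m (\<lambda>x. g x + hinge v b x)"
    by (intro aff convex_on_add g hinge_convex)
  ultimately show ?thesis by simp
qed

lemma diff_hinge_flip:
  assumes g: "convex_on U g"
  shows "diff_op (hinge (- u) (- a)) m g = diff_op (hinge u a) m g"
proof -
  have "m (\<lambda>x. g x + hinge u a x) = m (\<lambda>x. g x + hinge (- u) (- a) x)"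
    by (rule aff_eq[where a = u and b = "- a"])
      (auto intro!: convex_on_add g hinge_convex simp: hinge_flip[of u a])
  then show ?thesis by (simp add: diff_op_def)
qed

lemma diff_hinge_const:
  assumes g: "convex_on U g"
  shows "diff_op (hinge 0 a) m g = 0"
proof -
  have "m (\<lambda>x. g x + hinge 0 a x) = m g"
    by (rule aff_eq[where a = 0 and b = "max (- a) 0", OF g]) (simp add: hinge_def)
  then show ?thesis by (simp add: diff_op_def)
qed

lemma diff_hinge_shear:
  assumes "convex_on U g"
  shows "diff_op (hinge u a) (diff_op (hinge v b) m) g
    = diff_op (hinge u a) (diff_op (hinge (u + v) (a + b)) m) g"
  using shear_identity[OF assms, of u a v b] by (simp add: diff_op_def algebra_simps)

text \<open>Opposite hinges have disjoint supports: the maximum of \<open>s\<close> times one and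
  \<open>t\<close> times the other is their sum, the minimum is 0. The valuation property becomes
  additivity once the opposite hinge is flipped back modulo an affine function.\<close>

lemma hinge_additive:
  assumes g: "convex_on U g" and s: "0 \<le> s" and t: "0 \<le> t"
  shows "diff_op (\<lambda>x. (s + t) * hinge u a x) m g
    = diff_op (\<lambda>x. s * hinge u a x) m g + diff_op (\<lambda>x. t * hinge u a x) m g"
proof -
  have c: "convex_on U (\<lambda>x. r * hinge w b x)" if "0 \<le> r" for r w b
    using that by (intro convex_on_cmul hinge_convex)
  have "m (\<lambda>x. g x + s * hinge u a x) + m (\<lambda>x. g x + t * hinge (- u) (- a) x)
      = m (\<lambda>x. g x + s * hinge u a x + t * hinge (- u) (- a) x) + m g"
  proof (rule val_eq)
    have sg: "(hinge u a x = 0 \<and> 0 \<le> t * hinge (- u) (- a) x)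
        \<or> (hinge (- u) (- a) x = 0 \<and> 0 \<le> s * hinge u a x)" for x
      using s t by (auto simp: hinge_def)
    show "max (g x + s * hinge u a x) (g x + t * hinge (- u) (- a) x)
        = g x + s * hinge u a x + t * hinge (- u) (- a) x"
      "min (g x + s * hinge u a x) (g x + t * hinge (- u) (- a) x) = g x" for x
      using sg[of x] by auto
  qed (auto intro!: convex_on_add g c s t)
  moreover have "m (\<lambda>x. g x + t * hinge u a x) = m (\<lambda>x. g x + t * hinge (- u) (- a) x)"
  proof (rule aff_eq[where a = "t *\<^sub>R u" and b = "- t * a"])
    show "g x + t * hinge u a x = g x + t * hinge (- u) (- a) x + (t *\<^sub>R u \<bullet> x + - t * a)" for x
      unfolding hinge_flip[of u a] by (simp add: algebra_simps)
  qed (intro convex_on_add g c t)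
  moreover have "m (\<lambda>x. g x + (s + t) * hinge u a x) = m (\<lambda>x. g x + s * hinge u a x + t * hinge (- u) (- a) x)"
  proof (rule aff_eq[where a = "t *\<^sub>R u" and b = "- t * a"])
    show "g x + (s + t) * hinge u a x
        = g x + s * hinge u a x + t * hinge (- u) (- a) x + (t *\<^sub>R u \<bullet> x + - t * a)" for x
      unfolding hinge_flip[of u a] by (simp add: algebra_simps)
  qed (intro convex_on_add g c s t)
  ultimately show ?thesis by (simp add: diff_op_def algebra_simps)
qed

lemma diff_hinge_scale:
  assumes g: "convex_on U g" and t: "0 \<le> t"
  shows "diff_op (\<lambda>x. t * hinge u a x) m g = t *\<^sub>R diff_op (hinge u a) m g"
proof -
  have "diff_op (\<lambda>x. t * hinge u a x) m g = t *\<^sub>R diff_op (\<lambda>x. 1 * hinge u a x) m g"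
  proof (rule additive_continuous_imp_linear[OF lc _ _ t, of "\<lambda>t. diff_op (\<lambda>x. t * hinge u a x) m g"])
    fix ts :: "nat \<Rightarrow> real" and t :: real
    assume ts: "\<And>j. 0 \<le> ts j" and t: "0 \<le> t" and lim: "ts \<longlonglongrightarrow> t"
    show "lc_tendsto P (\<lambda>j. diff_op (\<lambda>x. ts j * hinge u a x) m g) (diff_op (\<lambda>x. t * hinge u a x) m g)"
      unfolding diff_op_def
    proof (intro lc_tendsto_diff lc lc_tendsto_const cont convex_on_add g convex_on_cmul ts t hinge_convex)
      fix K :: "'n set" assume K: "compact K" "K \<subseteq> U"
      have "continuous_on K (hinge u a)"
        unfolding hinge_def[abs_def] by (intro continuous_intros)
      then have "bounded (hinge u a ` K)"
        using K by (intro compact_imp_bounded compact_continuous_image)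
      moreover have "uniform_limit K (\<lambda>j _. ts j) (\<lambda>_. t) sequentially"
        using lim unfolding uniform_limit_iff tendsto_iff by simp
      moreover have "bounded ((\<lambda>_. t) ` K)"
        by (rule bounded_subset[of "{t}"]) auto
      ultimately show "uniform_limit K (\<lambda>j x. g x + ts j * hinge u a x) (\<lambda>x. g x + t * hinge u a x) sequentially"
        by (intro uniform_limit_add uniform_limit_const uniform_lim_mult)
    qed
  next
    fix r s :: real assume "0 \<le> r" "0 \<le> s"
    then show "diff_op (\<lambda>x. (r + s) * hinge u a x) m g
        = diff_op (\<lambda>x. r * hinge u a x) m g + diff_op (\<lambda>x. s * hinge u a x) m g"
      by (rule hinge_additive[OF g])
  qed
  then show ?thesis by simp
qed

text \<open>For positive \<open>c\<close>, shear along the hinge scaled by \<open>c\<close> and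
  cancel the factor \<open>c\<close> that linearity produces on both sides; for negative
  \<open>c\<close>, use the opposite orientation of \<open>u\<close>.\<close>

lemma diff_hinge_shear_scaled:
  assumes g: "convex_on U g"
  shows "diff_op (hinge u a) (diff_op (hinge v b) m) g
    = diff_op (hinge u a) (diff_op (hinge (v + c *\<^sub>R u) (b + c * a)) m) g"
proof -
  have pos: "diff_op (hinge u a) (diff_op (hinge v b) m) g
    = diff_op (hinge u a) (diff_op (hinge (v + c *\<^sub>R u) (b + c * a)) m) g" if c: "0 < c" for c u a
  proof -
    interpret A: dual_valuation U P "diff_op (hinge v b) m"
      by (rule dual_valuation_diff_op[OF hinge_convex])
    interpret B: dual_valuation U P "diff_op (hinge (v + c *\<^sub>R u) (b + c * a)) m"
      by (rule dual_valuation_diff_op[OF hinge_convex])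
    have h: "hinge (c *\<^sub>R u) (c * a) = (\<lambda>x. c * hinge u a x)"
      using c by (auto simp: hinge_scale)
    have "c *\<^sub>R diff_op (hinge u a) (diff_op (hinge v b) m) g
        = diff_op (hinge (c *\<^sub>R u) (c * a)) (diff_op (hinge v b) m) g"
      using A.diff_hinge_scale[OF g, of c] c by (simp add: h)
    also have "\<dots> = diff_op (hinge (c *\<^sub>R u) (c * a)) (diff_op (hinge (v + c *\<^sub>R u) (b + c * a)) m) g"
      using diff_hinge_shear[OF g, of "c *\<^sub>R u" "c * a" v b] by (simp add: add.commute)
    also have "\<dots> = c *\<^sub>R diff_op (hinge u a) (diff_op (hinge (v + c *\<^sub>R u) (b + c * a)) m) g"
      using B.diff_hinge_scale[OF g, of c] c by (simp add: h)
    finally show ?thesis using c by simp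
  qed
  consider "c = 0" | "0 < c" | "c < 0" by linarith
  then show ?thesis
  proof cases
    case 1
    then show ?thesis by simp
  next
    case 2
    then show ?thesis by (rule pos)
  next
    case 3
    interpret A: dual_valuation U P "diff_op (hinge v b) m"
      by (rule dual_valuation_diff_op[OF hinge_convex])
    interpret B: dual_valuation U P "diff_op (hinge (v + c *\<^sub>R u) (b + c * a)) m"
      by (rule dual_valuation_diff_op[OF hinge_convex])
    have e: "v + (- c) *\<^sub>R (- u) = v + c *\<^sub>R u" "b + - c * - a = b + c * a" by simp_all
    have "diff_op (hinge (- u) (- a)) (diff_op (hinge v b) m) g
        = diff_op (hinge (- u) (- a)) (diff_op (hinge (v + c *\<^sub>R u) (b + c * a)) m) g"
      using pos[of "- c" "- u" "- a", unfolded e] 3 by (simp only: neg_0_less_iff_less)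
    then show ?thesis
      by (simp only: A.diff_hinge_flip[OF g] B.diff_hinge_flip[OF g])
  qed
qed

end

section \<open>Iterated differences and linear dependence of their directions\<close>

definition iter_diff :: "('a \<Rightarrow> real) list \<Rightarrow> (('a \<Rightarrow> real) \<Rightarrow> 'f) \<Rightarrow> ('a \<Rightarrow> real) \<Rightarrow> 'f::real_vector" where
  "iter_diff hs m = foldr diff_op hs m"

lemma iter_diff_simps [simp]:
  "iter_diff [] m = m" "iter_diff (h # hs) m = diff_op h (iter_diff hs m)"
  by (simp_all add: iter_diff_def)

abbreviation hinges :: "('a::euclidean_space \<times> real) list \<Rightarrow> ('a \<Rightarrow> real) list" where
  "hinges L \<equiv> map (\<lambda>(u, a). hinge u a) L"

definition hinge_sum :: "('a::euclidean_space \<times> real) list \<Rightarrow> 'a \<Rightarrow> real" where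
  "hinge_sum L x = (\<Sum>(u, a)\<leftarrow>L. hinge u a x)"

lemma hinge_sum_simps [simp]:
  "hinge_sum [] x = 0" "hinge_sum ((u, a) # L) x = hinge u a x + hinge_sum L x"
  "hinge_sum (L @ L') x = hinge_sum L x + hinge_sum L' x"
  by (simp_all add: hinge_sum_def)

lemma convex_on_hinge_sum: "convex S \<Longrightarrow> convex_on S (hinge_sum L)"
proof (induction L)
  case Nil
  then show ?case by (simp add: hinge_sum_def[abs_def] convex_on_const)
next
  case (Cons p L)
  then show ?case
    by (cases p) (auto simp: hinge_sum_def[abs_def] intro!: convex_on_add convex_on_hinge)
qed

lemma diff_op_additive_map:
  assumes "\<And>F. s (\<lambda>x. F x + h x) = (\<lambda>x. s F x + s h x)"
  shows "diff_op h (\<lambda>F. m (s F)) F = diff_op (s h) m (s F)"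
  by (simp add: diff_op_def assms)

text \<open>Applied below with \<open>s\<close> the multiplication by a scalar and with
  \<open>s\<close> the pullback along an orthogonal projection.\<close>

lemma iter_diff_additive_map:
  assumes "\<And>F h. s (\<lambda>x. F x + h x) = (\<lambda>x. s F x + s h x)"
  shows "iter_diff hs (\<lambda>F. m (s F)) F = iter_diff (map s hs) m (s F)"
proof -
  have "iter_diff hs (\<lambda>F. m (s F)) = (\<lambda>F. iter_diff (map s hs) m (s F))"
  proof (induction hs)
    case (Cons h hs)
    show ?case
      unfolding iter_diff_simps list.map Cons.IH by (rule ext, rule diff_op_additive_map) (rule assms)
  qed simp
  then show ?thesis by simp
qed

lemma iter_diff_linear:
  "iter_diff hs (\<lambda>F. m F - c *\<^sub>R m' F) F = iter_diff hs m F - c *\<^sub>R iter_diff hs m' F"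
  by (induction hs arbitrary: F) (simp_all add: diff_op_def algebra_simps)

text \<open>An iterated difference is an alternating sum of values of \<open>m\<close> at
  \<open>F\<close> plus subsums of \<open>hs\<close>, and all these functions stay in the class
  \<open>A\<close>.\<close>

lemma iter_diff_closed:
  assumes "\<And>F. A F \<Longrightarrow> m F = 0" "A F" "\<And>F h. \<lbrakk>A F; h \<in> set hs\<rbrakk> \<Longrightarrow> A (\<lambda>x. F x + h x)"
  shows "iter_diff hs m F = 0"
  using assms(2,3) by (induction hs arbitrary: F) (auto simp: diff_op_def assms(1))

text \<open>Discrete Taylor expansion at 0, from
  \<open>m (F + h) = m F + diff_op h m F\<close>.\<close>

lemma hinge_sum_vanish:
  assumes "\<And>L. iter_diff (hinges L) m (\<lambda>_. 0) = 0"
  shows "m (hinge_sum L) = 0"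
proof -
  \<comment> \<open>Moving one hinge into the argument costs one more difference, so the induction
    has to carry all iterated differences and not only \<open>m\<close>.\<close>
  have "iter_diff (hinges L') m (hinge_sum L) = 0" for L'
  proof (induction L arbitrary: L')
    case Nil
    then show ?case using assms by (simp add: hinge_sum_def[abs_def])
  next
    case (Cons p L)
    obtain u a where p: "p = (u, a)" by (cases p)
    have "hinge_sum (p # L) = (\<lambda>x. hinge_sum L x + hinge u a x)"
      by (auto simp: p)
    then show ?case
      using Cons.IH[of "p # L'"] Cons.IH[of L'] by (simp add: p diff_op_def)
  qed
  from this[of "[]"] show ?thesis by simp
qed

context dual_valuation begin

lemma dual_valuation_iter_diff: "dual_valuation U P (iter_diff (hinges L) m)"
proof (induction L)
  case Nil
  show ?case by (simp add: dual_valuation_axioms)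
next
  case (Cons p L)
  then show ?case
    by (cases p) (auto intro: dual_valuation.dual_valuation_diff_op hinge_convex)
qed

text \<open>Each hinge contributes one factor \<open>t\<close> while the base \<open>g\<close> stays
  unscaled; at base 0 this is homogeneity of degree \<open>length L\<close>.\<close>

lemma iter_diff_scale:
  assumes "convex_on U g" "0 \<le> t"
  shows "iter_diff (map (\<lambda>h x. t * h x) (hinges L)) m g = t ^ length L *\<^sub>R iter_diff (hinges L) m g"
  using assms(1)
proof (induction L arbitrary: g)
  case Nil
  show ?case by simp
next
  case (Cons p L)
  obtain u a where p: "p = (u, a)" by (cases p)
  interpret A: dual_valuation U P "iter_diff (hinges L) m"
    by (rule dual_valuation_iter_diff)
  have c: "convex_on U (\<lambda>x. g x + t * hinge u a x)"
    using Cons.prems assms(2) by (intro convex_on_add convex_on_cmul hinge_convex)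
  have "iter_diff (map (\<lambda>h x. t * h x) (hinges (p # L))) m g
      = t ^ length L *\<^sub>R diff_op (\<lambda>x. t * hinge u a x) (iter_diff (hinges L) m) g"
    unfolding p list.map prod.case iter_diff_simps
    by (simp add: diff_op_def Cons.IH[OF Cons.prems] Cons.IH[OF c] scaleR_diff_right del: map_map)
  also have "\<dots> = t ^ length L *\<^sub>R t *\<^sub>R diff_op (hinge u a) (iter_diff (hinges L) m) g"
    by (subst A.diff_hinge_scale[OF Cons.prems assms(2)]) simp
  also have "\<dots> = t ^ length (p # L) *\<^sub>R iter_diff (hinges (p # L)) m g"
    by (simp add: p power_Suc2 del: power_Suc)
  finally show ?case .
qed

text \<open>Differences commute, so \<open>(u, a)\<close> can be brought next to the new hinge,
  where the two-hinge shear applies. If it is not the head, the head difference is expanded and the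
  induction hypothesis is used at two base points.\<close>

lemma diff_shear_iter_diff:
  assumes "convex_on U g" "(u, a) \<in> set L"
  shows "diff_op (hinge v b) (iter_diff (hinges L) m) g
    = diff_op (hinge (v + c *\<^sub>R u) (b + c * a)) (iter_diff (hinges L) m) g"
  using assms
proof (induction L arbitrary: g)
  case (Cons p L)
  obtain w d where p: "p = (w, d)" by (cases p)
  interpret A: dual_valuation U P "iter_diff (hinges L) m"
    by (rule dual_valuation_iter_diff)
  show ?case
  proof (cases "(u, a) = p")
    case True
    have "diff_op (hinge v' b') (iter_diff (hinges (p # L)) m) g
        = diff_op (hinge u a) (diff_op (hinge v' b') (iter_diff (hinges L) m)) g" for v' b'
      using True by (auto intro: diff_op_commute)
    then show ?thesis
      using A.diff_hinge_shear_scaled[OF Cons.prems(1), of u a v b c] by simp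
  next
    case False
    then have mem: "(u, a) \<in> set L" using Cons.prems by auto
    have c: "convex_on U (\<lambda>x. g x + hinge w d x)"
      using Cons.prems by (intro convex_on_add hinge_convex)
    have "diff_op (hinge v' b') (iter_diff (hinges (p # L)) m) g
        = diff_op (hinge v' b') (iter_diff (hinges L) m) (\<lambda>x. g x + hinge w d x)
          - diff_op (hinge v' b') (iter_diff (hinges L) m) g" for v' b'
      by (simp add: p) (simp add: diff_op_def ac_simps)
    then show ?thesis
      using Cons.IH[OF c mem] Cons.IH[OF Cons.prems(1) mem] by simp
  qed
qed simp

text \<open>Shears subtract from \<open>u\<close> a linear combination of the other directions until
  nothing is left; a hinge with direction 0 is constant and its difference vanishes.\<close>

lemma iter_diff_eq_0_if_in_span:
  assumes g: "convex_on U g" and u: "u \<in> span (fst ` set L)"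
  shows "iter_diff (hinges ((u, a) # L)) m g = 0"
proof -
  \<comment> \<open>The resulting offset is left existential: a hinge with direction 0 is constant
    whatever its offset.\<close>
  have "\<forall>v b. \<exists>b'. diff_op (hinge v b) (iter_diff (hinges L) m) g
      = diff_op (hinge (v - u) b') (iter_diff (hinges L) m) g"
    using u
  proof (induction rule: span_induct_alt)
    case base
    show ?case by auto
  next
    case (step c w y)
    then obtain d where mem: "(w, d) \<in> set L" by auto
    show ?case
    proof (intro allI)
      fix v b
      obtain b' where "diff_op (hinge v b) (iter_diff (hinges L) m) g
          = diff_op (hinge (v - y) b') (iter_diff (hinges L) m) g"
        using step by blast
      also have "\<dots> = diff_op (hinge (v - y + (- c) *\<^sub>R w) (b' + - c * d)) (iter_diff (hinges L) m) g"
        by (rule diff_shear_iter_diff[OF g mem])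
      also have "v - y + (- c) *\<^sub>R w = v - (c *\<^sub>R w + y)" by simp
      finally show "\<exists>b'. diff_op (hinge v b) (iter_diff (hinges L) m) g
          = diff_op (hinge (v - (c *\<^sub>R w + y)) b') (iter_diff (hinges L) m) g" by blast
    qed
  qed
  then obtain b' where "diff_op (hinge u a) (iter_diff (hinges L) m) g
      = diff_op (hinge (u - u) b') (iter_diff (hinges L) m) g" by blast
  also have "\<dots> = 0"
    using dual_valuation.diff_hinge_const[OF dual_valuation_iter_diff g] by simp
  finally show ?thesis by simp
qed

text \<open>Down the list, either the head lies in the span of the rest or the rest is already
  dependent. Distinctness is listed separately because the set of directions forgets repetitions,
  which also count as dependence.\<close>

lemma iter_diff_dependent:
  assumes "convex_on U g" "\<not> (distinct (map fst L) \<and> independent (fst ` set L))"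
  shows "iter_diff (hinges L) m g = 0"
  using assms
proof (induction L arbitrary: g)
  case (Cons p L)
  obtain u a where p: "p = (u, a)" by (cases p)
  show ?case
  proof (cases "u \<in> span (fst ` set L)")
    case True
    then show ?thesis using iter_diff_eq_0_if_in_span[OF Cons.prems(1)] p by simp
  next
    case False
    have u: "u \<notin> fst ` set L" using False by (metis span_base)
    have dep: "\<not> (distinct (map fst L) \<and> independent (fst ` set L))"
      using Cons.prems(2) False u by (auto simp: p independent_insert)
    have "convex_on U (\<lambda>x. g x + hinge u a x)"
      using Cons.prems by (intro convex_on_add hinge_convex)
    then show ?thesis
      using Cons.IH[OF _ dep] Cons.prems(1) by (simp add: p diff_op_def)
  qed
qed (simp add: independent_empty)

lemma iter_diff_eq_0_if_length_gt_dim: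
  assumes "convex_on U g" "dim (fst ` set L) < length L"
  shows "iter_diff (hinges L) m g = 0"
proof (rule iter_diff_dependent[OF assms(1)], rule notI)
  assume *: "distinct (map fst L) \<and> independent (fst ` set L)"
  then have "dim (fst ` set L) = card (set (map fst L))"
    by (simp add: dim_eq_card_independent)
  also have "\<dots> = length L"
    using * distinct_card[of "map fst L"] by (metis length_map)
  finally show False using assms(2) by simp
qed

end

section \<open>Locally uniform limits of hinge sums\<close>
text \<open>Approximation is on compact subsets of the whole space, not of \<open>U\<close>, which
  makes the cone invariant under translations and dilations, as convolution requires.\<close>

definition hinge_cone :: "('a::euclidean_space \<Rightarrow> real) set" where
  "hinge_cone = {F. \<forall>K e. compact K \<longrightarrow> 0 < e \<longrightarrow>
    (\<exists>L c d. \<forall>x\<in>K. \<bar>F x - (hinge_sum L x + (c \<bullet> x + d))\<bar> \<le> e)}"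

lemma hinge_coneI:
  assumes "\<And>K e. \<lbrakk>compact K; 0 < e\<rbrakk> \<Longrightarrow> \<exists>L c d. \<forall>x\<in>K. \<bar>F x - (hinge_sum L x + (c \<bullet> x + d))\<bar> \<le> e"
  shows "F \<in> hinge_cone"
  using assms by (simp add: hinge_cone_def)

lemma hinge_coneE:
  assumes "F \<in> hinge_cone" "compact K" "0 < e"
  obtains L c d where "\<And>x. x \<in> K \<Longrightarrow> \<bar>F x - (hinge_sum L x + (c \<bullet> x + d))\<bar> \<le> e"
proof -
  have "\<exists>L c d. \<forall>x\<in>K. \<bar>F x - (hinge_sum L x + (c \<bullet> x + d))\<bar> \<le> e"
    using assms by (simp add: hinge_cone_def)
  then show ?thesis by (elim exE) (rule that, blast)
qed

lemma hinge_cone_closed: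
  fixes F :: "'a::euclidean_space \<Rightarrow> real"
  assumes "\<And>K e. \<lbrakk>compact K; 0 < e\<rbrakk> \<Longrightarrow> \<exists>G\<in>hinge_cone. \<forall>x\<in>K. \<bar>F x - G x\<bar> \<le> e"
  shows "F \<in> hinge_cone"
proof (rule hinge_coneI)
  fix K :: "'a set" and e :: real assume K: "compact K" and e: "0 < e"
  obtain G where G: "G \<in> hinge_cone" "\<And>x. x \<in> K \<Longrightarrow> \<bar>F x - G x\<bar> \<le> e / 2"
    using assms[OF K, of "e / 2"] e by auto
  obtain L c d where L: "\<And>x. x \<in> K \<Longrightarrow> \<bar>G x - (hinge_sum L x + (c \<bullet> x + d))\<bar> \<le> e / 2"
    using hinge_coneE[OF G(1) K, of "e / 2"] e by auto
  have "\<bar>F x - (hinge_sum L x + (c \<bullet> x + d))\<bar> \<le> e" if "x \<in> K" for x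
    using G(2)[OF that] L[OF that] by linarith
  then show "\<exists>L c d. \<forall>x\<in>K. \<bar>F x - (hinge_sum L x + (c \<bullet> x + d))\<bar> \<le> e" by blast
qed

lemma hinge_cone_convex:
  assumes "F \<in> hinge_cone"
  shows "convex_on UNIV F"
proof (rule convex_onI)
  fix t :: real and x y :: 'a assume t: "0 < t" "t < 1"
  let ?z = "(1 - t) *\<^sub>R x + t *\<^sub>R y"
  show "F ?z \<le> (1 - t) * F x + t * F y"
  proof (rule field_le_epsilon)
    fix e :: real assume e: "0 < e"
    obtain L c d where L: "\<And>w. w \<in> {x, y, ?z} \<Longrightarrow> \<bar>F w - (hinge_sum L w + (c \<bullet> w + d))\<bar> \<le> e / 2"
      using hinge_coneE[OF assms, of "{x, y, ?z}" "e / 2"] e by auto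
    let ?H = "\<lambda>w. hinge_sum L w + (c \<bullet> w + d)"
    have "convex_on UNIV ?H"
      by (intro convex_on_add convex_on_hinge_sum convex_on_affine_function) auto
    then have H: "?H ?z \<le> (1 - t) * ?H x + t * ?H y"
      using t by (intro convex_onD) auto
    have "F ?z \<le> ?H ?z + e / 2"
      using L[OF insertI2[OF insertI2[OF singletonI]]] by linarith
    moreover have "?H x \<le> F x + e / 2" "?H y \<le> F y + e / 2"
      using L[OF insertI1] L[OF insertI2[OF insertI1]] by linarith+
    then have "(1 - t) * ?H x \<le> (1 - t) * (F x + e / 2)" "t * ?H y \<le> t * (F y + e / 2)"
      using t by (auto intro!: mult_left_mono)
    then have "(1 - t) * ?H x + t * ?H y \<le> (1 - t) * (F x + e / 2) + t * (F y + e / 2)"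
      by (rule add_mono)
    moreover have "(1 - t) * (F x + e / 2) + t * (F y + e / 2) = (1 - t) * F x + t * F y + e / 2"
      by (simp add: field_simps)
    ultimately show "F ?z \<le> (1 - t) * F x + t * F y + e"
      using H by linarith
  qed
qed simp

lemma hinge_cone_continuous: "F \<in> hinge_cone \<Longrightarrow> continuous_on UNIV F"
  by (intro convex_on_continuous hinge_cone_convex) auto

lemma hinge_cone_affine: "(\<lambda>x. c \<bullet> x + d) \<in> hinge_cone"
proof (rule hinge_coneI)
  fix K :: "'a set" and e :: real assume "0 < e"
  then show "\<exists>L c' d'. \<forall>x\<in>K. \<bar>c \<bullet> x + d - (hinge_sum L x + (c' \<bullet> x + d'))\<bar> \<le> e"
    by (intro exI[of _ "[]"] exI[of _ c] exI[of _ d]) simp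
qed

lemma hinge_cone_add:
  assumes "F \<in> hinge_cone" "G \<in> hinge_cone"
  shows "(\<lambda>x. F x + G x) \<in> hinge_cone"
proof (rule hinge_coneI)
  fix K :: "'a set" and e :: real assume K: "compact K" and e: "0 < e"
  obtain L c d where L: "\<And>x. x \<in> K \<Longrightarrow> \<bar>F x - (hinge_sum L x + (c \<bullet> x + d))\<bar> \<le> e / 2"
    using hinge_coneE[OF assms(1) K, of "e / 2"] e by auto
  obtain L' c' d' where L': "\<And>x. x \<in> K \<Longrightarrow> \<bar>G x - (hinge_sum L' x + (c' \<bullet> x + d'))\<bar> \<le> e / 2"
    using hinge_coneE[OF assms(2) K, of "e / 2"] e by auto
  have "\<bar>F x + G x - (hinge_sum (L @ L') x + ((c + c') \<bullet> x + (d + d')))\<bar> \<le> e" if "x \<in> K" for x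
    using L[OF that] L'[OF that] unfolding hinge_sum_simps inner_add_left by linarith
  then show "\<exists>L c d. \<forall>x\<in>K. \<bar>F x + G x - (hinge_sum L x + (c \<bullet> x + d))\<bar> \<le> e" by blast
qed

lemma hinge_sum_scale:
  assumes "0 \<le> t"
  shows "hinge_sum (map (\<lambda>(u, a). (t *\<^sub>R u, t * a)) L) x = t * hinge_sum L x"
  by (induction L) (auto simp: hinge_scale[OF assms] distrib_left)

lemma hinge_sum_affine_compose:
  "hinge_sum L (r *\<^sub>R x + v) = hinge_sum (map (\<lambda>(u, a). (r *\<^sub>R u, a - u \<bullet> v)) L) x"
  by (induction L) (auto simp: hinge_def inner_add_right algebra_simps)

lemma hinge_cone_scale:
  assumes "F \<in> hinge_cone" "0 \<le> t"
  shows "(\<lambda>x. t * F x) \<in> hinge_cone"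
proof (rule hinge_coneI)
  fix K :: "'a set" and e :: real assume K: "compact K" and e: "0 < e"
  obtain L c d where L: "\<And>x. x \<in> K \<Longrightarrow> \<bar>F x - (hinge_sum L x + (c \<bullet> x + d))\<bar> \<le> e / (t + 1)"
    using hinge_coneE[OF assms(1) K, of "e / (t + 1)"] e assms(2) by auto
  have "\<bar>t * F x - (hinge_sum (map (\<lambda>(u, a). (t *\<^sub>R u, t * a)) L) x + (t *\<^sub>R c \<bullet> x + t * d))\<bar> \<le> e"
    if "x \<in> K" for x
  proof -
    have "\<bar>t * F x - (hinge_sum (map (\<lambda>(u, a). (t *\<^sub>R u, t * a)) L) x + (t *\<^sub>R c \<bullet> x + t * d))\<bar>
        = \<bar>t * (F x - (hinge_sum L x + (c \<bullet> x + d)))\<bar>"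
      unfolding hinge_sum_scale[OF assms(2)] by (simp add: algebra_simps)
    also have "\<dots> \<le> t * (e / (t + 1))"
      using L[OF that] assms(2) by (simp only: abs_mult) (intro mult_mono, auto)
    also have "\<dots> \<le> e"
      using assms(2) e by (simp add: field_simps)
    finally show ?thesis .
  qed
  then show "\<exists>L c d. \<forall>x\<in>K. \<bar>t * F x - (hinge_sum L x + (c \<bullet> x + d))\<bar> \<le> e" by blast
qed

lemma hinge_cone_affine_compose:
  assumes "F \<in> hinge_cone"
  shows "(\<lambda>x. F (r *\<^sub>R x + v)) \<in> hinge_cone"
proof (rule hinge_coneI)
  fix K :: "'a set" and e :: real assume K: "compact K" and e: "0 < e"
  have "compact ((\<lambda>x. r *\<^sub>R x + v) ` K)"
    using K by (intro compact_continuous_image continuous_intros)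
  then obtain L c d where L: "\<And>x. x \<in> (\<lambda>x. r *\<^sub>R x + v) ` K \<Longrightarrow> \<bar>F x - (hinge_sum L x + (c \<bullet> x + d))\<bar> \<le> e"
    using hinge_coneE[OF assms _ e] by blast
  have "\<bar>F (r *\<^sub>R x + v) - (hinge_sum (map (\<lambda>(u, a). (r *\<^sub>R u, a - u \<bullet> v)) L) x
      + (r *\<^sub>R c \<bullet> x + (c \<bullet> v + d)))\<bar> \<le> e" if "x \<in> K" for x
    using L[OF imageI[OF that]]
    unfolding hinge_sum_affine_compose inner_add_right inner_scaleR_right inner_scaleR_left by linarith
  then show "\<exists>L c d. \<forall>x\<in>K. \<bar>F (r *\<^sub>R x + v) - (hinge_sum L x + (c \<bullet> x + d))\<bar> \<le> e" by blast
qed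

lemma hinge_cone_sum:
  assumes "\<And>i. i \<in> I \<Longrightarrow> F i \<in> hinge_cone"
  shows "(\<lambda>x. \<Sum>i\<in>I. F i x) \<in> hinge_cone"
  using assms
proof (induction I rule: infinite_finite_induct)
  case (insert i I)
  then show ?case using hinge_cone_add[of "F i"] by simp
qed (use hinge_cone_affine[of 0 0] in auto)

section \<open>Convex functions of one linear form\<close>

lemma convex_on_slope_mono:
  fixes \<phi> :: "real \<Rightarrow> real"
  assumes "convex_on UNIV \<phi>" "0 < \<delta>"
  shows "(\<phi> (x + \<delta>) - \<phi> x) / \<delta> \<le> (\<phi> (x + 2 * \<delta>) - \<phi> (x + \<delta>)) / \<delta>"
proof -
  have "\<phi> ((1 - 1/2) *\<^sub>R x + (1/2) *\<^sub>R (x + 2 * \<delta>)) \<le> (1 - 1/2) * \<phi> x + 1/2 * \<phi> (x + 2 * \<delta>)"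
    by (rule convex_onD[OF assms(1)]) auto
  moreover have "(1 - 1/2) *\<^sub>R x + (1/2) *\<^sub>R (x + 2 * \<delta>) = x + \<delta>"
    by (simp add: field_simps)
  ultimately have "2 * \<phi> (x + \<delta>) \<le> \<phi> x + \<phi> (x + 2 * \<delta>)" by simp
  then show ?thesis
    using assms(2) by (intro divide_right_mono) auto
qed

text \<open>Linear interpolation on an equidistant grid; the weights of the hinges are the jumps of
  the slopes.\<close>
lemma convex_real_interpolation:
  fixes \<phi> :: "real \<Rightarrow> real"
  assumes \<phi>: "convex_on UNIV \<phi>" and e: "0 < e"
  obtains N :: nat and c a \<alpha> \<beta> where "\<And>i. 0 \<le> c i"
    "\<And>t. t \<in> {-M..M} \<Longrightarrow> \<bar>\<phi> t - (\<alpha> + \<beta> * t + (\<Sum>i<N. c i * max (t - a i) 0))\<bar> \<le> e"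
proof (cases "0 < M")
  case False
  show ?thesis
  proof (rule that[of "\<lambda>_. 0" "\<phi> 0" 0 "\<lambda>_. 0" 0])
    fix t assume "t \<in> {-M..M}"
    then have "t = 0" using False by auto
    then show "\<bar>\<phi> t - (\<phi> 0 + 0 * t + (\<Sum>i<0. 0 * max (t - 0) 0))\<bar> \<le> e" using e by simp
  qed simp
next
  case True
  have "continuous_on UNIV \<phi>"
    using \<phi> by (intro convex_on_continuous) auto
  then have "uniformly_continuous_on {-M..M} \<phi>"
    by (intro compact_uniformly_continuous) (auto intro: continuous_on_subset)
  then obtain \<eta> where \<eta>: "0 < \<eta>"
      "\<And>s t. \<lbrakk>s \<in> {-M..M}; t \<in> {-M..M}; \<bar>s - t\<bar> < \<eta>\<rbrakk> \<Longrightarrow> \<bar>\<phi> s - \<phi> t\<bar> < e"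
    unfolding uniformly_continuous_on_def dist_real_def using e by metis
  obtain N :: nat where N: "2 * M / \<eta> < real N"
    using reals_Archimedean2 by blast
  have N0: "0 < real N"
    using N True \<eta>(1) by (smt (verit) divide_nonneg_pos)
  define \<delta> where "\<delta> = 2 * M / N"
  have \<delta>: "0 < \<delta>" "\<delta> < \<eta>"
    using True N N0 \<eta>(1) by (auto simp: \<delta>_def field_simps)
  define a where "a i = - M + real i * \<delta>" for i
  define s where "s i = (\<phi> (a (Suc i)) - \<phi> (a i)) / \<delta>" for i
  have a_Suc: "a (Suc i) = a i + \<delta>" for i
    by (simp add: a_def algebra_simps)
  have a_mono: "a i \<le> a j" if "i \<le> j" for i j
    using that \<delta>(1) by (simp add: a_def)
  have s_mono: "s i \<le> s (Suc i)" for i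
    using convex_on_slope_mono[OF \<phi> \<delta>(1), of "a i"] by (simp add: s_def a_Suc add.assoc)
  define c where "c i = s (Suc i) - s i" for i
  \<comment> \<open>Abel summation: with the first \<open>j\<close> kinks switched on, the
    interpolant is the chord of cell \<open>j\<close>.\<close>
  have line: "\<phi> (a 0) + s 0 * (t - a 0) + (\<Sum>i<j. c i * (t - a (Suc i))) = \<phi> (a j) + s j * (t - a j)" for t j
  proof (induction j)
    case (Suc j)
    have "s j * \<delta> = \<phi> (a (Suc j)) - \<phi> (a j)"
      using \<delta>(1) by (simp add: s_def)
    with Suc show ?case by (simp add: c_def a_Suc algebra_simps)
  qed simp
  show ?thesis
  proof (rule that[of c "\<phi> (a 0) - s 0 * a 0" "s 0" "\<lambda>i. a (Suc i)" N])
    show "0 \<le> c i" for i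
      using s_mono by (simp add: c_def)
    fix t assume t: "t \<in> {-M..M}"
    obtain j where j: "j < N" "a j \<le> t" "t \<le> a (Suc j)"
    \<comment> \<open>At the right endpoint the floor would give \<open>j = N\<close>, one past the
      last cell.\<close>
    proof (cases "t = M")
      case True
      have "a (Suc (N - 1)) = M"
        using N0 by (simp add: a_def \<delta>_def)
      moreover have "a (N - 1) \<le> a (Suc (N - 1))"
        by (rule a_mono) simp
      ultimately show ?thesis
        using that[of "N - 1"] N0 True by simp
    next
      case False
      define j where "j = nat \<lfloor>(t + M) / \<delta>\<rfloor>"
      have q1: "0 \<le> (t + M) / \<delta>"
        using t \<delta>(1) by simp
      have "t + M < 2 * M" using t False by auto
      also have "2 * M = real N * \<delta>" using N0 by (simp add: \<delta>_def)
      finally have q2: "(t + M) / \<delta> < N"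
        using \<delta>(1) by (simp add: divide_less_eq)
      note q = q1 q2
      have rj: "real j = of_int \<lfloor>(t + M) / \<delta>\<rfloor>"
        using q(1) by (simp add: j_def)
      have "real j \<le> (t + M) / \<delta>" "(t + M) / \<delta> \<le> real j + 1"
        unfolding rj by linarith+
      then have "a j \<le> t" "t \<le> a (Suc j)"
        using \<delta>(1) by (auto simp: a_def field_simps)
      moreover have "j < N"
        using \<open>real j \<le> (t + M) / \<delta>\<close> q(2) by linarith
      ultimately show ?thesis using that by blast
    qed
    have "(\<Sum>i<N. c i * max (t - a (Suc i)) 0) = (\<Sum>i<j. c i * (t - a (Suc i)))"
    proof (rule sum.mono_neutral_cong_right)
      show "\<forall>i\<in>{..<N} - {..<j}. c i * max (t - a (Suc i)) 0 = 0"
      proof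
        fix i assume "i \<in> {..<N} - {..<j}"
        then have "a (Suc j) \<le> a (Suc i)" by (intro a_mono) auto
        with j show "c i * max (t - a (Suc i)) 0 = 0" by auto
      qed
      fix i assume "i \<in> {..<j}"
      then have "a (Suc i) \<le> a j" by (intro a_mono) auto
      with j show "c i * max (t - a (Suc i)) 0 = c i * (t - a (Suc i))" by auto
    qed (use j in auto)
    then have eq: "\<phi> (a 0) - s 0 * a 0 + s 0 * t + (\<Sum>i<N. c i * max (t - a (Suc i)) 0)
        = \<phi> (a j) + s j * (t - a j)"
      using line[of t j] by (simp add: algebra_simps)
    define \<theta> where "\<theta> = (t - a j) / \<delta>"
    have \<theta>: "0 \<le> \<theta>" "\<theta> \<le> 1"
      using j \<delta>(1) by (auto simp: \<theta>_def a_Suc)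
    have chord: "\<phi> (a j) + s j * (t - a j) = (1 - \<theta>) * \<phi> (a j) + \<theta> * \<phi> (a (Suc j))"
      using \<delta>(1) by (simp add: s_def \<theta>_def field_simps)
    have aN: "a N = M" using N0 by (simp add: a_def \<delta>_def)
    have a0: "a 0 = - M" by (simp add: a_def)
    have mem: "a j \<in> {-M..M}" "a (Suc j) \<in> {-M..M}"
      using a_mono[of 0 j] a_mono[of j N] a_mono[of 0 "Suc j"] a_mono[of "Suc j" N] j aN a0 by auto
    have d: "\<bar>\<phi> t - \<phi> (a j)\<bar> \<le> e" "\<bar>\<phi> t - \<phi> (a (Suc j))\<bar> \<le> e"
      using \<eta>(2)[of t "a j"] \<eta>(2)[of t "a (Suc j)"] mem t j \<delta> by (auto simp: a_Suc)
    have "\<bar>\<phi> t - (\<phi> (a j) + s j * (t - a j))\<bar>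
        = \<bar>(1 - \<theta>) * (\<phi> t - \<phi> (a j)) + \<theta> * (\<phi> t - \<phi> (a (Suc j)))\<bar>"
      unfolding chord by (simp add: algebra_simps)
    also have "\<dots> \<le> (1 - \<theta>) * \<bar>\<phi> t - \<phi> (a j)\<bar> + \<theta> * \<bar>\<phi> t - \<phi> (a (Suc j))\<bar>"
      using \<theta> by (intro order_trans[OF abs_triangle_ineq]) (simp add: abs_mult)
    also have "\<dots> \<le> (1 - \<theta>) * e + \<theta> * e"
      using \<theta> d by (intro add_mono mult_left_mono) auto
    also have "\<dots> = e" by (simp add: algebra_simps)
    finally show "\<bar>\<phi> t - (\<phi> (a 0) - s 0 * a 0 + s 0 * t + (\<Sum>i<N. c i * max (t - a (Suc i)) 0))\<bar> \<le> e"
      unfolding eq .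
  qed
qed

text \<open>The directions of \<open>L\<close> are recorded because \<open>ridge_affine\<close>
  needs approximants built from parallel hinges, which membership in \<open>hinge_cone\<close>
  forgets.\<close>

lemma ridge_approx:
  fixes u :: "'a::euclidean_space"
  assumes \<phi>: "convex_on UNIV \<phi>" and e: "0 < e" and K: "compact K"
  obtains L \<alpha> \<beta> where "fst ` set L \<subseteq> span {u}"
    "\<And>x. x \<in> K \<Longrightarrow> \<bar>\<phi> (u \<bullet> x) - (hinge_sum L x + (\<beta> *\<^sub>R u \<bullet> x + \<alpha>))\<bar> \<le> e"
proof -
  have "bounded ((\<bullet>) u ` K)"
    using K by (intro compact_imp_bounded compact_continuous_image continuous_intros)
  then obtain M where M: "\<And>x. x \<in> K \<Longrightarrow> \<bar>u \<bullet> x\<bar> \<le> M"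
    unfolding bounded_iff by auto
  obtain N :: nat and c a \<alpha> \<beta> where c: "\<And>i. 0 \<le> c i"
    and ap: "\<And>t. t \<in> {-M..M} \<Longrightarrow> \<bar>\<phi> t - (\<alpha> + \<beta> * t + (\<Sum>i<N. c i * max (t - a i) 0))\<bar> \<le> e"
    using convex_real_interpolation[OF \<phi> e, of M] by metis
  define L where "L = map (\<lambda>i. (c i *\<^sub>R u, c i * a i)) [0..<N]"
  have L: "hinge_sum L x = (\<Sum>i<N. c i * max (u \<bullet> x - a i) 0)" for x
  proof -
    have "hinge_sum L x = (\<Sum>i<N. hinge (c i *\<^sub>R u) (c i * a i) x)"
      by (simp add: L_def hinge_sum_def interv_sum_list_conv_sum_set_nat o_def atLeast0LessThan)
    also have "\<dots> = (\<Sum>i<N. c i * max (u \<bullet> x - a i) 0)"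
      using c by (intro sum.cong) (auto simp: hinge_scale hinge_def[of u])
    finally show ?thesis .
  qed
  show ?thesis
  proof (rule that)
    show "fst ` set L \<subseteq> span {u}"
      by (auto simp: L_def span_base span_scale)
    fix x assume "x \<in> K"
    then have "u \<bullet> x \<in> {-M..M}" using M[of x] by auto
    from ap[OF this] show "\<bar>\<phi> (u \<bullet> x) - (hinge_sum L x + (\<beta> *\<^sub>R u \<bullet> x + \<alpha>))\<bar> \<le> e"
      unfolding L inner_scaleR_left by (simp only: ac_simps)
  qed
qed

lemma hinge_cone_ridge:
  fixes u :: "'a::euclidean_space"
  assumes "convex_on UNIV \<phi>"
  shows "(\<lambda>x. \<phi> (u \<bullet> x)) \<in> hinge_cone"
proof (rule hinge_coneI)
  fix K :: "'a set" and e :: real assume K: "compact K" and e: "0 < e"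
  show "\<exists>L c d. \<forall>x\<in>K. \<bar>\<phi> (u \<bullet> x) - (hinge_sum L x + (c \<bullet> x + d))\<bar> \<le> e"
  proof (rule ridge_approx[OF assms e K, where u = u])
    fix L \<alpha> \<beta> assume *: "\<And>x. x \<in> K \<Longrightarrow> \<bar>\<phi> (u \<bullet> x) - (hinge_sum L x + (\<beta> *\<^sub>R u \<bullet> x + \<alpha>))\<bar> \<le> e"
    have "\<forall>x\<in>K. \<bar>\<phi> (u \<bullet> x) - (hinge_sum L x + (\<beta> *\<^sub>R u \<bullet> x + \<alpha>))\<bar> \<le> e"
      by (rule ballI) (rule *)
    then show ?thesis by blast
  qed
qed

section \<open>Cosines and Gaussians\<close>

text \<open>\<open>cos_pair K Q\<close>: \<open>K\<close> is a convex combination of cosines of linear forms and \<open>Q\<close> the same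
  combination of the halved squares, so that \<open>K + Q\<close> is a sum of convex ridge functions.\<close>
inductive cos_pair :: "('a::euclidean_space \<Rightarrow> real) \<Rightarrow> ('a \<Rightarrow> real) \<Rightarrow> bool" where
  cos_pair_cos: "cos_pair (\<lambda>x. cos (u \<bullet> x)) (\<lambda>x. (u \<bullet> x)\<^sup>2 / 2)"
| cos_pair_mean: "\<lbrakk>cos_pair K Q; cos_pair K' Q'\<rbrakk>
    \<Longrightarrow> cos_pair (\<lambda>x. (K x + K' x) / 2) (\<lambda>x. (Q x + Q' x) / 2)"

lemma convex_cos_plus_square: "convex_on UNIV (\<lambda>t::real. cos t + t\<^sup>2 / 2)"
proof (rule convex_on_realI)
  show "((\<lambda>t. cos t + t\<^sup>2 / 2) has_real_derivative (- sin t + t)) (at t)" for t :: real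
    by (auto intro!: derivative_eq_intros)
  fix x y :: real assume xy: "x \<le> y"
  have "\<exists>z. sin y - sin x = (y - x) * cos z"
  proof (cases "x = y")
    case False
    then have "\<exists>z. x < z \<and> z < y \<and> sin y - sin x = (y - x) * cos z"
      using xy by (intro MVT2) auto
    then show ?thesis by blast
  qed simp
  then obtain z where "sin y - sin x = (y - x) * cos z" by blast
  moreover have "(y - x) * cos z \<le> (y - x) * 1"
    using xy by (intro mult_left_mono) auto
  ultimately show "- sin x + x \<le> - sin y + y" by simp
qed simp

lemma convex_square: "convex_on UNIV (\<lambda>t::real. t\<^sup>2)"
  using convex_power2 by simp

lemma hinge_cone_cos_pair:
  assumes "cos_pair K Q"
  shows "(\<lambda>x. K x + Q x) \<in> hinge_cone"
  using assms
proof induction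
  case (cos_pair_cos u)
  show ?case by (rule hinge_cone_ridge[OF convex_cos_plus_square])
next
  case (cos_pair_mean K Q K' Q')
  then have "(\<lambda>x. 1/2 * ((K x + Q x) + (K' x + Q' x))) \<in> hinge_cone"
    by (intro hinge_cone_scale hinge_cone_add[of "\<lambda>x. K x + Q x"]) auto
  moreover have "(\<lambda>x. 1/2 * ((K x + Q x) + (K' x + Q' x))) = (\<lambda>x. (K x + K' x) / 2 + (Q x + Q' x) / 2)"
    by (rule ext) (simp add: field_simps)
  ultimately show ?case by (simp only:)
qed

text \<open>A product of two cosines is the mean of the cosines of sum and difference, and by the
  parallelogram law the mean of the two squares is the sum of the original squares. Under products
  the quadratic parts therefore simply add.\<close>

lemma cos_pair_mult_cos:
  assumes "cos_pair K Q"
  shows "cos_pair (\<lambda>x. K x * cos (v \<bullet> x)) (\<lambda>x. Q x + (v \<bullet> x)\<^sup>2 / 2)"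
  using assms
proof induction
  case (cos_pair_cos u)
  have "cos_pair (\<lambda>x. (cos ((u - v) \<bullet> x) + cos ((u + v) \<bullet> x)) / 2)
      (\<lambda>x. (((u - v) \<bullet> x)\<^sup>2 / 2 + ((u + v) \<bullet> x)\<^sup>2 / 2) / 2)"
    by (intro cos_pair.intros)
  moreover have "(\<lambda>x. (cos ((u - v) \<bullet> x) + cos ((u + v) \<bullet> x)) / 2) = (\<lambda>x. cos (u \<bullet> x) * cos (v \<bullet> x))"
    by (simp add: inner_diff_left inner_add_left cos_add cos_diff)
  moreover have "(\<lambda>x. (((u - v) \<bullet> x)\<^sup>2 / 2 + ((u + v) \<bullet> x)\<^sup>2 / 2) / 2) = (\<lambda>x. (u \<bullet> x)\<^sup>2 / 2 + (v \<bullet> x)\<^sup>2 / 2)"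
    by (rule ext) (simp add: inner_diff_left inner_add_left power2_eq_square field_simps)
  ultimately show ?case by simp
next
  case (cos_pair_mean K Q K' Q')
  have "cos_pair (\<lambda>x. (K x * cos (v \<bullet> x) + K' x * cos (v \<bullet> x)) / 2)
      (\<lambda>x. (Q x + (v \<bullet> x)\<^sup>2 / 2 + (Q' x + (v \<bullet> x)\<^sup>2 / 2)) / 2)"
    by (intro cos_pair.cos_pair_mean cos_pair_mean.IH)
  moreover have "(\<lambda>x. (K x * cos (v \<bullet> x) + K' x * cos (v \<bullet> x)) / 2) = (\<lambda>x. (K x + K' x) / 2 * cos (v \<bullet> x))"
    by (simp add: field_simps)
  moreover have "(\<lambda>x. (Q x + (v \<bullet> x)\<^sup>2 / 2 + (Q' x + (v \<bullet> x)\<^sup>2 / 2)) / 2) = (\<lambda>x. (Q x + Q' x) / 2 + (v \<bullet> x)\<^sup>2 / 2)"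
    by (rule ext) (simp add: field_simps)
  ultimately show ?case by simp
qed

lemma cos_pair_prod:
  assumes "finite I"
  shows "cos_pair (\<lambda>x. \<Prod>i\<in>I. cos (u i \<bullet> x) ^ n i) (\<lambda>x. \<Sum>i\<in>I. n i * ((u i \<bullet> x)\<^sup>2 / 2))"
  using assms
proof (induction I)
  case empty
  show ?case using cos_pair_cos[of 0] by simp
next
  case (insert i I)
  have "cos_pair (\<lambda>x. (\<Prod>j\<in>I. cos (u j \<bullet> x) ^ n j) * cos (u i \<bullet> x) ^ k)
      (\<lambda>x. (\<Sum>j\<in>I. n j * ((u j \<bullet> x)\<^sup>2 / 2)) + k * ((u i \<bullet> x)\<^sup>2 / 2))" for k :: nat
  proof (induction k)
    case 0
    then show ?case using insert.IH by simp
  next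
    case (Suc k)
    from cos_pair_mult_cos[OF this, of "u i"] show ?case
      by (simp add: algebra_simps add_divide_distrib)
  qed
  from this[of "n i"] show ?case
    using insert.hyps by (simp add: algebra_simps)
qed

text \<open>Both functions agree with \<open>1 - y\<^sup>2 / 2\<close> to second order, with errors
  at most \<open>y ^ 4 / 24\<close> and \<open>y ^ 4 / 4\<close>.\<close>

lemma cos_minus_gauss_bound: "\<bar>cos y - exp (- y\<^sup>2 / 2)\<bar> \<le> y ^ 4" for y :: real
proof -
  obtain t where t: "cos y = (\<Sum>m<4. cos_coeff m * y ^ m) + (cos (t + 1/2 * real 4 * pi) / fact 4) * y ^ 4"
    using Maclaurin_cos_expansion[of y 4] by blast
  have s: "(\<Sum>m<4. cos_coeff m * y ^ m) = 1 - y\<^sup>2 / 2"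
  proof -
    have "{..<4::nat} = {0, 1, 2, 3}" by auto
    then show ?thesis by (simp add: cos_coeff_def fact_numeral)
  qed
  have "\<bar>cos y - (1 - y\<^sup>2 / 2)\<bar> = \<bar>cos (t + 1/2 * real 4 * pi)\<bar> / 24 * y ^ 4"
    unfolding t s by (simp add: abs_mult fact_numeral)
  also have "\<dots> \<le> 1 / 24 * y ^ 4"
    by (intro mult_right_mono divide_right_mono) auto
  finally have c: "\<bar>cos y - (1 - y\<^sup>2 / 2)\<bar> \<le> y ^ 4 / 24" by simp
  define z where "z = y\<^sup>2 / 2"
  have z: "0 \<le> z" by (simp add: z_def)
  have z2: "z\<^sup>2 = y ^ 4 / 4" by (simp add: z_def power_divide flip: power_mult)
  have "1 - z \<le> exp (- z)"
    using exp_ge_add_one_self[of "- z"] by simp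
  moreover have "exp (- z) \<le> 1 - z + z\<^sup>2"
  proof -
    have "exp (- z) \<le> 1 / (1 + z)"
      using exp_ge_add_one_self[of z] z by (simp add: exp_minus field_simps)
    also have "\<dots> \<le> 1 - z + z\<^sup>2"
    proof -
      have "1 \<le> (1 + z) * (1 - z + z\<^sup>2)"
        using z by (simp add: algebra_simps power2_eq_square)
      then show ?thesis using z by (simp add: field_simps)
    qed
    finally show ?thesis .
  qed
  ultimately have "\<bar>exp (- z) - (1 - z)\<bar> \<le> y ^ 4 / 4" using z2 by simp
  moreover have "exp (- y\<^sup>2 / 2) = exp (- z)" by (simp add: z_def)
  moreover have "0 \<le> y ^ 4" by simp
  moreover have "\<bar>cos y - (1 - z)\<bar> \<le> y ^ 4 / 24" using c by (simp only: z_def)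
  ultimately show ?thesis by linarith
qed

lemma norm_power2_eq_sum: "(norm x)\<^sup>2 = (\<Sum>i\<in>Basis. (i \<bullet> x)\<^sup>2)" for x :: "'a::euclidean_space"
  unfolding power2_norm_eq_inner by (subst euclidean_inner) (simp add: power2_eq_square inner_commute)

lemma gauss_eq_prod: "exp (- (norm x)\<^sup>2 / 2) = (\<Prod>i\<in>Basis. exp (- (i \<bullet> x)\<^sup>2 / 2))"
  for x :: "'a::euclidean_space"
  by (simp add: norm_power2_eq_sum sum_negf sum_divide_distrib flip: exp_sum)

text \<open>As in the central limit theorem, \<open>cos (t / sqrt N) ^ N\<close> tends to the
  Gaussian in each coordinate. The quadratic companion is \<open>N\<close> times half the square of
  \<open>t / sqrt N\<close>, hence does not depend on \<open>N\<close>.\<close>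

lemma hinge_cone_gauss:
  "(\<lambda>x::'a::euclidean_space. exp (- (norm x)\<^sup>2 / 2) + (norm x)\<^sup>2 / 2) \<in> hinge_cone"
proof (rule hinge_cone_closed)
  fix K :: "'a set" and e :: real assume K: "compact K" and e: "0 < e"
  obtain R where R: "\<And>x. x \<in> K \<Longrightarrow> norm x \<le> R"
    using compact_imp_bounded[OF K] unfolding bounded_iff by blast
  \<comment> \<open>Each of the \<open>N\<close> factors per coordinate errs by at most
    \<open>R ^ 4 / N\<^sup>2\<close>, so the total error is at most
    \<open>DIM('a) * R ^ 4 / N\<close>.\<close>
  obtain N :: nat where N: "real DIM('a) * R ^ 4 / e < N"
    using reals_Archimedean2 by blast
  then have N0: "0 < real N"
    using e by (smt (verit) divide_nonneg_pos mult_nonneg_nonneg of_nat_0_le_iff zero_le_even_power even_numeral)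
  define u where "u i = (1 / sqrt N) *\<^sub>R i" for i :: 'a
  have "(\<lambda>x. (\<Prod>i\<in>Basis. cos (u i \<bullet> x) ^ N) + (\<Sum>i\<in>Basis. N * ((u i \<bullet> x)\<^sup>2 / 2))) \<in> hinge_cone"
    by (rule hinge_cone_cos_pair[OF cos_pair_prod]) simp
  moreover have "(\<Sum>i\<in>Basis. N * ((u i \<bullet> x)\<^sup>2 / 2)) = (norm x)\<^sup>2 / 2" for x
  proof -
    have "(\<Sum>i\<in>Basis. N * ((u i \<bullet> x)\<^sup>2 / 2)) = (\<Sum>i\<in>Basis. (i \<bullet> x)\<^sup>2 / 2)"
      using N0 by (intro sum.cong) (simp_all add: u_def power_divide)
    then show ?thesis by (simp add: norm_power2_eq_sum sum_divide_distrib)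
  qed
  ultimately have mem: "(\<lambda>x. (\<Prod>i\<in>Basis. cos (u i \<bullet> x) ^ N) + (norm x)\<^sup>2 / 2) \<in> hinge_cone"
    by (simp only:)
  show "\<exists>G\<in>hinge_cone. \<forall>x\<in>K. \<bar>exp (- (norm x)\<^sup>2 / 2) + (norm x)\<^sup>2 / 2 - G x\<bar> \<le> e"
  proof (intro bexI[OF _ mem] ballI)
    fix x assume x: "x \<in> K"
    have ex: "exp (- (i \<bullet> x)\<^sup>2 / 2) = exp (- (u i \<bullet> x)\<^sup>2 / 2) ^ N" for i
    proof -
      have "real N * (- (u i \<bullet> x)\<^sup>2 / 2) = - (i \<bullet> x)\<^sup>2 / 2"
        using N0 by (simp add: u_def power_divide)
      then show ?thesis
        using exp_of_nat_mult[of N "- (u i \<bullet> x)\<^sup>2 / 2"] by (simp only:)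
    qed
    have "\<bar>exp (- (norm x)\<^sup>2 / 2) - (\<Prod>i\<in>Basis. cos (u i \<bullet> x) ^ N)\<bar>
        = norm ((\<Prod>i\<in>Basis. exp (- (u i \<bullet> x)\<^sup>2 / 2) ^ N) - (\<Prod>i\<in>Basis. cos (u i \<bullet> x) ^ N))"
    proof -
      have "exp (- (norm x)\<^sup>2 / 2) = (\<Prod>i\<in>Basis. exp (- (u i \<bullet> x)\<^sup>2 / 2) ^ N)"
        unfolding gauss_eq_prod by (intro prod.cong refl ex)
      then show ?thesis by (simp only: real_norm_def)
    qed
    also have "\<dots> \<le> (\<Sum>i\<in>(Basis::'a set). norm (exp (- (u i \<bullet> x)\<^sup>2 / 2) ^ N - cos (u i \<bullet> x) ^ N))"
      by (rule norm_prod_diff) (auto simp: power_abs intro!: power_le_one)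
    also have "\<dots> \<le> (\<Sum>i\<in>(Basis::'a set). R ^ 4 / N)"
    proof (rule sum_mono)
      fix i :: 'a assume i: "i \<in> Basis"
      have "norm (exp (- (u i \<bullet> x)\<^sup>2 / 2) ^ N - cos (u i \<bullet> x) ^ N)
          \<le> N * norm (exp (- (u i \<bullet> x)\<^sup>2 / 2) - cos (u i \<bullet> x))"
        by (rule norm_power_diff) auto
      also have "\<dots> \<le> N * (u i \<bullet> x) ^ 4"
        using cos_minus_gauss_bound[of "u i \<bullet> x"] by (intro mult_left_mono) (auto simp: abs_minus_commute)
      also have "\<dots> = \<bar>i \<bullet> x\<bar> ^ 4 / N"
      proof -
        have "(sqrt N) ^ 4 = real N ^ 2"
          using real_sqrt_pow2[of "real N"] by (simp add: power4_eq_xxxx power2_eq_square)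
        then show ?thesis
          using N0 by (simp add: u_def power_divide power2_eq_square)
      qed
      also have "\<dots> \<le> R ^ 4 / N"
      proof -
        have "\<bar>i \<bullet> x\<bar> \<le> R"
          using Basis_le_norm[OF i, of x] R[OF x] by (simp add: inner_commute)
        then show ?thesis by (intro divide_right_mono power_mono) auto
      qed
      finally show "norm (exp (- (u i \<bullet> x)\<^sup>2 / 2) ^ N - cos (u i \<bullet> x) ^ N) \<le> R ^ 4 / N" .
    qed
    also have "\<dots> \<le> e"
      using N N0 e by (simp add: field_simps)
    finally show "\<bar>exp (- (norm x)\<^sup>2 / 2) + (norm x)\<^sup>2 / 2
        - ((\<Prod>i\<in>Basis. cos (u i \<bullet> x) ^ N) + (norm x)\<^sup>2 / 2)\<bar> \<le> e" by simp
  qed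
qed

section \<open>Gaussian smoothing\<close>

text \<open>Riemann sums of the integral are combinations of translates of \<open>\<Phi>\<close>
  with nonnegative weights, hence lie in the cone; uniform continuity of \<open>\<Phi>\<close> makes
  them converge uniformly in \<open>x\<close> on \<open>K\<close>.\<close>

lemma hinge_cone_convolution:
  fixes h :: "'a::euclidean_space \<Rightarrow> real"
  assumes h: "continuous_on UNIV h" "\<And>x. 0 \<le> h x" and \<Phi>: "\<Phi> \<in> hinge_cone"
  shows "(\<lambda>x. \<integral>a. indicator (cball 0 R) a *\<^sub>R (h a * \<Phi> (x - a)) \<partial>lborel) \<in> hinge_cone"
proof (rule hinge_cone_closed)
  fix K :: "'a set" and e :: real assume K: "compact K" and e: "0 < e"
  let ?B = "cball (0::'a) R"
  have \<Phi>c: "continuous_on UNIV \<Phi>" by (rule hinge_cone_continuous[OF \<Phi>])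
  have intB: "set_integrable lborel ?B f" if "continuous_on UNIV f" for f :: "'a \<Rightarrow> real"
    unfolding set_integrable_def
    by (intro borel_integrable_compact compact_cball continuous_on_subset[OF that]) auto
  have cont_h\<Phi>: "continuous_on UNIV (\<lambda>a. h a * \<Phi> (x - a))" for x
    by (intro continuous_intros h continuous_on_compose2[OF \<Phi>c]) auto
  have intS: "set_integrable lborel S h" "set_integrable lborel S (\<lambda>a. h a * \<Phi> (x - a))"
    if "S \<in> sets borel" "S \<subseteq> ?B" for S x
    using that by (auto intro!: set_integrable_subset[OF intB] h cont_h\<Phi>)
  define J where "J = (LINT a:?B|lborel. h a)"
  have J: "0 \<le> J" unfolding J_def set_lebesgue_integral_def
    by (intro integral_nonneg_AE AE_I2) (auto simp: h)
  \<comment> \<open>Tolerance per unit of mass of \<open>h\<close>; the added 1 covers the case of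
    mass 0.\<close>
  define e' where "e' = e / (J + 1)"
  have e': "0 < e'" "e' * J \<le> e"
    using e J by (auto simp: e'_def field_simps)
  have "compact {x - y |x y. x \<in> K \<and> y \<in> ?B}"
    by (intro compact_differences K compact_cball)
  then have "uniformly_continuous_on {x - y |x y. x \<in> K \<and> y \<in> ?B} \<Phi>"
    by (intro compact_uniformly_continuous continuous_on_subset[OF \<Phi>c]) auto
  then obtain \<delta> where \<delta>: "0 < \<delta>" and uc: "\<And>x a c. \<lbrakk>x \<in> K; a \<in> ?B; c \<in> ?B; dist a c < \<delta>\<rbrakk>
      \<Longrightarrow> \<bar>\<Phi> (x - a) - \<Phi> (x - c)\<bar> \<le> e'"
  proof -
    assume u: "uniformly_continuous_on {x - y |x y. x \<in> K \<and> y \<in> ?B} \<Phi>"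
    obtain d where d: "0 < d" "\<And>p q. \<lbrakk>p \<in> {x - y |x y. x \<in> K \<and> y \<in> ?B};
        q \<in> {x - y |x y. x \<in> K \<and> y \<in> ?B}; dist q p < d\<rbrakk> \<Longrightarrow> dist (\<Phi> q) (\<Phi> p) < e'"
      using u e'(1) unfolding uniformly_continuous_on_def by meson
    show ?thesis
    proof (rule that[OF d(1)])
      fix x a c assume *: "x \<in> K" "a \<in> ?B" "c \<in> ?B" "dist a c < d"
      have "dist (x - a) (x - c) < d" using *(4) by (simp add: dist_norm norm_minus_commute)
      then have "dist (\<Phi> (x - a)) (\<Phi> (x - c)) < e'"
        using * by (intro d(2)) blast+
      then show "\<bar>\<Phi> (x - a) - \<Phi> (x - c)\<bar> \<le> e'" by (simp add: dist_real_def)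
    qed
  qed
  \<comment> \<open>The region \<open>S\<close> varies in the induction: the part of
    \<open>S\<close> near one centre is split off and \<open>\<Phi>\<close> frozen there, so that
    overlapping balls are never counted twice.\<close>
  have part: "\<exists>G\<in>hinge_cone. \<forall>x\<in>K. \<bar>(LINT a:S|lborel. h a * \<Phi> (x - a)) - G x\<bar> \<le> e' * (LINT a:S|lborel. h a)"
    if "finite I" "S \<in> sets borel" "S \<subseteq> ?B" "I \<subseteq> ?B" "S \<subseteq> (\<Union>c\<in>I. ball c \<delta>)" for I S
    using that
  proof (induction I arbitrary: S)
    case empty
    then have "S = {}" by simp
    then show ?case
      by (intro bexI[OF _ hinge_cone_affine[of 0 0]]) (simp add: set_lebesgue_integral_def)
  next
    case (insert c I)
    define S1 where "S1 = S \<inter> ball c \<delta>"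
    define S2 where "S2 = S - ball c \<delta>"
    have S1: "S1 \<in> sets borel" "S1 \<subseteq> ?B" and S2: "S2 \<in> sets borel" "S2 \<subseteq> ?B"
      using insert.prems by (auto simp: S1_def S2_def)
    have S: "S = S1 \<union> S2" "S1 \<inter> S2 = {}" by (auto simp: S1_def S2_def)
    obtain G where G: "G \<in> hinge_cone"
      "\<And>x. x \<in> K \<Longrightarrow> \<bar>(LINT a:S2|lborel. h a * \<Phi> (x - a)) - G x\<bar> \<le> e' * (LINT a:S2|lborel. h a)"
    proof -
      have "S2 \<subseteq> (\<Union>c\<in>I. ball c \<delta>)" using insert.prems by (auto simp: S2_def)
      then have "\<exists>G\<in>hinge_cone. \<forall>x\<in>K. \<bar>(LINT a:S2|lborel. h a * \<Phi> (x - a)) - G x\<bar> \<le> e' * (LINT a:S2|lborel. h a)"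
        using insert.prems by (intro insert.IH S2) auto
      then show ?thesis using that by blast
    qed
    define w where "w = (LINT a:S1|lborel. h a)"
    have w: "0 \<le> w" unfolding w_def set_lebesgue_integral_def
      by (intro integral_nonneg_AE AE_I2) (auto simp: h)
    have c: "(\<lambda>x. w * \<Phi> (1 *\<^sub>R x + - c) + G x) \<in> hinge_cone"
      by (intro hinge_cone_add G(1) hinge_cone_scale hinge_cone_affine_compose \<Phi> w)
    show ?case
    proof (intro bexI[OF _ c] ballI)
      fix x assume x: "x \<in> K"
      have split: "(LINT a:S|lborel. h a * \<Phi> (x - a))
          = (LINT a:S1|lborel. h a * \<Phi> (x - a)) + (LINT a:S2|lborel. h a * \<Phi> (x - a))"
        "(LINT a:S|lborel. h a) = w + (LINT a:S2|lborel. h a)"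
        unfolding S(1) w_def using S(2) intS S1 S2 by (auto intro!: set_integral_Un)
      have ic: "set_integrable lborel S1 (\<lambda>a. h a * \<Phi> (x - c))"
        using intS(1)[OF S1] by (rule set_integrable_mult_left)
      have "\<bar>(LINT a:S1|lborel. h a * \<Phi> (x - a)) - w * \<Phi> (x - c)\<bar>
          = \<bar>LINT a:S1|lborel. h a * \<Phi> (x - a) - h a * \<Phi> (x - c)\<bar>"
        using set_integral_diff(2)[OF intS(2)[OF S1, of x] ic] by (simp add: w_def)
      also have "\<dots> \<le> (LINT a:S1|lborel. e' * h a)"
        unfolding set_lebesgue_integral_def real_norm_def[symmetric]
      proof (rule Bochner_Integration.integral_norm_bound_integral)
        show "integrable lborel (\<lambda>a. indicat_real S1 a *\<^sub>R (h a * \<Phi> (x - a) - h a * \<Phi> (x - c)))"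
          using set_integral_diff(1)[OF intS(2)[OF S1, of x] ic] by (simp add: set_integrable_def)
        show "integrable lborel (\<lambda>a. indicat_real S1 a *\<^sub>R (e' * h a))"
          using set_integrable_mult_right[of e', OF intS(1)[OF S1]] by (simp add: set_integrable_def)
        fix a
        show "norm (indicat_real S1 a *\<^sub>R (h a * \<Phi> (x - a) - h a * \<Phi> (x - c))) \<le> indicat_real S1 a *\<^sub>R (e' * h a)"
        proof (cases "a \<in> S1")
          case True
          then have "\<bar>\<Phi> (x - a) - \<Phi> (x - c)\<bar> \<le> e'"
            using S1 insert.prems x by (intro uc) (auto simp: S1_def dist_commute)
          then have "h a * \<bar>\<Phi> (x - a) - \<Phi> (x - c)\<bar> \<le> h a * e'"
            by (intro mult_left_mono h)
          then show ?thesis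
            using True h(2)[of a] by (simp add: abs_mult mult.commute flip: right_diff_distrib)
        qed simp
      qed
      also have "\<dots> = e' * w"
        by (simp add: w_def)
      finally have "\<bar>(LINT a:S1|lborel. h a * \<Phi> (x - a)) - w * \<Phi> (x - c)\<bar> \<le> e' * w" .
      with G(2)[OF x] show "\<bar>(LINT a:S|lborel. h a * \<Phi> (x - a)) - (w * \<Phi> (1 *\<^sub>R x + - c) + G x)\<bar>
          \<le> e' * (LINT a:S|lborel. h a)"
        unfolding split by (simp add: distrib_left)
    qed
  qed
  obtain I where I: "I \<subseteq> ?B" "finite I" "?B \<subseteq> (\<Union>c\<in>I. ball c \<delta>)"
    using compactE_image[OF compact_cball, of ?B "\<lambda>c. ball c \<delta>" 0 R] \<delta> by (metis (no_types, lifting) UN_I centre_in_ball open_ball subsetI)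
  obtain G where G: "G \<in> hinge_cone" "\<And>x. x \<in> K \<Longrightarrow> \<bar>(LINT a:?B|lborel. h a * \<Phi> (x - a)) - G x\<bar> \<le> e' * J"
    using part[OF I(2) _ _ I(1,3)] by (auto simp: J_def)
  show "\<exists>G\<in>hinge_cone. \<forall>x\<in>K. \<bar>(\<integral>a. indicator ?B a *\<^sub>R (h a * \<Phi> (x - a)) \<partial>lborel) - G x\<bar> \<le> e"
    using G e'(2) unfolding set_lebesgue_integral_def by (meson order_trans)
qed

text \<open>Unnormalised, in the form that \<open>hinge_cone_gauss\<close> provides;
  \<open>smooth\<close> divides by \<open>gauss_mass\<close> instead.\<close>

definition gauss :: "'a::euclidean_space \<Rightarrow> real" where
  "gauss x = exp (- (norm x)\<^sup>2 / 2)"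

lemma gauss_pos: "0 < gauss x"
  by (simp add: gauss_def)

lemma continuous_gauss: "continuous_on S gauss"
  unfolding gauss_def[abs_def] by (intro continuous_intros) auto

lemma gauss_measurable [measurable]: "gauss \<in> borel_measurable borel"
  by (intro borel_measurable_continuous_onI continuous_gauss)

lemma integrable_gauss: "integrable lborel (gauss :: 'a::euclidean_space \<Rightarrow> real)"
proof (rule integrableI_nonneg)
  have 1: "(\<integral>\<^sup>+t. ennreal (exp (- t\<^sup>2 / 2)) \<partial>lborel) < \<infinity>"
  proof -
    have "integrable lborel (\<lambda>t. sqrt (2 * pi) * std_normal_density t)"
      using integrable_std_normal_moment[of 0] by simp
    then have "integrable lborel (\<lambda>t. exp (- t\<^sup>2 / 2) :: real)"
      by (simp add: std_normal_density_def)
    then show ?thesis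
      by (simp add: integrable_iff_bounded)
  qed
  have "(\<integral>\<^sup>+x. ennreal (gauss x) \<partial>(lborel :: 'a measure))
      = (\<integral>\<^sup>+x. (\<Prod>i\<in>Basis. (\<lambda>_ t. ennreal (exp (- t\<^sup>2 / 2))) i (x \<bullet> i)) \<partial>(lborel :: 'a measure))"
  proof (rule nn_integral_cong)
    fix x :: 'a
    have "ennreal (gauss x) = ennreal (\<Prod>i\<in>Basis. exp (- (i \<bullet> x)\<^sup>2 / 2))"
      unfolding gauss_def by (simp only: gauss_eq_prod)
    also have "\<dots> = (\<Prod>i\<in>Basis. ennreal (exp (- (i \<bullet> x)\<^sup>2 / 2)))"
      by (rule prod_ennreal[symmetric]) simp
    finally show "ennreal (gauss x) = (\<Prod>i\<in>Basis. (\<lambda>_ t. ennreal (exp (- t\<^sup>2 / 2))) i (x \<bullet> i))"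
      by (simp only: inner_commute)
  qed
  also have "\<dots> = (\<Prod>i\<in>(Basis::'a set). \<integral>\<^sup>+t. ennreal (exp (- t\<^sup>2 / 2)) \<partial>lborel)"
    by (rule nn_integral_lborel_prod) auto
  also have "\<dots> < \<infinity>"
    using 1 by (simp add: power_less_top_ennreal)
  finally show "(\<integral>\<^sup>+x. ennreal (gauss x) \<partial>(lborel :: 'a measure)) < \<infinity>" .
qed (auto simp: less_imp_le[OF gauss_pos])

definition gauss_mass :: "'a::euclidean_space itself \<Rightarrow> real" where
  "gauss_mass _ = (\<integral>x. gauss x \<partial>(lborel :: 'a measure))"

lemma gauss_mass_pos: "0 < gauss_mass TYPE('a::euclidean_space)"
proof -
  have "0 \<le> gauss_mass TYPE('a)"
    unfolding gauss_mass_def by (intro integral_nonneg_AE AE_I2 less_imp_le[OF gauss_pos])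
  moreover have "gauss_mass TYPE('a) \<noteq> 0"
  proof
    assume "gauss_mass TYPE('a) = 0"
    then have "AE x in (lborel :: 'a measure). gauss x = 0"
      unfolding gauss_mass_def
      using integral_nonneg_eq_0_iff_AE[OF integrable_gauss[where 'a = 'a]] by (simp add: less_imp_le[OF gauss_pos])
    then have "AE x in (lborel :: 'a measure). False"
      by (rule AE_mp) (auto simp: less_imp_neq[OF gauss_pos, symmetric])
    then show False
      by (simp add: AE_iff_null null_sets_def)
  qed
  ultimately show ?thesis by simp
qed

lemma gauss_tail:
  assumes "0 < e"
  obtains T where "0 < T" "(\<integral>x. indicator (- cball 0 T) x *\<^sub>R gauss x \<partial>(lborel :: 'a::euclidean_space measure)) \<le> e"
proof -
  have "(\<lambda>n. \<integral>x. indicator (- cball 0 (real n)) x *\<^sub>R gauss x \<partial>(lborel :: 'a measure)) \<longlonglongrightarrow> (\<integral>x. 0 \<partial>(lborel :: 'a measure))"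
  proof (rule integral_dominated_convergence[where w = gauss])
    show "AE x in (lborel :: 'a measure). (\<lambda>n. indicat_real (- cball 0 (real n)) x *\<^sub>R gauss x) \<longlonglongrightarrow> 0"
    proof (intro AE_I2 tendsto_eventually)
      fix x :: 'a
      show "\<forall>\<^sub>F n in sequentially. indicat_real (- cball 0 (real n)) x *\<^sub>R gauss x = 0"
        using eventually_ge_at_top[of "nat \<lceil>norm x\<rceil>"]
        by eventually_elim (auto simp: indicator_def nat_le_iff ceiling_le_iff)
    qed
    show "AE x in lborel. norm (indicat_real (- cball 0 (real n)) x *\<^sub>R gauss x) \<le> gauss x" for n
      by (intro AE_I2) (auto simp: indicator_def less_imp_le[OF gauss_pos])
  qed (auto intro: integrable_gauss)
  then have "\<forall>\<^sub>F n in sequentially. (\<integral>x. indicator (- cball 0 (real n)) x *\<^sub>R gauss x \<partial>(lborel :: 'a measure)) < e"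
    using assms by (intro order_tendstoD(2)) auto
  then have "\<forall>\<^sub>F n in sequentially. (\<integral>x. indicator (- cball 0 (real n)) x *\<^sub>R gauss x \<partial>(lborel :: 'a measure)) < e \<and> 0 < n"
    by (intro eventually_conj eventually_gt_at_top)
  then obtain n where "(\<integral>x. indicator (- cball 0 (real n)) x *\<^sub>R gauss x \<partial>(lborel :: 'a measure)) < e \<and> 0 < n"
    by (auto simp: eventually_sequentially)
  then show ?thesis by (intro that[of "real n"]) auto
qed

lemma hinge_cone_norm_square: "(\<lambda>x::'a::euclidean_space. (norm x)\<^sup>2) \<in> hinge_cone"
  unfolding norm_power2_eq_sum by (intro hinge_cone_sum hinge_cone_ridge convex_square)

text \<open>\<open>h\<close> is the excess of a convex function over the squared norm. It is
  nonnegative because it serves as the weight of a convolution, and has compact support because the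
  functions convolved with it grow quadratically. Only its sum with the squared norm is
  convex.\<close>

locale bump =
  fixes h :: "'a::euclidean_space \<Rightarrow> real" and R :: real
  assumes cont: "continuous_on UNIV h" and nonneg: "0 \<le> h x" and supp: "x \<notin> cball 0 R \<Longrightarrow> h x = 0"
    and convex_plus: "convex_on UNIV (\<lambda>x. (norm x)\<^sup>2 + h x)"
begin

definition smooth :: "real \<Rightarrow> 'a \<Rightarrow> real" where
  "smooth \<epsilon> x = (norm x)\<^sup>2 + (\<integral>b. h (x - \<epsilon> *\<^sub>R b) * gauss b \<partial>lborel) / gauss_mass TYPE('a)"

lemma h_measurable [measurable]: "h \<in> borel_measurable borel"
  by (intro borel_measurable_continuous_onI cont)

lemma bounded: obtains B where "0 < B" "\<And>x. h x \<le> B"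
proof -
  have "compact (h ` cball 0 R)"
    by (intro compact_continuous_image continuous_on_subset[OF cont]) auto
  from compact_imp_bounded[OF this] obtain B where B: "\<And>x. x \<in> cball 0 R \<Longrightarrow> \<bar>h x\<bar> \<le> B"
    unfolding bounded_iff by (metis imageI real_norm_def)
  have "h x \<le> max B 1" for x
    using B[of x] supp[of x] by (cases "x \<in> cball 0 R") auto
  then show ?thesis by (intro that[of "max B 1"]) auto
qed

lemma integrable_smooth: "integrable lborel (\<lambda>b. h (x - \<epsilon> *\<^sub>R b) * gauss b)"
proof -
  obtain B where B: "\<And>x. h x \<le> B" using bounded by blast
  show ?thesis
  proof (rule Bochner_Integration.integrable_bound)
    show "integrable lborel (\<lambda>b::'a. B * gauss b)"
      by (intro integrable_mult_right integrable_gauss)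
    show "AE b in lborel. norm (h (x - \<epsilon> *\<^sub>R b) * gauss b) \<le> norm (B * gauss b)"
      using B nonneg order_trans[OF nonneg B]
      by (intro AE_I2) (auto simp: abs_mult less_imp_le[OF gauss_pos] intro!: mult_right_mono)
  qed measurable
qed

text \<open>The convexity defect of the squared norm does not depend on the base point, so the convexity
  of its sum with \<open>h\<close> survives averaging \<open>h\<close> over translations.\<close>
lemma convex_smooth: "convex_on UNIV (smooth \<epsilon>)"
proof (rule convex_onI)
  fix t :: real and x y :: 'a assume t: "0 < t" "t < 1"
  let ?z = "(1 - t) *\<^sub>R x + t *\<^sub>R y"
  have q: "(norm ((1 - t) *\<^sub>R v + t *\<^sub>R w))\<^sup>2 = (1 - t) * (norm v)\<^sup>2 + t * (norm w)\<^sup>2 - t * (1 - t) * (norm (v - w))\<^sup>2"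
    for v w :: 'a
    unfolding power2_norm_eq_inner
    by (simp add: inner_add_left inner_add_right inner_diff_left inner_diff_right inner_commute algebra_simps)
  have hz: "h (?z - c) \<le> (1 - t) * h (x - c) + t * h (y - c) + t * (1 - t) * (norm (x - y))\<^sup>2" for c
  proof -
    have e: "?z - c = (1 - t) *\<^sub>R (x - c) + t *\<^sub>R (y - c)"
      by (simp add: algebra_simps)
    have "(norm (?z - c))\<^sup>2 + h (?z - c) \<le> (1 - t) * ((norm (x - c))\<^sup>2 + h (x - c)) + t * ((norm (y - c))\<^sup>2 + h (y - c))"
      unfolding e using t by (intro convex_onD[OF convex_plus]) auto
    moreover have "(norm (?z - c))\<^sup>2 = (1 - t) * (norm (x - c))\<^sup>2 + t * (norm (y - c))\<^sup>2 - t * (1 - t) * (norm (x - y))\<^sup>2"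
      unfolding e q by simp
    ultimately show ?thesis by (simp add: distrib_left)
  qed
  let ?I = "\<lambda>x. \<integral>b. h (x - \<epsilon> *\<^sub>R b) * gauss b \<partial>lborel"
  let ?Z = "gauss_mass TYPE('a)"
  have "?I ?z \<le> (\<integral>b. (1 - t) * (h (x - \<epsilon> *\<^sub>R b) * gauss b) + t * (h (y - \<epsilon> *\<^sub>R b) * gauss b)
      + t * (1 - t) * (norm (x - y))\<^sup>2 * gauss b \<partial>lborel)"
  proof (rule integral_mono)
    fix b :: 'a
    have "h (?z - \<epsilon> *\<^sub>R b) * gauss b \<le> ((1 - t) * h (x - \<epsilon> *\<^sub>R b) + t * h (y - \<epsilon> *\<^sub>R b)
        + t * (1 - t) * (norm (x - y))\<^sup>2) * gauss b"
      by (intro mult_right_mono hz less_imp_le[OF gauss_pos])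
    then show "h (?z - \<epsilon> *\<^sub>R b) * gauss b \<le> (1 - t) * (h (x - \<epsilon> *\<^sub>R b) * gauss b)
        + t * (h (y - \<epsilon> *\<^sub>R b) * gauss b) + t * (1 - t) * (norm (x - y))\<^sup>2 * gauss b"
      by (simp add: distrib_right mult.assoc)
  qed (intro integrable_smooth Bochner_Integration.integrable_add integrable_mult_right integrable_gauss)+
  also have "\<dots> = (1 - t) * ?I x + t * ?I y + t * (1 - t) * (norm (x - y))\<^sup>2 * ?Z"
    by (simp add: Bochner_Integration.integral_add integrable_smooth integrable_gauss gauss_mass_def)
  finally have "?I ?z / ?Z \<le> ((1 - t) * ?I x + t * ?I y + t * (1 - t) * (norm (x - y))\<^sup>2 * ?Z) / ?Z"
    using gauss_mass_pos[where 'a = 'a] by (intro divide_right_mono) auto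
  also have "\<dots> = (1 - t) * (?I x / ?Z) + t * (?I y / ?Z) + t * (1 - t) * (norm (x - y))\<^sup>2"
    using gauss_mass_pos[where 'a = 'a] by (simp add: add_divide_distrib)
  finally show "smooth \<epsilon> ?z \<le> (1 - t) * smooth \<epsilon> x + t * smooth \<epsilon> y"
    unfolding smooth_def q by (simp add: distrib_left)
qed simp

text \<open>Seen as an integral over centres \<open>a\<close> with weight \<open>h a\<close>, the
  average consists of translated Gaussians. Completing each to the cone element
  \<open>\<Phi>\<close> adds half of the scaled \<open>(norm (x - a))\<^sup>2\<close>, and these
  terms integrate to a multiple of \<open>(norm x)\<^sup>2\<close> plus an affine function.\<close>

lemma smooth_in_hinge_cone:
  assumes \<epsilon>: "0 < \<epsilon>"
  obtains s c d where "0 \<le> s" "(\<lambda>x. smooth \<epsilon> x + s * (norm x)\<^sup>2 + (c \<bullet> x + d)) \<in> hinge_cone"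
proof -
  let ?Z = "gauss_mass TYPE('a)"
  let ?ind = "indicat_real (cball (0::'a) R)"
  \<comment> \<open>Undoes the Jacobian of the substitution
    \<open>a = x - \<epsilon> *\<^sub>R b\<close> and normalises the Gaussian mass.\<close>
  define \<kappa> where "\<kappa> = 1 / (?Z * \<epsilon> ^ DIM('a))"
  have \<kappa>: "0 \<le> \<kappa>"
    using \<epsilon> gauss_mass_pos[where 'a = 'a] by (simp add: \<kappa>_def)
  have change: "(\<integral>a. h a * gauss ((1 / \<epsilon>) *\<^sub>R (x - a)) \<partial>lborel)
      = \<epsilon> ^ DIM('a) * (\<integral>b. h (x - \<epsilon> *\<^sub>R b) * gauss b \<partial>lborel)" for x
  proof -
    have "(\<integral>a. h a * gauss ((1 / \<epsilon>) *\<^sub>R (x - a)) \<partial>lborel)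
        = (\<integral>a. h a * gauss ((1 / \<epsilon>) *\<^sub>R (x - a))
            \<partial>density (distr lborel borel (\<lambda>b. x + (- \<epsilon>) *\<^sub>R b)) (\<lambda>_. \<bar>- \<epsilon>\<bar> ^ DIM('a)))"
      using lborel_affine[of "- \<epsilon>" x] \<epsilon> by simp
    also have "\<dots> = (\<integral>a. \<epsilon> ^ DIM('a) * (h a * gauss ((1 / \<epsilon>) *\<^sub>R (x - a))) \<partial>distr lborel borel (\<lambda>b. x + (- \<epsilon>) *\<^sub>R b))"
      using \<epsilon> by (subst integral_density) auto
    also have "\<dots> = (\<integral>b. \<epsilon> ^ DIM('a) * (h (x + (- \<epsilon>) *\<^sub>R b) * gauss ((1 / \<epsilon>) *\<^sub>R (x - (x + (- \<epsilon>) *\<^sub>R b)))) \<partial>lborel)"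
      by (subst integral_distr) auto
    also have "\<dots> = \<epsilon> ^ DIM('a) * (\<integral>b. h (x - \<epsilon> *\<^sub>R b) * gauss b \<partial>lborel)"
      using \<epsilon> by simp
    finally show ?thesis .
  qed
  define \<Phi> where "\<Phi> y = gauss ((1 / \<epsilon>) *\<^sub>R y) + (norm ((1 / \<epsilon>) *\<^sub>R y))\<^sup>2 / 2" for y :: 'a
  have \<Phi>: "\<Phi> \<in> hinge_cone"
    using hinge_cone_affine_compose[OF hinge_cone_gauss, of "1 / \<epsilon>" 0]
    by (simp add: \<Phi>_def[abs_def] gauss_def)
  have int: "integrable lborel (\<lambda>a. ?ind a *\<^sub>R f a)" if "continuous_on UNIV f"
    for f :: "'a \<Rightarrow> 'b::{banach, second_countable_topology}"
    by (intro borel_integrable_compact compact_cball continuous_on_subset[OF that]) auto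
  \<comment> \<open>\<open>A\<close>, \<open>V\<close>, \<open>W\<close> are the moments of
    \<open>h\<close> of order 0, 1, 2; they give the square, linear and constant term of the
    correction.\<close>
  define A where "A = (\<integral>a. ?ind a *\<^sub>R h a \<partial>lborel)"
  define V where "V = (\<integral>a. ?ind a *\<^sub>R (h a *\<^sub>R a) \<partial>lborel)"
  define W where "W = (\<integral>a. ?ind a *\<^sub>R (h a * (norm a)\<^sup>2) \<partial>lborel)"
  have i1: "integrable lborel (\<lambda>a. ?ind a *\<^sub>R h a)"
    and i2: "integrable lborel (\<lambda>a. ?ind a *\<^sub>R (h a *\<^sub>R a))"
    and i3: "integrable lborel (\<lambda>a. ?ind a *\<^sub>R (h a * (norm a)\<^sup>2))"
    and i4: "integrable lborel (\<lambda>a. ?ind a *\<^sub>R (h a * gauss ((1 / \<epsilon>) *\<^sub>R (x - a))))" for x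
    by (intro int continuous_intros cont continuous_on_compose2[OF continuous_gauss]; auto)+
  have A: "0 \<le> A"
    unfolding A_def by (intro integral_nonneg_AE AE_I2) (auto simp: nonneg)
  have expand: "(\<integral>a. ?ind a *\<^sub>R (h a * \<Phi> (x - a)) \<partial>lborel)
      = \<epsilon> ^ DIM('a) * (\<integral>b. h (x - \<epsilon> *\<^sub>R b) * gauss b \<partial>lborel)
        + (A * (norm x)\<^sup>2 - 2 * (V \<bullet> x) + W) / (2 * \<epsilon>\<^sup>2)" for x
  proof -
    have "(\<integral>a. ?ind a *\<^sub>R (h a * \<Phi> (x - a)) \<partial>lborel)
        = (\<integral>a. ?ind a *\<^sub>R (h a * gauss ((1 / \<epsilon>) *\<^sub>R (x - a)))
            + ((?ind a *\<^sub>R h a) * (norm x)\<^sup>2 - 2 * ((?ind a *\<^sub>R (h a *\<^sub>R a)) \<bullet> x)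
              + ?ind a *\<^sub>R (h a * (norm a)\<^sup>2)) / (2 * \<epsilon>\<^sup>2) \<partial>lborel)"
    proof (intro Bochner_Integration.integral_cong refl)
      fix a :: 'a
      have "(norm ((1 / \<epsilon>) *\<^sub>R (x - a)))\<^sup>2 = ((norm x)\<^sup>2 - 2 * (a \<bullet> x) + (norm a)\<^sup>2) / \<epsilon>\<^sup>2"
      proof -
        have "(norm (x - a))\<^sup>2 = (norm x)\<^sup>2 - 2 * (a \<bullet> x) + (norm a)\<^sup>2"
          by (simp add: power2_norm_eq_inner inner_diff_left inner_diff_right inner_commute)
        then show ?thesis by (simp add: power_divide)
      qed
      then show "?ind a *\<^sub>R (h a * \<Phi> (x - a)) = ?ind a *\<^sub>R (h a * gauss ((1 / \<epsilon>) *\<^sub>R (x - a)))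
          + ((?ind a *\<^sub>R h a) * (norm x)\<^sup>2 - 2 * ((?ind a *\<^sub>R (h a *\<^sub>R a)) \<bullet> x)
            + ?ind a *\<^sub>R (h a * (norm a)\<^sup>2)) / (2 * \<epsilon>\<^sup>2)"
        unfolding \<Phi>_def by (cases "a \<in> cball 0 R") (simp_all add: field_simps del: mem_cball)
    qed
    also have "\<dots> = (\<integral>a. ?ind a *\<^sub>R (h a * gauss ((1 / \<epsilon>) *\<^sub>R (x - a))) \<partial>lborel)
        + (A * (norm x)\<^sup>2 - 2 * (V \<bullet> x) + W) / (2 * \<epsilon>\<^sup>2)"
    proof -
      have i5: "integrable lborel (\<lambda>a. (?ind a *\<^sub>R h a) * (norm x)\<^sup>2)"
        using i1 by (rule integrable_mult_left)
      have i6: "integrable lborel (\<lambda>a. 2 * ((?ind a *\<^sub>R (h a *\<^sub>R a)) \<bullet> x))"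
        by (intro integrable_mult_right integrable_inner_left i2)
      have "(\<integral>a. (?ind a *\<^sub>R h a) * (norm x)\<^sup>2 - 2 * ((?ind a *\<^sub>R (h a *\<^sub>R a)) \<bullet> x)
          + ?ind a *\<^sub>R (h a * (norm a)\<^sup>2) \<partial>lborel) = A * (norm x)\<^sup>2 - 2 * (V \<bullet> x) + W"
      proof -
        have "(\<integral>a. 2 * ((?ind a *\<^sub>R (h a *\<^sub>R a)) \<bullet> x) \<partial>lborel) = 2 * (V \<bullet> x)"
          unfolding V_def by (subst integral_inner_left[OF i2, symmetric]) (rule integral_mult_right_zero)
        moreover have "(\<integral>a. (?ind a *\<^sub>R h a) * (norm x)\<^sup>2 \<partial>lborel) = A * (norm x)\<^sup>2"
          unfolding A_def by (rule integral_mult_left_zero)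
        ultimately show ?thesis
          using Bochner_Integration.integral_add[OF Bochner_Integration.integrable_diff[OF i5 i6] i3]
            Bochner_Integration.integral_diff[OF i5 i6] by (simp only: W_def)
      qed
      moreover have "integrable lborel (\<lambda>a. ((?ind a *\<^sub>R h a) * (norm x)\<^sup>2 - 2 * ((?ind a *\<^sub>R (h a *\<^sub>R a)) \<bullet> x)
          + ?ind a *\<^sub>R (h a * (norm a)\<^sup>2)) / (2 * \<epsilon>\<^sup>2))"
        by (intro integrable_divide_zero Bochner_Integration.integrable_add Bochner_Integration.integrable_diff i5 i6 i3)
      ultimately show ?thesis
        by (simp only: Bochner_Integration.integral_add[OF i4] integral_divide_zero)
    qed
    also have "(\<integral>a. ?ind a *\<^sub>R (h a * gauss ((1 / \<epsilon>) *\<^sub>R (x - a))) \<partial>lborel)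
        = (\<integral>a. h a * gauss ((1 / \<epsilon>) *\<^sub>R (x - a)) \<partial>lborel)"
    proof (intro Bochner_Integration.integral_cong refl)
      show "?ind a *\<^sub>R (h a * gauss ((1 / \<epsilon>) *\<^sub>R (x - a))) = h a * gauss ((1 / \<epsilon>) *\<^sub>R (x - a))" for a
        using supp[of a] by (cases "a \<in> cball 0 R") (simp_all del: mem_cball)
    qed
    finally show ?thesis unfolding change .
  qed
  have "(\<lambda>x. (norm x)\<^sup>2 + \<kappa> * (\<integral>a. ?ind a *\<^sub>R (h a * \<Phi> (x - a)) \<partial>lborel)) \<in> hinge_cone"
    by (intro hinge_cone_add hinge_cone_norm_square hinge_cone_scale hinge_cone_convolution cont nonneg \<Phi> \<kappa>)
  moreover have "(norm x)\<^sup>2 + \<kappa> * (\<integral>a. ?ind a *\<^sub>R (h a * \<Phi> (x - a)) \<partial>lborel)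
      = smooth \<epsilon> x + (\<kappa> * A / (2 * \<epsilon>\<^sup>2)) * (norm x)\<^sup>2 + ((- (\<kappa> / \<epsilon>\<^sup>2)) *\<^sub>R V \<bullet> x + \<kappa> * W / (2 * \<epsilon>\<^sup>2))" for x
  proof -
    have k: "\<kappa> * (\<epsilon> ^ DIM('a) * I) = I / ?Z" for I
      using \<epsilon> by (simp add: \<kappa>_def)
    have "\<kappa> * ((A * (norm x)\<^sup>2 - 2 * (V \<bullet> x) + W) / (2 * \<epsilon>\<^sup>2))
        = (\<kappa> * A / (2 * \<epsilon>\<^sup>2)) * (norm x)\<^sup>2 + ((- (\<kappa> / \<epsilon>\<^sup>2)) *\<^sub>R V \<bullet> x + \<kappa> * W / (2 * \<epsilon>\<^sup>2))"
      using \<epsilon> by (simp add: field_simps)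
    then show ?thesis
      unfolding expand smooth_def distrib_left k by simp
  qed
  ultimately have "(\<lambda>x. smooth \<epsilon> x + (\<kappa> * A / (2 * \<epsilon>\<^sup>2)) * (norm x)\<^sup>2
      + ((- (\<kappa> / \<epsilon>\<^sup>2)) *\<^sub>R V \<bullet> x + \<kappa> * W / (2 * \<epsilon>\<^sup>2))) \<in> hinge_cone"
    by (simp only:)
  then show ?thesis
    by (rule that[rotated]) (use A \<kappa> in simp)
qed

lemma smooth_tendsto:
  assumes K: "compact K" and e: "0 < e"
  obtains \<epsilon>0 where "0 < \<epsilon>0" "\<And>\<epsilon> x. \<lbrakk>0 < \<epsilon>; \<epsilon> < \<epsilon>0; x \<in> K\<rbrakk> \<Longrightarrow> \<bar>smooth \<epsilon> x - ((norm x)\<^sup>2 + h x)\<bar> \<le> e"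
proof -
  let ?Z = "gauss_mass TYPE('a)"
  have Z: "0 < ?Z" by (rule gauss_mass_pos)
  obtain B where B: "0 < B" "\<And>x. h x \<le> B" using bounded by blast
  \<comment> \<open>Outside this ball \<open>h\<close> changes by at most \<open>B\<close>, so the
    tail contributes at most half of \<open>e * ?Z\<close>.\<close>
  obtain T where T: "0 < T" "(\<integral>x. indicator (- cball 0 T) x *\<^sub>R gauss x \<partial>(lborel :: 'a measure)) \<le> e * ?Z / (2 * B)"
    using gauss_tail[of "e * ?Z / (2 * B)"] e Z B by auto
  have "compact {x - y |x y. x \<in> K \<and> y \<in> cball 0 T}"
    by (intro compact_differences K compact_cball)
  then have "uniformly_continuous_on {x - y |x y. x \<in> K \<and> y \<in> cball 0 T} h"
    by (intro compact_uniformly_continuous continuous_on_subset[OF cont]) auto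
  then obtain \<delta> where \<delta>: "0 < \<delta>" "\<And>p q. \<lbrakk>p \<in> {x - y |x y. x \<in> K \<and> y \<in> cball 0 T};
      q \<in> {x - y |x y. x \<in> K \<and> y \<in> cball 0 T}; dist q p < \<delta>\<rbrakk> \<Longrightarrow> dist (h q) (h p) < e / 2"
    using e unfolding uniformly_continuous_on_def by (meson half_gt_zero)
  show ?thesis
  \<comment> \<open>The bound \<open>\<delta> / T\<close> makes the shift
    \<open>\<epsilon> *\<^sub>R b\<close> shorter than \<open>\<delta>\<close>; the bound 1 keeps it
    in \<open>cball 0 T\<close>, so that the shifted point stays in the compact set of uniform
    continuity.\<close>
  proof (rule that[of "min 1 (\<delta> / T)"])
    show "0 < min 1 (\<delta> / T)" using \<delta> T by simp
    fix \<epsilon> x assume \<epsilon>: "0 < \<epsilon>" "\<epsilon> < min 1 (\<delta> / T)" and x: "x \<in> K"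
    have near: "\<bar>h (x - \<epsilon> *\<^sub>R b) - h x\<bar> \<le> e / 2" if "b \<in> cball 0 T" for b
    proof -
      have nb: "norm b \<le> T" using that by simp
      have "norm (\<epsilon> *\<^sub>R b) \<le> \<epsilon> * T"
        using \<epsilon> nb by simp
      also have "\<epsilon> * T < \<delta>" using \<epsilon> T by (simp add: field_simps)
      finally have d: "norm (\<epsilon> *\<^sub>R b) < \<delta>" .
      have "norm (\<epsilon> *\<^sub>R b) \<le> 1 * T"
        using \<epsilon> nb T unfolding norm_scaleR by (intro mult_mono) auto
      then have "\<epsilon> *\<^sub>R b \<in> cball 0 T" "0 \<in> cball (0::'a) T" using T by auto
      then have "x - \<epsilon> *\<^sub>R b \<in> {x - y |x y. x \<in> K \<and> y \<in> cball 0 T}" "x \<in> {x - y |x y. x \<in> K \<and> y \<in> cball 0 T}"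
        using x by (blast, force)
      then have "dist (h (x - \<epsilon> *\<^sub>R b)) (h x) < e / 2"
        using d by (intro \<delta>(2)) (auto simp: dist_norm)
      then show ?thesis by (simp add: dist_real_def)
    qed
    have far: "\<bar>h (x - \<epsilon> *\<^sub>R b) - h x\<bar> \<le> B" for b
      using nonneg[of x] nonneg[of "x - \<epsilon> *\<^sub>R b"] B(2)[of x] B(2)[of "x - \<epsilon> *\<^sub>R b"] by linarith
    let ?tail = "\<lambda>b::'a. indicat_real (- cball 0 T) b *\<^sub>R gauss b"
    have it: "integrable lborel ?tail"
      by (rule integrable_mult_indicator[OF _ integrable_gauss]) simp
    have ih: "integrable lborel (\<lambda>b::'a. h x * gauss b)"
      by (intro integrable_mult_right integrable_gauss)
    have "\<bar>(\<integral>b. h (x - \<epsilon> *\<^sub>R b) * gauss b \<partial>lborel) - h x * ?Z\<bar>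
        = norm (\<integral>b. h (x - \<epsilon> *\<^sub>R b) * gauss b - h x * gauss b \<partial>lborel)"
      by (subst Bochner_Integration.integral_diff[OF integrable_smooth ih]) (simp add: gauss_mass_def)
    also have "\<dots> \<le> (\<integral>b. e / 2 * gauss b + B * ?tail b \<partial>lborel)"
    proof (rule Bochner_Integration.integral_norm_bound_integral)
      show "integrable lborel (\<lambda>b. h (x - \<epsilon> *\<^sub>R b) * gauss b - h x * gauss b)"
        by (intro Bochner_Integration.integrable_diff integrable_smooth ih)
      show "integrable lborel (\<lambda>b::'a. e / 2 * gauss b + B * ?tail b)"
        by (intro Bochner_Integration.integrable_add integrable_mult_right integrable_gauss it)
      fix b :: 'a
      have g: "0 \<le> gauss b" by (rule less_imp_le[OF gauss_pos])
      have n: "norm (h (x - \<epsilon> *\<^sub>R b) * gauss b - h x * gauss b) = \<bar>h (x - \<epsilon> *\<^sub>R b) - h x\<bar> * gauss b"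
        using g by (simp add: abs_mult flip: left_diff_distrib)
      show "norm (h (x - \<epsilon> *\<^sub>R b) * gauss b - h x * gauss b) \<le> e / 2 * gauss b + B * ?tail b"
      proof (cases "b \<in> cball 0 T")
        case True
        then show ?thesis
          unfolding n using mult_right_mono[OF near[OF True] g] by (simp del: mem_cball)
      next
        case False
        have "0 \<le> e / 2 * gauss b" using e g by simp
        then show ?thesis
          unfolding n using False mult_right_mono[OF far[of b] g] by (simp del: mem_cball)
      qed
    qed
    also have "\<dots> = e / 2 * ?Z + B * (\<integral>b. ?tail b \<partial>lborel)"
      by (subst Bochner_Integration.integral_add)
        (use it in \<open>simp_all add: integrable_gauss gauss_mass_def\<close>)
    also have "\<dots> \<le> e / 2 * ?Z + B * (e * ?Z / (2 * B))"
      using T(2) B(1) by (intro add_left_mono mult_left_mono) auto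
    also have "\<dots> = e * ?Z" using B(1) by simp
    finally have *: "\<bar>(\<integral>b. h (x - \<epsilon> *\<^sub>R b) * gauss b \<partial>lborel) - h x * ?Z\<bar> \<le> e * ?Z" .
    have "\<bar>smooth \<epsilon> x - ((norm x)\<^sup>2 + h x)\<bar> = \<bar>(\<integral>b. h (x - \<epsilon> *\<^sub>R b) * gauss b \<partial>lborel) - h x * ?Z\<bar> / ?Z"
    proof -
      have "smooth \<epsilon> x - ((norm x)\<^sup>2 + h x) = ((\<integral>b. h (x - \<epsilon> *\<^sub>R b) * gauss b \<partial>lborel) - h x * ?Z) / ?Z"
        using Z by (simp add: smooth_def diff_divide_distrib)
      then show ?thesis using Z by (simp add: abs_divide)
    qed
    also have "\<dots> \<le> e" using * Z by (simp add: divide_le_eq)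
    finally show "\<bar>smooth \<epsilon> x - ((norm x)\<^sup>2 + h x)\<bar> \<le> e" .
  qed
qed

end

section \<open>Valuations vanishing on hinge sums\<close>

text \<open>A segment from \<open>x\<close> to \<open>y\<close> can be prolonged by a fixed
  \<open>r\<close> inside \<open>U\<close>, where the function is bounded; convexity bounds the
  slope on the segment by the slope up to the prolonged end.\<close>

lemma convex_on_lipschitz_compact:
  fixes f :: "'a::euclidean_space \<Rightarrow> real"
  assumes U: "open U" and f: "convex_on U f" and K: "compact K" "K \<subseteq> U"
  obtains L where "0 \<le> L" "\<And>x y. \<lbrakk>x \<in> K; y \<in> K\<rbrakk> \<Longrightarrow> f y - f x \<le> L * norm (y - x)"
proof -
  obtain r where r: "0 < r" "(\<Union>x\<in>K. cball x r) \<subseteq> U"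
    using compact_subset_open_imp_cball_epsilon_subset[OF K(1) U K(2)] .
  let ?K = "{x + y |x y. x \<in> K \<and> y \<in> cball 0 r}"
  have K': "compact ?K"
    by (intro compact_sums K compact_cball)
  have sub: "?K \<subseteq> U"
  proof
    fix z assume "z \<in> ?K"
    then obtain x y where "z = x + y" "x \<in> K" "norm y \<le> r" by auto
    then have "z \<in> cball x r" by (simp add: dist_norm)
    with \<open>x \<in> K\<close> have "z \<in> (\<Union>x\<in>K. cball x r)" by blast
    then show "z \<in> U" using r(2) by blast
  qed
  have "compact (f ` ?K)"
    by (intro compact_continuous_image K' continuous_on_subset[OF convex_on_continuous[OF U f] sub])
  from compact_imp_bounded[OF this] obtain M where "\<forall>y\<in>f ` ?K. norm y \<le> M"
    unfolding bounded_iff ..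
  then have M: "\<bar>f z\<bar> \<le> M" if "z \<in> ?K" for z
    using imageI[OF that, of f] by (simp only: real_norm_def)
  have inK: "x \<in> ?K" if "x \<in> K" for x
    using that r(1) by (intro CollectI exI[of _ x] exI[of _ 0]) auto
  show ?thesis
  proof (rule that[of "2 * \<bar>M\<bar> / r"])
    show "0 \<le> 2 * \<bar>M\<bar> / r" using r by simp
    fix x y assume x: "x \<in> K" and y: "y \<in> K"
    show "f y - f x \<le> 2 * \<bar>M\<bar> / r * norm (y - x)"
    proof (cases "x = y")
      case False
      define d where "d = norm (y - x)"
      have d: "0 < d" using False by (simp add: d_def)
      \<comment> \<open>The point at distance \<open>r\<close> beyond \<open>y\<close>;
        \<open>l\<close> below is the ratio at which \<open>y\<close> divides the segment from
        \<open>x\<close> to \<open>z\<close>.\<close>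
      define z where "z = y + (r / d) *\<^sub>R (y - x)"
      have z: "z \<in> ?K"
        unfolding z_def using y r d by (intro CollectI exI conjI refl) (auto simp: d_def)
      define l where "l = d / (d + r)"
      have l: "0 \<le> l" "l \<le> 1" "l \<le> d / r"
        using d r by (auto simp: l_def field_simps)
      have "1 + r / d = (d + r) / d"
        using d by (simp add: add_divide_distrib)
      then have "l * (1 + r / d) = 1"
        using d r(1) by (simp add: l_def)
      moreover have "(1 - l) *\<^sub>R x + l *\<^sub>R z = x + (l * (1 + r / d)) *\<^sub>R (y - x)"
        by (simp add: z_def algebra_simps)
      ultimately have "y = (1 - l) *\<^sub>R x + l *\<^sub>R z" by simp
      then have "f y \<le> (1 - l) * f x + l * f z"
        using convex_onD[OF f l(1,2), of x z] x z K sub by auto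
      then have "f y - f x \<le> l * (f z - f x)" by (simp add: algebra_simps)
      also have "\<dots> \<le> l * (2 * \<bar>M\<bar>)"
        using M[OF z] M[OF inK[OF x]] l by (intro mult_left_mono) auto
      also have "\<dots> \<le> d / r * (2 * \<bar>M\<bar>)"
        using l by (intro mult_right_mono) auto
      finally show ?thesis by (simp add: d_def mult.commute)
    qed simp
  qed
qed

text \<open>The extension is the infimal convolution of \<open>f\<close> with \<open>L\<close> times
  the norm. Compactness provides minimisers \<open>p x\<close>, convexity of \<open>K\<close> makes
  the result convex, and the Lipschitz bound makes it agree with \<open>f\<close> on
  \<open>K\<close>.\<close>

lemma convex_lipschitz_extension:
  fixes f :: "'a::euclidean_space \<Rightarrow> real"
  assumes f: "convex_on K f" "continuous_on K f" and K: "compact K" "K \<noteq> {}" and L: "0 \<le> L"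
    and lip: "\<And>x y. \<lbrakk>x \<in> K; y \<in> K\<rbrakk> \<Longrightarrow> f y - f x \<le> L * norm (y - x)"
  obtains g where "convex_on UNIV g" "\<And>x. x \<in> K \<Longrightarrow> g x = f x"
    "\<And>x y. g y - g x \<le> L * norm (y - x)"
proof -
  have "\<exists>y\<in>K. \<forall>z\<in>K. f y + L * norm (x - y) \<le> f z + L * norm (x - z)" for x
    by (intro continuous_attains_inf K continuous_intros f)
  then obtain p where p: "\<And>x. p x \<in> K"
    and min: "\<And>x z. z \<in> K \<Longrightarrow> f (p x) + L * norm (x - p x) \<le> f z + L * norm (x - z)"
    by metis
  define g where "g x = f (p x) + L * norm (x - p x)" for x
  have g_le: "g x \<le> f z + L * norm (x - z)" if "z \<in> K" for x z
    using min[OF that] by (simp add: g_def)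
  show ?thesis
  proof (rule that)
    show "convex_on UNIV g"
    proof (rule convex_onI)
      fix t :: real and x y :: 'a assume t: "0 < t" "t < 1"
      let ?z = "(1 - t) *\<^sub>R x + t *\<^sub>R y" and ?w = "(1 - t) *\<^sub>R p x + t *\<^sub>R p y"
      have w: "?w \<in> K"
        using convex_on_imp_convex[OF f(1)] p t by (simp add: convex_alt)
      have "norm (?z - ?w) = norm ((1 - t) *\<^sub>R (x - p x) + t *\<^sub>R (y - p y))"
        by (simp add: algebra_simps)
      also have "\<dots> \<le> (1 - t) * norm (x - p x) + t * norm (y - p y)"
        using t by (intro order_trans[OF norm_triangle_ineq]) simp
      finally have n: "L * norm (?z - ?w) \<le> L * ((1 - t) * norm (x - p x) + t * norm (y - p y))"
        using L by (rule mult_left_mono)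
      have "f ?w \<le> (1 - t) * f (p x) + t * f (p y)"
        using t p by (intro convex_onD[OF f(1)]) auto
      then show "g ?z \<le> (1 - t) * g x + t * g y"
        using g_le[OF w, of ?z] n by (simp add: g_def algebra_simps)
    qed simp
    show "g x = f x" if "x \<in> K" for x
      using g_le[OF that, of x] lip[OF p that, of x] by (simp add: g_def)
    show "g y - g x \<le> L * norm (y - x)" for x y
    proof -
      have "L * norm (y - p x) \<le> L * (norm (y - x) + norm (x - p x))"
        using L norm_triangle_ineq[of "y - x" "x - p x"] by (intro mult_left_mono) auto
      then show ?thesis
        using g_le[OF p, of y x] by (simp add: g_def distrib_left)
    qed
  qed
qed

text \<open>Turns an identity between two valuations into the vanishing of one, so that density
  arguments and the vanishing criterion apply to it.\<close>

lemma dual_valuation_diff: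
  assumes "dual_valuation U P m" "dual_valuation U P m'"
  shows "dual_valuation U P (\<lambda>F. m F - c *\<^sub>R m' F)"
proof -
  interpret A: dual_valuation U P m by fact
  interpret B: dual_valuation U P m' by fact
  show ?thesis
  proof
    fix F G assume FG: "convex_on U F" "convex_on U G" "convex_on U (\<lambda>x. min (F x) (G x))"
    have "c *\<^sub>R m' F + c *\<^sub>R m' G = c *\<^sub>R m' (\<lambda>x. max (F x) (G x)) + c *\<^sub>R m' (\<lambda>x. min (F x) (G x))"
      using B.val[OF FG] by (simp only: scaleR_add_right[symmetric])
    then show "m F - c *\<^sub>R m' F + (m G - c *\<^sub>R m' G)
        = m (\<lambda>x. max (F x) (G x)) - c *\<^sub>R m' (\<lambda>x. max (F x) (G x))
          + (m (\<lambda>x. min (F x) (G x)) - c *\<^sub>R m' (\<lambda>x. min (F x) (G x)))"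
      using A.val[OF FG] by (metis add_diff_add)
  next
    fix F G :: "'a \<Rightarrow> real" assume "\<And>x. x \<in> U \<Longrightarrow> F x = G x"
    then show "m F - c *\<^sub>R m' F = m G - c *\<^sub>R m' G"
      using A.cong[of F G] B.cong[of F G] by simp
  next
    fix Fs F assume "\<And>j. convex_on U (Fs j)" "convex_on U F"
      "\<And>K. compact K \<Longrightarrow> K \<subseteq> U \<Longrightarrow> uniform_limit K Fs F sequentially"
    then show "lc_tendsto P (\<lambda>j. m (Fs j) - c *\<^sub>R m' (Fs j)) (m F - c *\<^sub>R m' F)"
      by (intro lc_tendsto_diff lc_tendsto_scaleR A.lc A.cont B.cont)
  qed (simp_all add: A.lc A.open_U A.convex_U A.aff B.aff)
qed

section \<open>From hinge sums to all convex functions\<close>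

context dual_valuation begin

lemma dual_valuation_const: "dual_valuation U P (\<lambda>_. v)"
  by unfold_locales (simp_all add: lc open_U convex_U lc_tendsto_const)

lemma dual_valuation_add_scaled:
  assumes F: "convex_on U F" and t: "0 \<le> t"
  shows "dual_valuation U P (\<lambda>G. m (\<lambda>x. F x + t * G x))"
proof
  have c: "convex_on U (\<lambda>x. F x + t * G x)" if "convex_on U G" for G
    using that t by (intro convex_on_add convex_on_cmul F)
  fix G H assume GH: "convex_on U G" "convex_on U H" "convex_on U (\<lambda>x. min (G x) (H x))"
  show "m (\<lambda>x. F x + t * G x) + m (\<lambda>x. F x + t * H x)
      = m (\<lambda>x. F x + t * max (G x) (H x)) + m (\<lambda>x. F x + t * min (G x) (H x))"
  proof (rule val_eq)
    show "max (F x + t * G x) (F x + t * H x) = F x + t * max (G x) (H x)" 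
      "min (F x + t * G x) (F x + t * H x) = F x + t * min (G x) (H x)" for x
      using t by (simp_all add: max_mult_distrib_left min_mult_distrib_left max_add_distrib_right min_add_distrib_right)
  qed (intro c GH)+
next
  fix G a b assume "convex_on U G"
  then show "m (\<lambda>x. F x + t * (G x + (a \<bullet> x + b))) = m (\<lambda>x. F x + t * G x)"
    using t by (intro aff_eq[where a = "t *\<^sub>R a" and b = "t * b"] convex_on_add convex_on_cmul F)
      (simp_all add: algebra_simps)
next
  fix G H :: "'n \<Rightarrow> real" assume "\<And>x. x \<in> U \<Longrightarrow> G x = H x"
  then show "m (\<lambda>x. F x + t * G x) = m (\<lambda>x. F x + t * H x)"
    by (intro cong) simp
next
  fix Gs G assume Gs: "\<And>j. convex_on U (Gs j)" and G: "convex_on U G"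
    and lim: "\<And>K. compact K \<Longrightarrow> K \<subseteq> U \<Longrightarrow> uniform_limit K Gs G sequentially"
  show "lc_tendsto P (\<lambda>j. m (\<lambda>x. F x + t * Gs j x)) (m (\<lambda>x. F x + t * G x))"
  proof (intro cont convex_on_add convex_on_cmul F t Gs G)
    fix K assume "compact K" "K \<subseteq> U"
    from bounded_linear.uniform_limit[OF bounded_linear_mult_right lim[OF this], of t]
    show "uniform_limit K (\<lambda>j x. F x + t * Gs j x) (\<lambda>x. F x + t * G x) sequentially"
      by (intro uniform_limit_add uniform_limit_const)
  qed
qed (use lc open_U convex_U in auto)

text \<open>One sequence has to serve all compact sets, so the approximants are chosen along an
  exhaustion of \<open>U\<close> by compact sets, with errors tending to 0.\<close>

lemma vanish_if_approx:
  assumes F: "convex_on U F"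
    and ap: "\<And>K e. \<lbrakk>compact K; K \<subseteq> U; 0 < e\<rbrakk>
      \<Longrightarrow> \<exists>G. convex_on U G \<and> m G = 0 \<and> (\<forall>x\<in>K. \<bar>G x - F x\<bar> \<le> e)"
  shows "m F = 0"
proof (rule open_Union_compact_subsets[OF open_U])
  fix C :: "nat \<Rightarrow> 'n set" assume C: "\<And>n. compact (C n)" "\<And>n. C n \<subseteq> U"
    and ex: "\<And>K. \<lbrakk>compact K; K \<subseteq> U\<rbrakk> \<Longrightarrow> \<exists>N. \<forall>n\<ge>N. K \<subseteq> C n"
  have "\<exists>G. convex_on U G \<and> m G = 0 \<and> (\<forall>x\<in>C n. \<bar>G x - F x\<bar> \<le> inverse (real (Suc n)))" for n
    by (intro ap C) simp
  then obtain G where G: "\<And>n. convex_on U (G n)" "\<And>n. m (G n) = 0"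
      "\<And>n x. x \<in> C n \<Longrightarrow> \<bar>G n x - F x\<bar> \<le> inverse (real (Suc n))"
    by metis
  have "lc_tendsto P (\<lambda>n. m (G n)) (m F)"
  proof (intro cont G F)
    fix K assume K: "compact K" "K \<subseteq> U"
    obtain N where N: "\<And>n. n \<ge> N \<Longrightarrow> K \<subseteq> C n" using ex[OF K] by blast
    show "uniform_limit K G F sequentially"
      unfolding uniform_limit_iff
    proof (intro allI impI)
      fix e :: real assume "0 < e"
      then have "\<forall>\<^sub>F n in sequentially. inverse (real (Suc n)) < e"
        using LIMSEQ_inverse_real_of_nat by (rule order_tendstoD(2)[rotated])
      moreover have "\<forall>\<^sub>F n in sequentially. N \<le> n" by (rule eventually_ge_at_top)
      ultimately show "\<forall>\<^sub>F n in sequentially. \<forall>x\<in>K. dist (G n x) (F x) < e"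
      proof eventually_elim
        case (elim n)
        show ?case
        proof
          fix x assume "x \<in> K"
          then have "\<bar>G n x - F x\<bar> \<le> inverse (real (Suc n))" using G(3) N elim by blast
          then show "dist (G n x) (F x) < e" using elim by (simp add: dist_real_def)
        qed
      qed
    qed
  qed
  moreover have "lc_tendsto P (\<lambda>n. m (G n)) 0"
    by (simp add: G lc_tendsto_const lc)
  ultimately show ?thesis by (rule lc_tendsto_unique[OF lc])
qed

text \<open>Two parallel hinges span dimension at most 1, so their second difference vanishes and
  the first difference is insensitive to parallel hinges in the base.\<close>

lemma diff_hinge_parallel:
  assumes F: "convex_on U F" and w: "w \<in> span {u}" and L: "fst ` set L \<subseteq> span {u}"
  shows "diff_op (hinge w b) m (\<lambda>x. F x + hinge_sum L x) = diff_op (hinge w b) m F"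
  using L
proof (induction L)
  case Nil
  show ?case by (simp add: hinge_sum_def)
next
  case (Cons p L)
  obtain v a where p: "p = (v, a)" by (cases p)
  let ?G = "\<lambda>x. F x + hinge_sum L x"
  have G: "convex_on U ?G"
    by (intro convex_on_add F convex_on_hinge_sum convex_U)
  have "dim {v, w} \<le> dim (span {u})"
    using w Cons.prems by (intro dim_subset) (auto simp: p)
  also have "\<dots> \<le> card {u}"
    unfolding dim_span by (rule dim_le_card') simp
  finally have "dim (fst ` set [(v, a), (w, b)]) < length [(v, a), (w, b)]" by simp
  from iter_diff_eq_0_if_length_gt_dim[OF G this]
  have "diff_op (hinge v a) (diff_op (hinge w b) m) ?G = 0" by simp
  then have "diff_op (hinge w b) m (\<lambda>x. ?G x + hinge v a x) = diff_op (hinge w b) m ?G"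
    unfolding diff_op_def[of "hinge v a"] by simp
  moreover have "(\<lambda>x. ?G x + hinge v a x) = (\<lambda>x. F x + hinge_sum (p # L) x)"
    by (simp add: p ac_simps)
  ultimately show ?case using Cons by simp
qed

text \<open>All differences along the hinges of \<open>L\<close> can be taken at the base
  \<open>F\<close>, where each is linear in the scale; cross terms are absent.\<close>

lemma parallel_hinges_affine:
  assumes F: "convex_on U F" and s: "0 \<le> s" and L: "fst ` set L \<subseteq> span {u}"
  shows "m (\<lambda>x. F x + s * hinge_sum L x) - m F = s *\<^sub>R (m (\<lambda>x. F x + hinge_sum L x) - m F)"
  using L
proof (induction L)
  case Nil
  show ?case by simp
next
  case (Cons p L)
  obtain v a where p: "p = (v, a)" by (cases p)
  have v: "v \<in> span {u}" and L: "fst ` set L \<subseteq> span {u}"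
    using Cons.prems by (auto simp: p)
  let ?L = "map (\<lambda>(u, a). (s *\<^sub>R u, s * a)) L"
  have L': "fst ` set ?L \<subseteq> span {u}"
    using L by (auto intro!: span_scale)
  have F': "convex_on U (\<lambda>x. F x + s * hinge_sum L x)"
    by (intro convex_on_add F convex_on_cmul s convex_on_hinge_sum convex_U)
  have "diff_op (\<lambda>x. s * hinge v a x) m (\<lambda>x. F x + s * hinge_sum L x)
      = s *\<^sub>R diff_op (hinge v a) m (\<lambda>x. F x + s * hinge_sum L x)"
    by (rule diff_hinge_scale[OF F' s])
  also have "\<dots> = s *\<^sub>R diff_op (hinge v a) m F"
    using diff_hinge_parallel[OF F v L', of a] by (simp only: hinge_sum_scale[OF s])
  also have "\<dots> = s *\<^sub>R diff_op (hinge v a) m (\<lambda>x. F x + hinge_sum L x)"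
    by (simp only: diff_hinge_parallel[OF F v L])
  finally have "m (\<lambda>x. F x + s * hinge_sum L x + s * hinge v a x) - m (\<lambda>x. F x + s * hinge_sum L x)
      = s *\<^sub>R (m (\<lambda>x. F x + hinge_sum L x + hinge v a x) - m (\<lambda>x. F x + hinge_sum L x))"
    unfolding diff_op_def .
  note step = this
  have eq: "(\<lambda>x. F x + s * hinge_sum (p # L) x) = (\<lambda>x. F x + s * hinge_sum L x + s * hinge v a x)"
    "(\<lambda>x. F x + hinge_sum (p # L) x) = (\<lambda>x. F x + hinge_sum L x + hinge v a x)"
    by (simp_all add: p algebra_simps)
  have tele: "X - Z = s *\<^sub>R (Y - Z)" if "X - X' = s *\<^sub>R (Y - Y')" "X' - Z = s *\<^sub>R (Y' - Z)" for X X' Y Y' Z :: 'f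
  proof -
    have "X - Z = (X - X') + (X' - Z)" by simp
    also have "\<dots> = s *\<^sub>R ((Y - Y') + (Y' - Z))" unfolding that by (simp only: scaleR_add_right)
    finally show ?thesis by simp
  qed
  show ?case unfolding eq by (rule tele[OF step Cons.IH[OF L]])
qed

lemma ridge_affine:
  assumes F: "convex_on U F" and \<phi>: "convex_on UNIV \<phi>" and s: "0 \<le> s"
  shows "m (\<lambda>x. F x + s * \<phi> (u \<bullet> x)) - m F = s *\<^sub>R (m (\<lambda>x. F x + \<phi> (u \<bullet> x)) - m F)"
proof -
  \<comment> \<open>The defect of the claim as a function of the added term. It is again a dual
    valuation, so it need only vanish on sums of hinges parallel to \<open>u\<close>.\<close>
  define n where "n G = m (\<lambda>x. F x + s * G x) - s *\<^sub>R m (\<lambda>x. F x + 1 * G x) - (1 - s) *\<^sub>R m F" for G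
  interpret n: dual_valuation U P n
    unfolding n_def[abs_def]
    by (intro dual_valuation_diff dual_valuation_add_scaled dual_valuation_const F s) simp
  have n_eq: "n G = 0 \<longleftrightarrow> m (\<lambda>x. F x + s * G x) - m F = s *\<^sub>R (m (\<lambda>x. F x + G x) - m F)" for G
    by (auto simp: n_def algebra_simps)
  have "n (\<lambda>x. \<phi> (u \<bullet> x)) = 0"
  proof (rule n.vanish_if_approx)
    show "convex_on U (\<lambda>x. \<phi> (u \<bullet> x))"
      by (rule convex_on_subset[OF hinge_cone_convex[OF hinge_cone_ridge[OF \<phi>]]]) (auto simp: convex_U)
    fix K :: "'n set" and e :: real assume K: "compact K" and e: "0 < e"
    show "\<exists>G. convex_on U G \<and> n G = 0 \<and> (\<forall>x\<in>K. \<bar>G x - \<phi> (u \<bullet> x)\<bar> \<le> e)"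
    proof (rule ridge_approx[OF \<phi> e K, where u = u])
      fix L \<alpha> \<beta> assume L: "fst ` set L \<subseteq> span {u}"
        and ap: "\<And>x. x \<in> K \<Longrightarrow> \<bar>\<phi> (u \<bullet> x) - (hinge_sum L x + (\<beta> *\<^sub>R u \<bullet> x + \<alpha>))\<bar> \<le> e"
      let ?G = "\<lambda>x. hinge_sum L x + (\<beta> *\<^sub>R u \<bullet> x + \<alpha>)"
      have "convex_on U ?G"
        by (intro convex_on_add convex_on_hinge_sum convex_on_affine_function convex_U)
      moreover have "n ?G = n (hinge_sum L)"
        by (intro n.aff convex_on_hinge_sum convex_U)
      moreover have "n (hinge_sum L) = 0"
        unfolding n_eq by (rule parallel_hinges_affine[OF F s L])
      moreover have "\<forall>x\<in>K. \<bar>?G x - \<phi> (u \<bullet> x)\<bar> \<le> e"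
        using ap by (simp only: abs_minus_commute) blast
      ultimately show ?thesis by auto
    qed
  qed
  then show ?thesis unfolding n_eq .
qed

lemma vanish_on_hinge_cone:
  assumes van: "\<And>L. m (hinge_sum L) = 0" and F: "F \<in> hinge_cone"
  shows "m F = 0"
proof (rule vanish_if_approx)
  show "convex_on U F"
    by (rule convex_on_subset[OF hinge_cone_convex[OF F]]) (auto simp: convex_U)
  fix K :: "'n set" and e :: real assume K: "compact K" and e: "0 < e"
  show "\<exists>G. convex_on U G \<and> m G = 0 \<and> (\<forall>x\<in>K. \<bar>G x - F x\<bar> \<le> e)"
  proof (rule hinge_coneE[OF F K e])
    fix L c d assume ap: "\<And>x. x \<in> K \<Longrightarrow> \<bar>F x - (hinge_sum L x + (c \<bullet> x + d))\<bar> \<le> e"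
    let ?G = "\<lambda>x. hinge_sum L x + (c \<bullet> x + d)"
    have "convex_on U ?G"
      by (intro convex_on_add convex_on_hinge_sum convex_on_affine_function convex_U)
    moreover have "m ?G = m (hinge_sum L)"
      by (intro aff convex_on_hinge_sum convex_U)
    moreover have "\<forall>x\<in>K. \<bar>?G x - F x\<bar> \<le> e"
      using ap by (simp only: abs_minus_commute) blast
    ultimately show ?thesis using van by auto
  qed
qed

text \<open>Adding multiples of the squares of the coordinates changes \<open>m\<close> affinely in each
  coefficient, so vanishing for all large coefficients forces vanishing for zero coefficients.\<close>
lemma vanish_if_quadratic_in_hinge_cone:
  assumes van: "\<And>L. m (hinge_sum L) = 0" and F: "convex_on U F" and b: "0 \<le> b"
    and mem: "(\<lambda>x. F x + b * (norm x)\<^sup>2 + (c \<bullet> x + d)) \<in> hinge_cone"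
  shows "m F = 0"
proof -
  let ?Q = "\<lambda>J s x. \<Sum>i\<in>J. s i * (i \<bullet> x)\<^sup>2"
  have Q: "?Q J s \<in> hinge_cone" if "\<And>i. i \<in> J \<Longrightarrow> 0 \<le> s i" for J :: "'n set" and s
    using that by (intro hinge_cone_sum hinge_cone_scale hinge_cone_ridge convex_square)
  have cQ: "convex_on U (\<lambda>x. F x + ?Q J s x)" if "\<And>i. i \<in> J \<Longrightarrow> b \<le> s i" for J :: "'n set" and s
    using that b order_trans
    by (intro convex_on_add F convex_on_subset[OF hinge_cone_convex[OF Q]] convex_U) (blast | simp)+
  \<comment> \<open>\<open>J\<close> holds the coordinates whose square has already been removed;
    the other coefficients stay arbitrary above \<open>b\<close>, which leaves room to vary the next
    one.\<close>
  have "\<forall>s. (\<forall>i\<in>Basis - J. b \<le> s i) \<longrightarrow> m (\<lambda>x. F x + ?Q (Basis - J) s x) = 0"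
    if "finite J" "J \<subseteq> Basis" for J
    using that
  proof (induction J)
    case empty
    show ?case
    proof (intro allI impI)
      fix s :: "'n \<Rightarrow> real" assume "\<forall>i\<in>Basis - {}. b \<le> s i"
      then have s: "\<And>i. i \<in> Basis \<Longrightarrow> b \<le> s i" by simp
      \<comment> \<open>The assumption supplies coefficient \<open>b\<close> in every coordinate;
        the surplus \<open>s i - b\<close> is a nonnegative combination of squares, itself in the
        cone.\<close>
      have "(\<lambda>x. (F x + b * (norm x)\<^sup>2 + (c \<bullet> x + d)) + ?Q Basis (\<lambda>i. s i - b) x) \<in> hinge_cone"
        using s by (intro hinge_cone_add mem Q) simp
      then have "m (\<lambda>x. (F x + b * (norm x)\<^sup>2 + (c \<bullet> x + d)) + ?Q Basis (\<lambda>i. s i - b) x) = 0"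
        by (rule vanish_on_hinge_cone[OF van])
      moreover have "m (\<lambda>x. (F x + b * (norm x)\<^sup>2 + (c \<bullet> x + d)) + ?Q Basis (\<lambda>i. s i - b) x)
          = m (\<lambda>x. F x + ?Q Basis s x)"
      proof (rule aff_eq[where a = c and b = d])
        show "convex_on U (\<lambda>x. F x + ?Q Basis s x)" by (rule cQ[OF s])
        show "(F x + b * (norm x)\<^sup>2 + (c \<bullet> x + d)) + ?Q Basis (\<lambda>i. s i - b) x
            = F x + ?Q Basis s x + (c \<bullet> x + d)" for x
          by (simp add: norm_power2_eq_sum sum_distrib_left left_diff_distrib sum_subtractf)
      qed
      ultimately show "m (\<lambda>x. F x + ?Q (Basis - {}) s x) = 0" by simp
    qed
  next
    case (insert k J)
    show ?case
    proof (intro allI impI)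
      fix s :: "'n \<Rightarrow> real" assume "\<forall>i\<in>Basis - insert k J. b \<le> s i"
      then have s: "\<And>i. i \<in> Basis - insert k J \<Longrightarrow> b \<le> s i" by simp
      define G where "G x = F x + ?Q (Basis - insert k J) s x" for x
      have G: "convex_on U G"
        unfolding G_def[abs_def] by (rule cQ[OF s])
      have split: "Basis - J = insert k (Basis - insert k J)"
        using insert by auto
      have zero: "m (\<lambda>x. G x + r * (k \<bullet> x)\<^sup>2) = 0" if r: "b \<le> r" for r
      proof -
        have "m (\<lambda>x. F x + ?Q (Basis - J) (s(k := r)) x) = 0"
          using insert.IH insert.prems s r by auto
        moreover have "?Q (Basis - J) (s(k := r)) x = r * (k \<bullet> x)\<^sup>2 + ?Q (Basis - insert k J) s x" for x
          unfolding split by (subst sum.insert) (auto intro!: sum.cong)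
        ultimately show ?thesis by (simp add: G_def ac_simps)
      qed
      define D where "D = m (\<lambda>x. G x + (k \<bullet> x)\<^sup>2) - m G"
      have "m (\<lambda>x. G x + r * (k \<bullet> x)\<^sup>2) = m G + r *\<^sub>R D" if "0 \<le> r" for r
        using ridge_affine[OF G convex_square that, of k] by (simp add: D_def algebra_simps)
      \<comment> \<open>An affine function of the coefficient with two zeros is identically 0, in
        particular at coefficient 0.\<close>
      then have "m G + b *\<^sub>R D = 0" "m G + (b + 1) *\<^sub>R D = 0"
        using zero[of b] zero[of "b + 1"] b by auto
      then have "m G = 0" by (simp add: algebra_simps)
      then show "m (\<lambda>x. F x + ?Q (Basis - insert k J) s x) = 0"
        by (simp add: G_def[abs_def])
    qed
  qed
  from this[of Basis] show ?thesis by simp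
qed

lemma vanish_on_bump:
  assumes van: "\<And>L. m (hinge_sum L) = 0" and h: "bump h R"
  shows "m (\<lambda>x. (norm x)\<^sup>2 + h x) = 0"
proof (rule vanish_if_approx)
  interpret bump h R by fact
  show "convex_on U (\<lambda>x. (norm x)\<^sup>2 + h x)"
    by (rule convex_on_subset[OF convex_plus]) (auto simp: convex_U)
  fix K :: "'n set" and e :: real assume K: "compact K" and e: "0 < e"
  obtain \<epsilon>0 where \<epsilon>0: "0 < \<epsilon>0"
    "\<And>\<epsilon> x. \<lbrakk>0 < \<epsilon>; \<epsilon> < \<epsilon>0; x \<in> K\<rbrakk> \<Longrightarrow> \<bar>smooth \<epsilon> x - ((norm x)\<^sup>2 + h x)\<bar> \<le> e"
    using smooth_tendsto[OF K e] by blast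
  define \<epsilon> where "\<epsilon> = \<epsilon>0 / 2"
  have \<epsilon>: "0 < \<epsilon>" "\<epsilon> < \<epsilon>0" using \<epsilon>0(1) by (auto simp: \<epsilon>_def)
  have c: "convex_on U (smooth \<epsilon>)"
    by (rule convex_on_subset[OF convex_smooth]) (auto simp: convex_U)
  have "m (smooth \<epsilon>) = 0"
  proof (rule smooth_in_hinge_cone[OF \<epsilon>(1)])
    fix s c' d assume "0 \<le> s" "(\<lambda>x. smooth \<epsilon> x + s * (norm x)\<^sup>2 + (c' \<bullet> x + d)) \<in> hinge_cone"
    then show ?thesis by (rule vanish_if_quadratic_in_hinge_cone[OF van c])
  qed
  then show "\<exists>G. convex_on U G \<and> m G = 0 \<and> (\<forall>x\<in>K. \<bar>G x - ((norm x)\<^sup>2 + h x)\<bar> \<le> e)"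
    using c \<epsilon>0(2)[OF \<epsilon>] by blast
qed

text \<open>The maximum of \<open>F\<close> and the squared norm minus \<open>\<rho>\<close> equals
  \<open>F\<close> on \<open>K\<close> for large \<open>\<rho>\<close>, and equals the paraboloid
  far out because \<open>F\<close> grows at most linearly. Up to the constant \<open>\<rho>\<close>
  it is the squared norm plus a bump.\<close>

lemma vanish_on_lipschitz:
  assumes van: "\<And>L. m (hinge_sum L) = 0" and F: "convex_on UNIV F" and L: "0 \<le> L"
    and lip: "\<And>x y. F y - F x \<le> L * norm (y - x)"
  shows "m F = 0"
proof (rule vanish_if_approx)
  show "convex_on U F"
    by (rule convex_on_subset[OF F]) (auto simp: convex_U)
  have Fc: "continuous_on UNIV F"
    using F by (intro convex_on_continuous) auto
  fix K :: "'n set" and e :: real assume K: "compact K" and e: "0 < e"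
  have "compact ((\<lambda>x. (norm x)\<^sup>2 - F x) ` K)"
    by (intro compact_continuous_image K continuous_intros continuous_on_subset[OF Fc]) auto
  from compact_imp_bounded[OF this] obtain \<rho> where \<rho>': "\<forall>y\<in>(\<lambda>x. (norm x)\<^sup>2 - F x) ` K. norm y \<le> \<rho>"
    unfolding bounded_iff ..
  have \<rho>: "(norm x)\<^sup>2 - \<rho> \<le> F x" if "x \<in> K" for x
    using bspec[OF \<rho>' imageI[OF that]] by (simp add: abs_le_iff)
  define h where "h x = max (F x - (norm x)\<^sup>2 + \<rho>) 0" for x
  define G where "G x = max (F x) ((norm x)\<^sup>2 + - \<rho>)" for x
  have Gh: "(norm x)\<^sup>2 + h x = G x + (0 \<bullet> x + \<rho>)" for x
    by (simp add: h_def G_def max_def)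
  have G: "convex_on UNIV G"
    unfolding G_def[abs_def]
    by (intro convex_on_max F convex_on_add hinge_cone_convex[OF hinge_cone_norm_square] convex_on_const[THEN iffD2]) simp
  have GU: "convex_on U G"
    by (rule convex_on_subset[OF G]) (auto simp: convex_U)
  \<comment> \<open>The summand 1 forces \<open>1 \<le> norm x\<close> outside the ball, so that
    constants can be absorbed into multiples of \<open>norm x\<close>.\<close>
  define R where "R = L + 1 + \<bar>F 0\<bar> + \<bar>\<rho>\<bar>"
  have "bump h R"
  proof
    show "continuous_on UNIV h"
      unfolding h_def[abs_def] by (intro continuous_intros Fc)
    show "0 \<le> h x" for x by (simp add: h_def)
    show "convex_on UNIV (\<lambda>x. (norm x)\<^sup>2 + h x)"
      unfolding Gh by (intro convex_on_add G convex_on_affine_function) simp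
    fix x :: 'n assume "x \<notin> cball 0 R"
    then have x: "R < norm x" by simp
    then have x1: "1 \<le> norm x" using L by (simp add: R_def)
    have "L * norm x + (\<bar>F 0\<bar> + \<bar>\<rho>\<bar>) * 1 \<le> L * norm x + (\<bar>F 0\<bar> + \<bar>\<rho>\<bar>) * norm x"
      using x1 by (intro add_left_mono mult_left_mono) auto
    also have "\<dots> \<le> R * norm x"
      by (simp add: R_def algebra_simps)
    also have "\<dots> \<le> norm x * norm x"
      using x by (intro mult_right_mono) auto
    finally have "F x - (norm x)\<^sup>2 + \<rho> \<le> 0"
      using lip[of x 0] by (simp add: power2_eq_square)
    then show "h x = 0" by (simp add: h_def)
  qed
  from vanish_on_bump[OF van this] have "m G = 0"
    unfolding Gh using aff[OF GU, of 0 \<rho>] by simp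
  moreover have "\<forall>x\<in>K. \<bar>G x - F x\<bar> \<le> e"
  proof
    fix x assume "x \<in> K"
    from \<rho>[OF this] show "\<bar>G x - F x\<bar> \<le> e" using e by (simp add: G_def)
  qed
  ultimately show "\<exists>G. convex_on U G \<and> m G = 0 \<and> (\<forall>x\<in>K. \<bar>G x - F x\<bar> \<le> e)"
    using GU by blast
qed

lemma vanish_if_vanish_on_hinge_sums:
  assumes van: "\<And>L. m (hinge_sum L) = 0" and F: "convex_on U F"
  shows "m F = 0"
proof (rule vanish_if_approx[OF F])
  fix K :: "'n set" and e :: real assume K: "compact K" "K \<subseteq> U" and e: "0 < e"
  show "\<exists>G. convex_on U G \<and> m G = 0 \<and> (\<forall>x\<in>K. \<bar>G x - F x\<bar> \<le> e)"
  proof (cases "K = {}")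
    case True
    then show ?thesis
      using van[of "[]"] convex_on_hinge_sum[OF convex_U, of "[]"] by blast
  next
    case False
    \<comment> \<open>The Lipschitz extension needs a convex domain; the hull stays compact and
      inside \<open>U\<close>.\<close>
    let ?K = "convex hull K"
    have K': "compact ?K" "?K \<subseteq> U" "?K \<noteq> {}"
      using K False convex_U by (auto simp: compact_convex_hull hull_minimal)
    obtain L where L: "0 \<le> L" "\<And>x y. \<lbrakk>x \<in> ?K; y \<in> ?K\<rbrakk> \<Longrightarrow> F y - F x \<le> L * norm (y - x)"
      using convex_on_lipschitz_compact[OF open_U F K'(1,2)] by blast
    have FK: "convex_on ?K F"
      by (rule convex_on_subset[OF F K'(2)]) simp
    have cK: "continuous_on ?K F"
      by (rule continuous_on_subset[OF convex_on_continuous[OF open_U F] K'(2)])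
    obtain G where G: "convex_on UNIV G" "\<And>x. x \<in> ?K \<Longrightarrow> G x = F x"
        "\<And>x y. G y - G x \<le> L * norm (y - x)"
      using convex_lipschitz_extension[OF FK cK K'(1,3) L] by blast
    have "convex_on U G"
      by (rule convex_on_subset[OF G(1)]) (auto simp: convex_U)
    moreover have "m G = 0"
      by (rule vanish_on_lipschitz[OF van G(1) L(1) G(3)])
    moreover have "\<forall>x\<in>K. \<bar>G x - F x\<bar> \<le> e"
      using G(2) e hull_subset[of K convex] by auto
    ultimately show ?thesis by blast
  qed
qed

lemma iter_diff_homogeneity_defect:
  assumes "0 \<le> t"
  shows "iter_diff (hinges L) (\<lambda>F. m (\<lambda>x. t * F x) - c *\<^sub>R m F) (\<lambda>_. 0)
    = (t ^ length L - c) *\<^sub>R iter_diff (hinges L) m (\<lambda>_. 0)"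
proof -
  have "iter_diff (hinges L) (\<lambda>F. m (\<lambda>x. t * F x)) (\<lambda>_. 0)
      = iter_diff (map (\<lambda>h x. t * h x) (hinges L)) m (\<lambda>x. t * 0)"
    by (rule iter_diff_additive_map[of "\<lambda>F x. t * F x"]) (simp add: distrib_left)
  also have "\<dots> = t ^ length L *\<^sub>R iter_diff (hinges L) m (\<lambda>_. 0)"
    using iter_diff_scale[of "\<lambda>_. 0" t L] assms convex_U by (simp add: convex_on_const del: map_map)
  finally show ?thesis
    by (simp only: iter_diff_linear scaleR_diff_left)
qed

text \<open>Scaling by 2 separates the degrees, since \<open>2 ^ j\<close> differs from
  \<open>2 ^ k\<close> for distinct exponents: only differences of order \<open>k\<close> can
  survive, and among those only the ones along independent directions.\<close>

lemma homogeneous_vanish: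
  assumes hom: "\<And>F. convex_on U F \<Longrightarrow> m (\<lambda>x. 2 * F x) = 2 ^ k *\<^sub>R m F"
    and van: "\<And>L. \<lbrakk>length L = k; distinct (map fst L); independent (fst ` set L)\<rbrakk>
      \<Longrightarrow> iter_diff (hinges L) m (\<lambda>_. 0) = 0"
    and F: "convex_on U F"
  shows "m F = 0"
proof (rule vanish_if_vanish_on_hinge_sums[OF _ F], rule hinge_sum_vanish)
  fix L :: "('n \<times> real) list"
  have c0: "convex_on U (\<lambda>_. 0)" using convex_U by (simp add: convex_on_const)
  have "iter_diff (hinges L) (\<lambda>F. m (\<lambda>x. 2 * F x) - 2 ^ k *\<^sub>R m F) (\<lambda>_. 0) = 0"
    by (rule iter_diff_closed[where A = "convex_on U"])
      (auto simp: hom intro!: c0 convex_on_add hinge_convex)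
  then have *: "(2 ^ length L - 2 ^ k) *\<^sub>R iter_diff (hinges L) m (\<lambda>_. 0) = 0"
    by (simp add: iter_diff_homogeneity_defect)
  show "iter_diff (hinges L) m (\<lambda>_. 0) = 0"
  proof (cases "length L = k \<and> distinct (map fst L) \<and> independent (fst ` set L)")
    case True
    then show ?thesis by (intro van) auto
  next
    case False
    then consider "length L \<noteq> k" | "\<not> (distinct (map fst L) \<and> independent (fst ` set L))" by blast
    then show ?thesis
    proof cases
      case 1
      then have "(2::real) ^ length L \<noteq> 2 ^ k" by simp
      then show ?thesis using * by simp
    next
      case 2
      then show ?thesis by (rule iter_diff_dependent[OF c0])
    qed
  qed
qed

end

section \<open>Vanishing on subspaces and homogeneity\<close>

lemma restr_mem_ConvF: "convex_on U F \<Longrightarrow> restr U F \<in> ConvF U"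
  using convex_on_cong[of U F "restr U F"] by (simp add: ConvF_def restr_def)

lemma restr_ConvF: "f \<in> ConvF U \<Longrightarrow> restr U f = f"
  by (auto simp: ConvF_def restr_def)

lemma dual_valuation_restr:
  fixes U :: "'a::euclidean_space set"
  assumes lc: "lc_seminorms P" and U: "open U" "convex U" and \<mu>: "VConv U P \<mu>"
  shows "dual_valuation U P (\<lambda>F. \<mu> (restr U F))"
proof
  fix F G assume FG: "convex_on U F" "convex_on U G" and min: "convex_on U (\<lambda>x. min (F x) (G x))"
  have eq: "(\<lambda>x. max (restr U F x) (restr U G x)) = restr U (\<lambda>x. max (F x) (G x))"
    "(\<lambda>x. min (restr U F x) (restr U G x)) = restr U (\<lambda>x. min (F x) (G x))"
    by (auto simp: restr_def)
  have "convex_on U (\<lambda>x. min (restr U F x) (restr U G x))"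
    unfolding eq using restr_mem_ConvF[OF min] by (simp add: ConvF_def)
  then have "\<mu> (restr U F) + \<mu> (restr U G) = \<mu> (\<lambda>x. max (restr U F x) (restr U G x)) + \<mu> (\<lambda>x. min (restr U F x) (restr U G x))"
    using \<mu> FG[THEN restr_mem_ConvF] unfolding VConv_def is_valuation_def by blast
  then show "\<mu> (restr U F) + \<mu> (restr U G)
      = \<mu> (restr U (\<lambda>x. max (F x) (G x))) + \<mu> (restr U (\<lambda>x. min (F x) (G x)))"
    unfolding eq .
next
  fix F and a :: 'a and b assume F: "convex_on U F"
  have "affine_fun (\<lambda>x. a \<bullet> x + b)" by (auto simp: affine_fun_def)
  then have "\<mu> (restr U (\<lambda>x. restr U F x + (a \<bullet> x + b))) = \<mu> (restr U F)"
    using \<mu> restr_mem_ConvF[OF F] unfolding VConv_def by blast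
  moreover have "restr U (\<lambda>x. restr U F x + (a \<bullet> x + b)) = restr U (\<lambda>x. F x + (a \<bullet> x + b))"
    by (auto simp: restr_def)
  ultimately show "\<mu> (restr U (\<lambda>x. F x + (a \<bullet> x + b))) = \<mu> (restr U F)" by simp
next
  fix F G :: "'a \<Rightarrow> real" assume "\<And>x. x \<in> U \<Longrightarrow> F x = G x"
  then have "restr U F = restr U G" by (auto simp: restr_def)
  then show "\<mu> (restr U F) = \<mu> (restr U G)" by simp
next
  fix Fs F assume Fs: "\<And>j. convex_on U (Fs j)" and F: "convex_on U F"
    and lim: "\<And>K. compact K \<Longrightarrow> K \<subseteq> U \<Longrightarrow> uniform_limit K Fs F sequentially"
  have lim': "uniform_limit K (\<lambda>j. restr U (Fs j)) (restr U F) sequentially" if "compact K" "K \<subseteq> U" for K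
  proof -
    have "x \<in> U" if "x \<in> K" for x using that \<open>K \<subseteq> U\<close> by blast
    then show ?thesis
      using lim[OF that] by (simp add: uniform_limit_iff restr_def)
  qed
  have "lc_tendsto P (\<lambda>j. \<mu> (fs j)) (\<mu> f)"
    if "\<And>j. fs j \<in> ConvF U" "f \<in> ConvF U"
      "\<And>K. compact K \<Longrightarrow> K \<subseteq> U \<Longrightarrow> uniform_limit K fs f sequentially" for fs f
    using \<mu> that by (simp add: VConv_def cont_val_def)
  from this[OF restr_mem_ConvF[OF Fs] restr_mem_ConvF[OF F] lim']
  show "lc_tendsto P (\<lambda>j. \<mu> (restr U (Fs j))) (\<mu> (restr U F))" .
qed (use lc U in auto)

section \<open>Orthogonal projections and pullbacks of valuations\<close>

lemma
  assumes E: "subspace E"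
  shows orth_proj_mem: "orth_proj E x \<in> E"
    and orth_proj_orthogonal: "z \<in> E \<Longrightarrow> (x - orth_proj E x) \<bullet> z = 0"
    and orth_proj_unique: "\<lbrakk>v \<in> E; \<And>z. z \<in> E \<Longrightarrow> (x - v) \<bullet> z = 0\<rbrakk> \<Longrightarrow> orth_proj E x = v"
proof -
  have uniq: "y = y'" if "y \<in> E \<and> (\<forall>z\<in>E. (x - y) \<bullet> z = 0)" "y' \<in> E \<and> (\<forall>z\<in>E. (x - y') \<bullet> z = 0)" for y y'
  proof -
    have "y - y' \<in> E" using that E by (simp add: subspace_diff)
    then have "(x - y) \<bullet> (y - y') = 0" "(x - y') \<bullet> (y - y') = 0" using that by blast+
    then have "(y - y') \<bullet> (y - y') = 0" by (simp add: inner_diff_left)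
    then show ?thesis by simp
  qed
  obtain y w where y: "y \<in> span E" and w: "\<And>z. z \<in> span E \<Longrightarrow> orthogonal w z" and x: "x = y + w"
    using orthogonal_subspace_decomp_exists[of E x] by metis
  have Py: "y \<in> E \<and> (\<forall>z\<in>E. (x - y) \<bullet> z = 0)"
    using y w x E by (auto simp: span_eq_iff[THEN iffD2, OF E] orthogonal_def)
  have P: "orth_proj E x \<in> E \<and> (\<forall>z\<in>E. (x - orth_proj E x) \<bullet> z = 0)"
    unfolding orth_proj_def by (rule theI[of _ y]) (use Py uniq in blast)+
  then show "orth_proj E x \<in> E" "z \<in> E \<Longrightarrow> (x - orth_proj E x) \<bullet> z = 0" by auto
  show "\<lbrakk>v \<in> E; \<And>z. z \<in> E \<Longrightarrow> (x - v) \<bullet> z = 0\<rbrakk> \<Longrightarrow> orth_proj E x = v"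
    using uniq[OF P] by blast
qed

lemma orth_proj_idem: "subspace E \<Longrightarrow> x \<in> E \<Longrightarrow> orth_proj E x = x"
  by (rule orth_proj_unique) auto

lemma linear_orth_proj:
  assumes E: "subspace E"
  shows "linear (orth_proj E)"
proof
  fix x y :: 'a and c :: real
  show "orth_proj E (x + y) = orth_proj E x + orth_proj E y"
  proof (rule orth_proj_unique[OF E])
    fix z assume "z \<in> E"
    then show "(x + y - (orth_proj E x + orth_proj E y)) \<bullet> z = 0"
      using orth_proj_orthogonal[OF E, of z x] orth_proj_orthogonal[OF E, of z y]
      by (simp add: inner_diff_left inner_add_left)
  qed (intro subspace_add E orth_proj_mem)
  show "orth_proj E (c *\<^sub>R x) = c *\<^sub>R orth_proj E x"
  proof (rule orth_proj_unique[OF E])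
    fix z assume "z \<in> E"
    then show "(c *\<^sub>R x - c *\<^sub>R orth_proj E x) \<bullet> z = 0"
      using orth_proj_orthogonal[OF E, of z x] by (simp add: inner_diff_left)
  qed (intro subspace_scale E orth_proj_mem)
qed

lemma inner_orth_proj: "subspace E \<Longrightarrow> u \<in> E \<Longrightarrow> u \<bullet> orth_proj E x = u \<bullet> x"
  using orth_proj_orthogonal[of E u x] by (simp add: inner_diff_left inner_diff_right inner_commute)

lemma inner_orth_proj_swap: "subspace E \<Longrightarrow> u \<bullet> orth_proj E x = orth_proj E u \<bullet> x"
  using inner_orth_proj[of E "orth_proj E x" u] inner_orth_proj[of E "orth_proj E u" x] orth_proj_mem[of E]
  by (simp add: inner_commute)

lemma convex_on_linear_compose:
  assumes "convex_on T F" "linear A" "convex S" "A ` S \<subseteq> T"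
  shows "convex_on S (\<lambda>x. F (A x))"
proof (rule convex_onI)
  fix t :: real and x y assume "0 < t" "t < 1" "x \<in> S" "y \<in> S"
  then show "F (A ((1 - t) *\<^sub>R x + t *\<^sub>R y)) \<le> (1 - t) * F (A x) + t * F (A y)"
    using assms(4) convex_onD[OF assms(1), of t "A x" "A y"]
    by (simp add: linear_add[OF assms(2)] linear_scale[OF assms(2)] image_subset_iff)
qed (use assms in simp)

context dual_valuation begin

text \<open>The functions being pulled back live on the whole target space, so the new valuation has
  domain \<open>UNIV\<close> whatever \<open>U\<close> is.\<close>

lemma dual_valuation_linear_compose:
  assumes A: "linear A"
  shows "dual_valuation UNIV P (\<lambda>F. m (\<lambda>x. F (A x)))"
proof
  have c: "convex_on U (\<lambda>x. F (A x))" if "convex_on UNIV F" for F :: "'a \<Rightarrow> real"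
    by (rule convex_on_linear_compose[OF that A convex_U]) simp
  fix F G :: "'a \<Rightarrow> real"
  assume "convex_on UNIV F" "convex_on UNIV G" "convex_on UNIV (\<lambda>x. min (F x) (G x))"
  then show "m (\<lambda>x. F (A x)) + m (\<lambda>x. G (A x))
      = m (\<lambda>x. max (F (A x)) (G (A x))) + m (\<lambda>x. min (F (A x)) (G (A x)))"
    using c[of "\<lambda>x. min (F x) (G x)"] by (intro val c) auto
next
  fix F :: "'a \<Rightarrow> real" and a b assume F: "convex_on UNIV F"
  show "m (\<lambda>x. F (A x) + (a \<bullet> A x + b)) = m (\<lambda>x. F (A x))"
  proof (rule aff_eq[where a = "adjoint A a" and b = b])
    show "convex_on U (\<lambda>x. F (A x))"
      by (rule convex_on_linear_compose[OF F A convex_U]) simp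
    show "F (A x) + (a \<bullet> A x + b) = F (A x) + (adjoint A a \<bullet> x + b)" for x
      using adjoint_works[OF A, of x a] by (simp add: inner_commute)
  qed
next
  fix Fs :: "nat \<Rightarrow> 'a \<Rightarrow> real" and F
  assume Fs: "\<And>j. convex_on UNIV (Fs j)" and F: "convex_on UNIV F"
    and lim: "\<And>K. compact K \<Longrightarrow> K \<subseteq> UNIV \<Longrightarrow> uniform_limit K Fs F sequentially"
  show "lc_tendsto P (\<lambda>j. m (\<lambda>x. Fs j (A x))) (m (\<lambda>x. F (A x)))"
  proof (rule cont)
    show "convex_on U (\<lambda>x. Fs j (A x))" for j
      by (rule convex_on_linear_compose[OF Fs A convex_U]) simp
    show "convex_on U (\<lambda>x. F (A x))"
      by (rule convex_on_linear_compose[OF F A convex_U]) simp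
    fix K assume K: "compact K" "K \<subseteq> U"
    have "compact (A ` K)"
      using K A by (intro compact_continuous_image linear_continuous_on) (simp add: linear_linear)
    then have "uniform_limit (A ` K) Fs F sequentially" by (intro lim) auto
    then show "uniform_limit K (\<lambda>j x. Fs j (A x)) (\<lambda>x. F (A x)) sequentially"
      by (simp add: uniform_limit_iff)
  qed
qed (use lc in auto)

text \<open>Hinges with directions in \<open>E\<close> do not change under the projection onto
  \<open>E\<close>, so every function in the alternating sum is a pullback from
  \<open>E\<close>.\<close>

lemma iter_diff_vanish_subspace:
  assumes E: "subspace E" and van: "\<And>f. convex_on E f \<Longrightarrow> m (\<lambda>x. f (orth_proj E x)) = 0"
    and L: "fst ` set L \<subseteq> E"
  shows "iter_diff (hinges L) m (\<lambda>_. 0) = 0"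
proof (rule iter_diff_closed[where A = "\<lambda>F. convex_on UNIV F \<and> (\<forall>x. F (orth_proj E x) = F x)"])
  fix F assume F: "convex_on UNIV F \<and> (\<forall>x. F (orth_proj E x) = F x)"
  then have "convex_on E F"
    using subspace_imp_convex[OF E] by (auto intro: convex_on_subset)
  from van[OF this] show "m F = 0" using F by simp
next
  fix F h assume F: "convex_on UNIV F \<and> (\<forall>x. F (orth_proj E x) = F x)" and "h \<in> set (hinges L)"
  then obtain u a where h: "h = hinge u a" and u: "u \<in> E" using L by force
  show "convex_on UNIV (\<lambda>x. F x + h x) \<and> (\<forall>x. F (orth_proj E x) + h (orth_proj E x) = F x + h x)"
  proof
    show "convex_on UNIV (\<lambda>x. F x + h x)"
      unfolding h using F by (intro convex_on_add convex_on_hinge) auto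
    show "\<forall>x. F (orth_proj E x) + h (orth_proj E x) = F x + h x"
      using F by (simp add: h hinge_def inner_orth_proj[OF E u])
  qed
qed (simp add: convex_on_const)

end

theorem theorem3p4:
  fixes U :: "'n::euclidean_space set"
    and P :: "('f::real_vector \<Rightarrow> real) set"
    and \<mu> :: "('n \<Rightarrow> real) \<Rightarrow> 'f"
    and k :: nat
  assumes "lc_seminorms P" and "open U" and "convex U"
  shows "(VConvk U P k \<mu> \<and> (\<forall>E. subspace E \<and> dim E = k \<longrightarrow> vanishes_on U \<mu> E)
            \<longrightarrow> (\<forall>f\<in>ConvF U. \<mu> f = 0))
       \<and> (VConv U P \<mu> \<longrightarrow> (dually_simple U \<mu> \<longleftrightarrow> homogeneous_of U DIM('n) \<mu>))"
proof (intro conjI impI)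
  define m where "m F = \<mu> (restr U F)" for F
  have dv: "dual_valuation U P m" if "VConv U P \<mu>"
    unfolding m_def[abs_def] by (rule dual_valuation_restr[OF assms that])
  have hom: "m (\<lambda>x. t * F x) = t ^ j *\<^sub>R m F"
    if "homogeneous_of U j \<mu>" "convex_on U F" "0 \<le> t" for j t F
  proof -
    have "restr U (\<lambda>x. t * F x) = (\<lambda>x. t * restr U F x)" by (auto simp: restr_def)
    then show ?thesis
      using that restr_mem_ConvF[OF that(2)] by (simp add: m_def homogeneous_of_def)
  qed
  have c0: "convex_on U (\<lambda>_. 0)" using assms(3) by (simp add: convex_on_const)

  show "\<forall>f\<in>ConvF U. \<mu> f = 0"
    if *: "VConvk U P k \<mu> \<and> (\<forall>E. subspace E \<and> dim E = k \<longrightarrow> vanishes_on U \<mu> E)"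
  proof
    interpret dual_valuation U P m using dv * by (simp add: VConvk_def)
    fix f assume f: "f \<in> ConvF U"
    have "m f = 0"
    proof (rule homogeneous_vanish[where k = k])
      show "convex_on U f" using f by (simp add: ConvF_def)
      show "m (\<lambda>x. 2 * F x) = 2 ^ k *\<^sub>R m F" if "convex_on U F" for F
        using * that by (intro hom) (auto simp: VConvk_def)
      fix L :: "('n \<times> real) list"
      assume L: "length L = k" "distinct (map fst L)" "independent (fst ` set L)"
      have "dim (span (fst ` set L)) = card (set (map fst L))"
        using L(3) by (simp add: dim_eq_card_independent)
      also have "\<dots> = k" using distinct_card[OF L(2)] L(1) by simp
      finally have "vanishes_on U \<mu> (span (fst ` set L))" using * by simp
      then show "iter_diff (hinges L) m (\<lambda>_. 0) = 0"
        by (intro iter_diff_vanish_subspace[OF subspace_span _ span_superset])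
          (simp add: vanishes_on_def m_def)
    qed
    then show "\<mu> f = 0" using f by (simp add: m_def restr_ConvF)
  qed

  assume \<mu>: "VConv U P \<mu>"
  interpret dual_valuation U P m by (rule dv[OF \<mu>])
  show "dually_simple U \<mu> \<longleftrightarrow> homogeneous_of U DIM('n) \<mu>"
  proof
    assume simple: "dually_simple U \<mu>"
    show "homogeneous_of U DIM('n) \<mu>"
      unfolding homogeneous_of_def
    proof (intro ballI allI impI)
      fix f and t :: real assume f: "f \<in> ConvF U" and t: "0 \<le> t"
      \<comment> \<open>The homogeneity defect for the fixed \<open>t\<close>, again a dual
        valuation; it suffices to kill its iterated differences at 0.\<close>
      define n where "n F = m (\<lambda>x. t * F x) - t ^ DIM('n) *\<^sub>R m F" for F
      interpret n: dual_valuation U P n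
        using dual_valuation_diff[OF dual_valuation_add_scaled[OF c0 t] dual_valuation_axioms]
        by (simp add: n_def[abs_def])
      have "n f = 0"
      proof (rule n.vanish_if_vanish_on_hinge_sums, rule hinge_sum_vanish)
        show "convex_on U f" using f by (simp add: ConvF_def)
        fix L :: "('n \<times> real) list"
        \<comment> \<open>Longer lists are dependent and shorter ones span a proper subspace, where
          \<open>\<mu>\<close> vanishes. At length \<open>DIM('n)\<close> the factor in the
          homogeneity defect is 0.\<close>
        have "length L = DIM('n) \<or> iter_diff (hinges L) m (\<lambda>_. 0) = 0"
        proof -
          consider "length L = DIM('n)" | "DIM('n) < length L" | "length L < DIM('n)" by linarith
          then show ?thesis
          proof cases
            case 2
            have "dim (fst ` set L) \<le> DIM('n)" by (rule dim_subset_UNIV)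
            with 2 show ?thesis using iter_diff_eq_0_if_length_gt_dim[OF c0] by force
          next
            case 3
            have "dim (span (fst ` set L)) \<le> card (fst ` set L)"
              unfolding dim_span by (rule dim_le_card') simp
            also have "\<dots> \<le> length L"
              using card_length[of "map fst L"] by simp
            finally have "span (fst ` set L) \<noteq> UNIV" using 3 by (metis dim_UNIV not_le)
            then have "vanishes_on U \<mu> (span (fst ` set L))"
              using simple by (simp add: dually_simple_def)
            then have "iter_diff (hinges L) m (\<lambda>_. 0) = 0"
              by (intro iter_diff_vanish_subspace[OF subspace_span _ span_superset])
                (simp add: vanishes_on_def m_def)
            then show ?thesis ..
          qed simp
        qed
        then show "iter_diff (hinges L) n (\<lambda>_. 0) = 0"
          unfolding n_def[abs_def] iter_diff_homogeneity_defect[OF t] by auto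
      qed
      moreover have "restr U (\<lambda>x. t * f x) = (\<lambda>x. t * f x)" "restr U f = f"
        using f by (auto simp: restr_def ConvF_def)
      ultimately show "\<mu> (\<lambda>x. t * f x) = t ^ DIM('n) *\<^sub>R \<mu> f"
        by (simp add: n_def m_def)
    qed
  next
    assume h: "homogeneous_of U DIM('n) \<mu>"
    show "dually_simple U \<mu>"
      unfolding dually_simple_def vanishes_on_def
    proof (intro allI impI)
      fix E :: "'n set" and f assume "subspace E \<and> E \<noteq> UNIV" and f: "convex_on E f"
      then have E: "subspace E" "E \<noteq> UNIV" by auto
      let ?T = "orth_proj E"
      have T: "linear ?T" by (rule linear_orth_proj[OF E(1)])
      interpret n: dual_valuation UNIV P "\<lambda>F. m (\<lambda>x. F (?T x))"
        by (rule dual_valuation_linear_compose[OF T])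
      \<comment> \<open>The projection appears twice because \<open>f\<close> is convex only on
        \<open>E\<close>: the pulled-back valuation is applied to \<open>f\<close> composed with
        \<open>?T\<close>, which is convex everywhere. Idempotence removes the repetition.\<close>
      have "m (\<lambda>x. f (?T (?T x))) = 0"
      proof (rule n.homogeneous_vanish[where k = "DIM('n)" and F = "\<lambda>x. f (?T x)"])
        show "convex_on UNIV (\<lambda>x. f (?T x))"
          by (rule convex_on_linear_compose[OF f T]) (auto simp: orth_proj_mem[OF E(1)])
        show "m (\<lambda>x. 2 * F (?T x)) = 2 ^ DIM('n) *\<^sub>R m (\<lambda>x. F (?T x))" if "convex_on UNIV F" for F
          by (intro hom[OF h] convex_on_linear_compose[OF that T convex_U]) auto
        fix L :: "('n \<times> real) list" assume L: "length L = DIM('n)"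
        let ?L = "map (\<lambda>(u, a). (?T u, a)) L"
        have "dim (fst ` set ?L) \<le> dim E"
          by (rule dim_subset) (auto simp: orth_proj_mem[OF E(1)])
        also have "dim E < length ?L"
          using E L by (metis dim_eq_full dim_subset_UNIV le_neq_implies_less length_map span_eq_iff)
        finally have "iter_diff (hinges ?L) m (\<lambda>_. 0) = 0"
          by (rule iter_diff_eq_0_if_length_gt_dim[OF c0])
        moreover have "iter_diff (hinges L) (\<lambda>F. m (\<lambda>x. F (?T x))) (\<lambda>_. 0)
            = iter_diff (map (\<lambda>F x. F (?T x)) (hinges L)) m (\<lambda>x. 0)"
          by (rule iter_diff_additive_map[of "\<lambda>F x. F (?T x)"]) simp
        moreover have "map (\<lambda>F x. F (?T x)) (hinges L) = hinges ?L"
          by (auto simp: hinge_def inner_orth_proj_swap[OF E(1)])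
        ultimately show "iter_diff (hinges L) (\<lambda>F. m (\<lambda>x. F (?T x))) (\<lambda>_. 0) = 0"
          by (simp only:)
      qed
      then show "\<mu> (restr U (\<lambda>x. f (?T x))) = 0"
        by (simp add: m_def orth_proj_idem[OF E(1) orth_proj_mem[OF E(1)]])
    qed
  qed
qed

end
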